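(* The following discrete problem is well-posed: for every $\bm f\in[H^{-1}(\Omega)]^3$ there exists at least one $(\bm u_h,\bm E_h,\bm B_h)\in\bm X_h$, $(p_h,r_h)\in\bm Y_h$ such that for all $(\bm v,\bm F,\bm C)\in\bm X_h$ and $(q,s)\in\bm Y_h$, $$L(\bm u_h;\bm u_h,\bm v)+R_e^{-1}(\nabla\bm u_h,\nabla\bm v)-S(\bm j_h\times\bm B_h,\bm v)-(p_h,\nabla\cdot\bm v)=\langle\bm f,\bm v\rangle,$$ $$S(\bm j_h,\bm F)-\alpha(\bm B_h,\nabla\times\bm F)=0,$$ $$\alpha(\nabla\times\bm E_h,\bm C)+(r_h,\nabla\cdot\bm C)=0,$$ $$-(\nabla\cdot\bm u_h,q)=0,\qquad(\nabla\cdot\bm B_h,s)=0,$$ where $\bm j_h=\bm E_h+\bm u_h\times\bm B_h$; moreover, there is $\varepsilon>0$ such that the solution is unique whenever $\|\bm f\|_{-1}\le\varepsilon$.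
   Context: $\Omega\subset\mathbb R^3$ is a bounded contractible Lipschitz polyhedron. $(\cdot,\cdot)$, $\|\cdot\|$: $L^2(\Omega)$ inner product and norm. $R_e,R_m,S>0$ are constants, $\alpha:=SR_m^{-1}$, and $\|\bm f\|_{-1}:=\sup_{0\ne\bm v\in[H_0^1(\Omega)]^3}\langle\bm f,\bm v\rangle/\|\nabla\bm v\|$. The trilinear form is $L(\bm w;\bm u,\bm v):=\frac12[((\bm w\cdot\nabla)\bm u,\bm v)-((\bm w\cdot\nabla)\bm v,\bm u)]$. $\mathcal T_h$ belongs to a shape-regular, quasi-uniform family of simplicial triangulations of $\Omega$. $H_0^h(\mathrm{grad},\Omega)\xrightarrow{\nabla}H_0^h(\mathrm{curl},\Omega)\xrightarrow{\nabla\times}H_0^h(\mathrm{div},\Omega)\xrightarrow{\nabla\cdot}L_0^{2,h}(\Omega)$ is a standard conforming finite element de Rham complex on $\mathcal T_h$ (Lagrange, Nédélec, Raviart–Thomas or BDM, discontinuous elements) with homogeneous boundary conditions (zero trace, zero tangential trace, zero normal trace, zero mean, respectively); it is exact. $\bm V_h\subset[H_0^1(\Omega)]^3$ and $Q_h\subset L_0^2(\Omega)$ are an inf-sup stable Stokes finite element pair (e.g. Taylor–Hood). $$\bm X_h:=\bm V_h\times H_0^h(\mathrm{curl},\Omega)\times H_0^h(\mathrm{div},\Omega),\qquad\bm Y_h:=Q_h\times L_0^{2,h}(\Omega).$$ *)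

theory Defs
  imports "HOL-Analysis.Analysis"
begin

type_synonym scalar_field = "real^3 \<Rightarrow> real"
type_synonym vector_field = "real^3 \<Rightarrow> real^3"
type_synonym mesh = "(real^3) set set"

section \<open>Domain and triangulations\<close>

text \<open>Near every boundary point the domain is, in some rotated coordinate system with vertical
  direction \<open>e\<close>, the part of a ball strictly above the graph of a Lipschitz function of the
  horizontal component \<open>y - (y \<bullet> e) e\<close>.\<close>

definition lipschitz_boundary :: "(real^3) set \<Rightarrow> bool" where
  "lipschitz_boundary \<Omega> \<longleftrightarrow>
     (\<forall>x\<in>frontier \<Omega>. \<exists>e r M. \<exists>g :: real^3 \<Rightarrow> real.
        norm e = 1 \<and> r > 0 \<and> lipschitz_on M UNIV g \<and>
        (\<forall>y\<in>ball x r. y \<in> \<Omega> \<longleftrightarrow> g (y - (y \<bullet> e) *\<^sub>R e) < y \<bullet> e))"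

text \<open>The library notion \<open>polytope\<close> is convex; a polyhedral domain is a finite union of these,
  up to its boundary.\<close>

definition lipschitz_polyhedron :: "(real^3) set \<Rightarrow> bool" where
  "lipschitz_polyhedron \<Omega> \<longleftrightarrow>
     open \<Omega> \<and> \<Omega> \<noteq> {} \<and> lipschitz_boundary \<Omega> \<and>
     (\<exists>P. finite P \<and> (\<forall>K\<in>P. polytope K) \<and> closure \<Omega> = \<Union>P)"

definition simplicial_mesh :: "(real^3) set \<Rightarrow> mesh \<Rightarrow> bool" where
  "simplicial_mesh \<Omega> T \<longleftrightarrow> triangulation T \<and> (\<forall>K\<in>T. 3 simplex K) \<and> \<Union>T = closure \<Omega>"

definition inradius :: "(real^3) set \<Rightarrow> real" where
  "inradius K = Sup {r. 0 \<le> r \<and> (\<exists>c. cball c r \<subseteq> K)}"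

definition mesh_size :: "mesh \<Rightarrow> real" where
  "mesh_size T = Max (diameter ` T)"

definition shape_regular :: "mesh set \<Rightarrow> bool" where
  "shape_regular F \<longleftrightarrow> (\<exists>\<sigma>>0. \<forall>T\<in>F. \<forall>K\<in>T. diameter K \<le> \<sigma> * inradius K)"

definition quasi_uniform :: "mesh set \<Rightarrow> bool" where
  "quasi_uniform F \<longleftrightarrow> (\<exists>\<tau>>0. \<forall>T\<in>F. \<forall>K\<in>T. mesh_size T \<le> \<tau> * diameter K)"

section \<open>Square integrable functions and weak derivatives\<close>

text \<open>Elements of \<open>L\<^sup>2\<close>-type spaces are represented by functions on the whole space, only their
  values almost everywhere on \<open>\<Omega>\<close> being relevant. Equality in these spaces is equality almost
  everywhere on \<open>\<Omega>\<close>.\<close>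

definition ae_eq :: "(real^3) set \<Rightarrow> (real^3 \<Rightarrow> 'a) \<Rightarrow> (real^3 \<Rightarrow> 'a) \<Rightarrow> bool" where
  "ae_eq \<Omega> f g \<longleftrightarrow> (AE x in lebesgue_on \<Omega>. f x = g x)"

definition L2 :: "(real^3) set \<Rightarrow> (real^3 \<Rightarrow> 'a::euclidean_space) set" where
  "L2 \<Omega> = {f. f \<in> borel_measurable (lebesgue_on \<Omega>) \<and>
              integrable (lebesgue_on \<Omega>) (\<lambda>x. (norm (f x))\<^sup>2)}"

definition l2_inner ::
    "(real^3) set \<Rightarrow> (real^3 \<Rightarrow> 'a::euclidean_space) \<Rightarrow> (real^3 \<Rightarrow> 'a) \<Rightarrow> real" where
  "l2_inner \<Omega> f g = (\<integral>x. f x \<bullet> g x \<partial>lebesgue_on \<Omega>)"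

definition l2_norm :: "(real^3) set \<Rightarrow> (real^3 \<Rightarrow> 'a::euclidean_space) \<Rightarrow> real" where
  "l2_norm \<Omega> f = sqrt (l2_inner \<Omega> f f)"

definition L2_mean_zero :: "(real^3) set \<Rightarrow> scalar_field set" where
  "L2_mean_zero \<Omega> = {q \<in> L2 \<Omega>. (\<integral>x. q x \<partial>lebesgue_on \<Omega>) = 0}"

definition partial :: "3 \<Rightarrow> scalar_field \<Rightarrow> scalar_field" where
  "partial i f x = frechet_derivative f (at x) (axis i 1)"

text \<open>Infinitely differentiable: the largest class of differentiable functions that is closed under
  taking partial derivatives.\<close>

coinductive smooth :: "scalar_field \<Rightarrow> bool" where
  "(\<forall>x. f differentiable (at x)) \<Longrightarrow> (\<forall>i. smooth (partial i f)) \<Longrightarrow> smooth f"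

definition smooth_vec :: "vector_field \<Rightarrow> bool" where
  "smooth_vec \<phi> \<longleftrightarrow> (\<forall>i. smooth (\<lambda>x. \<phi> x $ i))"

definition grad :: "scalar_field \<Rightarrow> vector_field" where
  "grad \<phi> x = (\<chi> i. partial i \<phi> x)"

definition curl :: "vector_field \<Rightarrow> vector_field" where
  "curl \<phi> x = vector
     [partial 2 (\<lambda>y. \<phi> y $ 3) x - partial 3 (\<lambda>y. \<phi> y $ 2) x,
      partial 3 (\<lambda>y. \<phi> y $ 1) x - partial 1 (\<lambda>y. \<phi> y $ 3) x,
      partial 1 (\<lambda>y. \<phi> y $ 2) x - partial 2 (\<lambda>y. \<phi> y $ 1) x]"

definition compact_support_in :: "(real^3) set \<Rightarrow> (real^3 \<Rightarrow> 'a::zero) \<Rightarrow> bool" where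
  "compact_support_in \<Omega> \<phi> \<longleftrightarrow>
     compact (closure {x. \<phi> x \<noteq> 0}) \<and> closure {x. \<phi> x \<noteq> 0} \<subseteq> \<Omega>"

definition test_functions :: "(real^3) set \<Rightarrow> scalar_field set" where
  "test_functions \<Omega> = {\<phi>. smooth \<phi> \<and> compact_support_in \<Omega> \<phi>}"

definition test_vec :: "(real^3) set \<Rightarrow> vector_field set" where
  "test_vec \<Omega> = {\<phi>. smooth_vec \<phi> \<and> compact_support_in \<Omega> \<phi>}"

definition has_weak_grad :: "(real^3) set \<Rightarrow> scalar_field \<Rightarrow> vector_field \<Rightarrow> bool" where
  "has_weak_grad \<Omega> u g \<longleftrightarrow> g \<in> L2 \<Omega> \<and>
     (\<forall>\<phi>\<in>test_functions \<Omega>. \<forall>i.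
        l2_inner \<Omega> u (partial i \<phi>) = - l2_inner \<Omega> (\<lambda>x. g x $ i) \<phi>)"

definition has_weak_curl :: "(real^3) set \<Rightarrow> vector_field \<Rightarrow> vector_field \<Rightarrow> bool" where
  "has_weak_curl \<Omega> E w \<longleftrightarrow> w \<in> L2 \<Omega> \<and>
     (\<forall>\<phi>\<in>test_vec \<Omega>. l2_inner \<Omega> E (curl \<phi>) = l2_inner \<Omega> w \<phi>)"

definition has_weak_div :: "(real^3) set \<Rightarrow> vector_field \<Rightarrow> scalar_field \<Rightarrow> bool" where
  "has_weak_div \<Omega> B d \<longleftrightarrow> d \<in> L2 \<Omega> \<and>
     (\<forall>\<phi>\<in>test_functions \<Omega>. l2_inner \<Omega> B (grad \<phi>) = - l2_inner \<Omega> d \<phi>)"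

text \<open>Weak derivatives are unique up to null sets; the following pick a representative.\<close>

definition weak_grad :: "(real^3) set \<Rightarrow> scalar_field \<Rightarrow> vector_field" where
  "weak_grad \<Omega> u = (SOME g. has_weak_grad \<Omega> u g)"

definition weak_curl :: "(real^3) set \<Rightarrow> vector_field \<Rightarrow> vector_field" where
  "weak_curl \<Omega> E = (SOME w. has_weak_curl \<Omega> E w)"

definition weak_div :: "(real^3) set \<Rightarrow> vector_field \<Rightarrow> scalar_field" where
  "weak_div \<Omega> B = (SOME d. has_weak_div \<Omega> B d)"

text \<open>Row \<open>i\<close> of the Jacobian is the gradient of component \<open>i\<close>, so the matrix-vector product with
  \<open>w\<close> is \<open>(w \<cdot> \<nabla>) u\<close>. The inner product on matrices is the Frobenius one.\<close>

definition weak_jacobian :: "(real^3) set \<Rightarrow> vector_field \<Rightarrow> real^3 \<Rightarrow> real^3^3" where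
  "weak_jacobian \<Omega> u x = (\<chi> i. weak_grad \<Omega> (\<lambda>y. u y $ i) x)"

section \<open>Function spaces with homogeneous boundary conditions\<close>

definition H01 :: "(real^3) set \<Rightarrow> scalar_field set" where
  "H01 \<Omega> = {u \<in> L2 \<Omega>. (\<exists>g. has_weak_grad \<Omega> u g) \<and>
     (\<exists>\<phi>. (\<forall>n::nat. \<phi> n \<in> test_functions \<Omega>) \<and>
        (\<lambda>n. l2_norm \<Omega> (\<lambda>x. \<phi> n x - u x)) \<longlonglongrightarrow> 0 \<and>
        (\<lambda>n. l2_norm \<Omega> (\<lambda>x. grad (\<phi> n) x - weak_grad \<Omega> u x)) \<longlonglongrightarrow> 0)}"

definition H01_vec :: "(real^3) set \<Rightarrow> vector_field set" where
  "H01_vec \<Omega> = {v. \<forall>i. (\<lambda>x. v x $ i) \<in> H01 \<Omega>}"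

text \<open>The tangential and normal traces are the functionals given by Green's formulas, i.e.
  \<open>\<langle>n \<times> E, \<phi>\<rangle> = (\<nabla> \<times> E, \<phi>) - (E, \<nabla> \<times> \<phi>)\<close> and \<open>\<langle>B \<cdot> n, \<phi>\<rangle> = (\<nabla> \<cdot> B, \<phi>) + (B, \<nabla> \<phi>)\<close> for \<open>\<phi>\<close> smooth up
  to the boundary; the spaces below consist of the fields for which they vanish.\<close>

definition H0_curl :: "(real^3) set \<Rightarrow> vector_field set" where
  "H0_curl \<Omega> = {E \<in> L2 \<Omega>. (\<exists>w. has_weak_curl \<Omega> E w) \<and>
     (\<forall>\<phi>. smooth_vec \<phi> \<longrightarrow> l2_inner \<Omega> (weak_curl \<Omega> E) \<phi> - l2_inner \<Omega> E (curl \<phi>) = 0)}"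

definition H0_div :: "(real^3) set \<Rightarrow> vector_field set" where
  "H0_div \<Omega> = {B \<in> L2 \<Omega>. (\<exists>d. has_weak_div \<Omega> B d) \<and>
     (\<forall>\<phi>. smooth \<phi> \<longrightarrow> l2_inner \<Omega> (weak_div \<Omega> B) \<phi> + l2_inner \<Omega> B (grad \<phi>) = 0)}"

text \<open>Bounded linear functionals on \<open>[H\<^sub>0\<^sup>1(\<Omega>)]\<^sup>3\<close>, normed by \<open>v \<mapsto> \<parallel>\<nabla>v\<parallel>\<close>. Boundedness together with
  linearity forces such a functional to respect equality almost everywhere.\<close>

definition Hminus1 :: "(real^3) set \<Rightarrow> (vector_field \<Rightarrow> real) set" where
  "Hminus1 \<Omega> = {f.
     (\<forall>u\<in>H01_vec \<Omega>. \<forall>v\<in>H01_vec \<Omega>. f (\<lambda>x. u x + v x) = f u + f v) \<and>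
     (\<forall>c. \<forall>v\<in>H01_vec \<Omega>. f (\<lambda>x. c *\<^sub>R v x) = c * f v) \<and>
     (\<exists>M. \<forall>v\<in>H01_vec \<Omega>. \<bar>f v\<bar> \<le> M * l2_norm \<Omega> (weak_jacobian \<Omega> v))}"

definition norm_Hminus1 :: "(real^3) set \<Rightarrow> (vector_field \<Rightarrow> real) \<Rightarrow> real" where
  "norm_Hminus1 \<Omega> f =
     Sup {f v / l2_norm \<Omega> (weak_jacobian \<Omega> v) | v. v \<in> H01_vec \<Omega> \<and> \<not> ae_eq \<Omega> v (\<lambda>x. 0)}"

section \<open>Finite element spaces\<close>

definition poly_deg :: "nat \<Rightarrow> scalar_field set" where
  "poly_deg k = {p. \<exists>c :: nat \<Rightarrow> nat \<Rightarrow> nat \<Rightarrow> real. \<forall>x.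
     p x = (\<Sum>(a, b, d) \<in> {(a, b, d). a + b + d \<le> k}. c a b d * x$1 ^ a * x$2 ^ b * x$3 ^ d)}"

definition poly_deg_vec :: "nat \<Rightarrow> vector_field set" where
  "poly_deg_vec k = {p. \<forall>i. (\<lambda>x. p x $ i) \<in> poly_deg k}"

definition piecewise :: "mesh \<Rightarrow> (real^3 \<Rightarrow> 'a) set \<Rightarrow> (real^3 \<Rightarrow> 'a) set" where
  "piecewise T P = {f. \<forall>K\<in>T. \<exists>p\<in>P. ae_eq K f p}"

text \<open>Local shape functions of the Nedelec elements of the first kind and of the Raviart--Thomas
  elements, for \<open>k \<ge> 1\<close> (so that \<open>k = 1\<close> is the lowest order). Taking the second summand from the
  full space of polynomials of degree at most \<open>k - 1\<close> instead of the homogeneous ones of degree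
  \<open>k - 1\<close> gives the same sum.\<close>

definition nedelec1_shape :: "nat \<Rightarrow> vector_field set" where
  "nedelec1_shape k = {\<lambda>x. a x + cross3 x (b x) | a b. a \<in> poly_deg_vec (k - 1) \<and> b \<in> poly_deg_vec (k - 1)}"

definition raviart_thomas_shape :: "nat \<Rightarrow> vector_field set" where
  "raviart_thomas_shape k = {\<lambda>x. a x + b x *\<^sub>R x | a b. a \<in> poly_deg_vec (k - 1) \<and> b \<in> poly_deg (k - 1)}"

definition Lagrange :: "(real^3) set \<Rightarrow> nat \<Rightarrow> mesh \<Rightarrow> scalar_field set" where
  "Lagrange \<Omega> k T = H01 \<Omega> \<inter> piecewise T (poly_deg k)"

definition Nedelec1 :: "(real^3) set \<Rightarrow> nat \<Rightarrow> mesh \<Rightarrow> vector_field set" where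
  "Nedelec1 \<Omega> k T = H0_curl \<Omega> \<inter> piecewise T (nedelec1_shape k)"

definition Nedelec2 :: "(real^3) set \<Rightarrow> nat \<Rightarrow> mesh \<Rightarrow> vector_field set" where
  "Nedelec2 \<Omega> k T = H0_curl \<Omega> \<inter> piecewise T (poly_deg_vec k)"

definition RT :: "(real^3) set \<Rightarrow> nat \<Rightarrow> mesh \<Rightarrow> vector_field set" where
  "RT \<Omega> k T = H0_div \<Omega> \<inter> piecewise T (raviart_thomas_shape k)"

definition BDM :: "(real^3) set \<Rightarrow> nat \<Rightarrow> mesh \<Rightarrow> vector_field set" where
  "BDM \<Omega> k T = H0_div \<Omega> \<inter> piecewise T (poly_deg_vec k)"

definition DG :: "(real^3) set \<Rightarrow> nat \<Rightarrow> mesh \<Rightarrow> scalar_field set" where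
  "DG \<Omega> k T = L2_mean_zero \<Omega> \<inter> piecewise T (poly_deg k)"

text \<open>The four standard sequences of these elements ending in discontinuous elements of
  degree \<open>k - 1\<close>.\<close>

inductive standard_de_rham ::
    "(real^3) set \<Rightarrow> (mesh \<Rightarrow> scalar_field set) \<Rightarrow> (mesh \<Rightarrow> vector_field set) \<Rightarrow>
     (mesh \<Rightarrow> vector_field set) \<Rightarrow> (mesh \<Rightarrow> scalar_field set) \<Rightarrow> bool" for \<Omega> where
  "k \<ge> 1 \<Longrightarrow> standard_de_rham \<Omega> (Lagrange \<Omega> k) (Nedelec1 \<Omega> k) (RT \<Omega> k) (DG \<Omega> (k - 1))"
| "k \<ge> 1 \<Longrightarrow> standard_de_rham \<Omega> (Lagrange \<Omega> (k + 1)) (Nedelec2 \<Omega> k) (RT \<Omega> k) (DG \<Omega> (k - 1))"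
| "k \<ge> 1 \<Longrightarrow> standard_de_rham \<Omega> (Lagrange \<Omega> (k + 1)) (Nedelec1 \<Omega> (k + 1)) (BDM \<Omega> k) (DG \<Omega> (k - 1))"
| "k \<ge> 1 \<Longrightarrow> standard_de_rham \<Omega> (Lagrange \<Omega> (k + 2)) (Nedelec2 \<Omega> (k + 1)) (BDM \<Omega> k) (DG \<Omega> (k - 1))"

definition exact_complex ::
    "(real^3) set \<Rightarrow> scalar_field set \<Rightarrow> vector_field set \<Rightarrow> vector_field set \<Rightarrow> scalar_field set \<Rightarrow> bool" where
  "exact_complex \<Omega> G N D W \<longleftrightarrow>
     (\<forall>\<phi>\<in>G. weak_grad \<Omega> \<phi> \<in> N) \<and> (\<forall>E\<in>N. weak_curl \<Omega> E \<in> D) \<and> (\<forall>B\<in>D. weak_div \<Omega> B \<in> W) \<and>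
     (\<forall>\<phi>\<in>G. ae_eq \<Omega> (weak_grad \<Omega> \<phi>) (\<lambda>x. 0) \<longleftrightarrow> ae_eq \<Omega> \<phi> (\<lambda>x. 0)) \<and>
     (\<forall>E\<in>N. ae_eq \<Omega> (weak_curl \<Omega> E) (\<lambda>x. 0) \<longleftrightarrow> (\<exists>\<phi>\<in>G. ae_eq \<Omega> E (weak_grad \<Omega> \<phi>))) \<and>
     (\<forall>B\<in>D. ae_eq \<Omega> (weak_div \<Omega> B) (\<lambda>x. 0) \<longleftrightarrow> (\<exists>E\<in>N. ae_eq \<Omega> B (weak_curl \<Omega> E))) \<and>
     (\<forall>s\<in>W. \<exists>B\<in>D. ae_eq \<Omega> s (weak_div \<Omega> B))"

definition linear_space :: "(real^3 \<Rightarrow> 'a::real_vector) set \<Rightarrow> bool" where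
  "linear_space X \<longleftrightarrow> (\<lambda>x. 0) \<in> X \<and>
     (\<forall>f\<in>X. \<forall>g\<in>X. (\<lambda>x. f x + g x) \<in> X) \<and> (\<forall>c. \<forall>f\<in>X. (\<lambda>x. c *\<^sub>R f x) \<in> X)"

text \<open>Conforming finite element velocity and pressure spaces. They are piecewise polynomial on the
  mesh or, to include macro-elements such as Scott--Vogelius on split meshes, on a simplicial
  refinement of it.\<close>

definition stokes_fe_pair ::
    "(real^3) set \<Rightarrow> mesh \<Rightarrow> vector_field set \<Rightarrow> scalar_field set \<Rightarrow> bool" where
  "stokes_fe_pair \<Omega> T V Q \<longleftrightarrow>
     linear_space V \<and> V \<subseteq> H01_vec \<Omega> \<and> linear_space Q \<and> Q \<subseteq> L2_mean_zero \<Omega> \<and>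
     (\<exists>T' m. simplicial_mesh \<Omega> T' \<and> (\<forall>K'\<in>T'. \<exists>K\<in>T. K' \<subseteq> K) \<and>
        V \<subseteq> piecewise T' (poly_deg_vec m) \<and> Q \<subseteq> piecewise T' (poly_deg m))"

text \<open>The supremum formally includes \<open>v = 0\<close>, where the quotient is \<open>0 / 0 = 0\<close>. This changes
  nothing if \<open>V T \<noteq> {0}\<close> (the supremum is then nonnegative anyway), and gives the supremum the value
  \<open>0\<close> otherwise.\<close>

definition inf_sup_stable ::
    "(real^3) set \<Rightarrow> mesh set \<Rightarrow> (mesh \<Rightarrow> vector_field set) \<Rightarrow> (mesh \<Rightarrow> scalar_field set) \<Rightarrow> bool" where
  "inf_sup_stable \<Omega> F V Q \<longleftrightarrow>
     (\<exists>\<beta>>0. \<forall>T\<in>F. \<forall>q\<in>Q T.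
        \<beta> * l2_norm \<Omega> q \<le>
        (SUP v\<in>V T. l2_inner \<Omega> (weak_div \<Omega> v) q / l2_norm \<Omega> (weak_jacobian \<Omega> v)))"

section \<open>The discrete stationary MHD problem\<close>

definition trilinear :: "(real^3) set \<Rightarrow> vector_field \<Rightarrow> vector_field \<Rightarrow> vector_field \<Rightarrow> real" where
  "trilinear \<Omega> w u v =
     1/2 * (l2_inner \<Omega> (\<lambda>x. weak_jacobian \<Omega> u x *v w x) v -
            l2_inner \<Omega> (\<lambda>x. weak_jacobian \<Omega> v x *v w x) u)"

text \<open>The arguments \<open>V\<close>, \<open>N\<close>, \<open>D\<close>, \<open>Q\<close>, \<open>W\<close> are the discrete spaces of velocities, electric fields,
  magnetic fields, pressures and multipliers \<open>r\<close>.\<close>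

definition mhd_solution ::
    "(real^3) set \<Rightarrow> real \<Rightarrow> real \<Rightarrow> real \<Rightarrow>
     vector_field set \<Rightarrow> vector_field set \<Rightarrow> vector_field set \<Rightarrow> scalar_field set \<Rightarrow> scalar_field set \<Rightarrow>
     (vector_field \<Rightarrow> real) \<Rightarrow>
     vector_field \<Rightarrow> vector_field \<Rightarrow> vector_field \<Rightarrow> scalar_field \<Rightarrow> scalar_field \<Rightarrow> bool" where
  "mhd_solution \<Omega> R\<^sub>e R\<^sub>m S V N D Q W f u E B p r \<longleftrightarrow>
     u \<in> V \<and> E \<in> N \<and> B \<in> D \<and> p \<in> Q \<and> r \<in> W \<and>
     (let j = (\<lambda>x. E x + cross3 (u x) (B x)); \<alpha> = S / R\<^sub>m in
       (\<forall>v\<in>V. trilinear \<Omega> u u v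
            + 1 / R\<^sub>e * l2_inner \<Omega> (weak_jacobian \<Omega> u) (weak_jacobian \<Omega> v)
            - S * l2_inner \<Omega> (\<lambda>x. cross3 (j x) (B x)) v
            - l2_inner \<Omega> p (weak_div \<Omega> v) = f v) \<and>
       (\<forall>F\<in>N. S * l2_inner \<Omega> j F - \<alpha> * l2_inner \<Omega> B (weak_curl \<Omega> F) = 0) \<and>
       (\<forall>C\<in>D. \<alpha> * l2_inner \<Omega> (weak_curl \<Omega> E) C + l2_inner \<Omega> r (weak_div \<Omega> C) = 0) \<and>
       (\<forall>q\<in>Q. - l2_inner \<Omega> (weak_div \<Omega> u) q = 0) \<and>
       (\<forall>s\<in>W. l2_inner \<Omega> (weak_div \<Omega> B) s = 0))"

end

theory Submission
  imports Defs "HOL-Homology.Brouwer_Degree" "HOL-Computational_Algebra.Polynomial" "HOL-Real_Asymp.Real_Asymp"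
begin

text \<open>
  Up to null sets all five discrete spaces consist of piecewise polynomials on a finite mesh. They
  are therefore finite-dimensional and their elements are essentially bounded, so that every product
  in the equations is integrable and all bounds may depend on the mesh. What remains is an energy
  identity, a topological existence argument and a perturbation argument.

  \<^emph>\<open>A priori bounds.\<close> The form \<open>L\<close> is skew in its last two arguments and \<open>(j \<times> B) \<bullet> u = - j \<bullet> (u \<times> B)\<close>.
  Testing the first equation with \<open>u\<close>, the second with \<open>E\<close> and the third with \<open>\<nabla> \<times> E\<close> hence gives
  \<open>\<nabla> \<times> E = 0\<close> and \<open>R\<^sub>e\<^sup>-\<^sup>1 \<parallel>\<nabla>u\<parallel>\<^sup>2 + S \<parallel>j\<parallel>\<^sup>2 = \<langle>f, u\<rangle>\<close> (\<open>solution_curl_zero\<close>, \<open>solution_energy\<close>). Exactness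
  of the complex yields \<open>r = 0\<close>, \<open>\<nabla> \<cdot> B = 0\<close> and a bounded linear right inverse \<open>A\<close> of the curl on the
  divergence-free fields (\<open>curl_lift\<close>); the second equation tested with \<open>A B\<close> bounds \<open>B\<close> by
  \<open>j\<close> (\<open>magnetic_bound\<close>), and \<open>E = j - u \<times> B\<close> is then bounded too.

  \<^emph>\<open>Existence.\<close> One looks for \<open>u\<close> discretely divergence-free, \<open>E\<close> in the kernel of the curl and \<open>B\<close>
  in the kernel of the divergence, which removes both multipliers. The second equation splits into
  its restriction to curl-free test functions and \<open>\<alpha> (B, B') = S (j, A B')\<close> for all divergence-free \<open>B'\<close>.
  If the last equation gets a small weight, the resulting map on coordinates points outwards on
  a large sphere. A continuous map with this property has a zero, because otherwise the identity of
  the sphere would be homotopic to a constant (\<open>acute_angle_zero\<close>, \<open>galerkin_solution\<close>,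
  \<open>reduced_solution_exists\<close>). The pressure exists because a linear form that vanishes on the
  common kernel of finitely many linear forms is a combination of them (\<open>linear_form_in_span\<close>).

  \<^emph>\<open>Uniqueness.\<close> Testing the difference of the equations of two solutions with the difference of the
  solutions gives \<open>R\<^sub>e\<^sup>-\<^sup>1 \<parallel>\<nabla>\<delta>u\<parallel>\<^sup>2 + S \<parallel>\<delta>j\<parallel>\<^sup>2\<close> on the left, and on the right terms that are quadratic in the
  differences with a solution as third factor (\<open>solutions_difference_identity\<close>). As the solutions are
  \<open>O(\<epsilon>)\<close>, the left side absorbs the right one for small \<open>\<epsilon>\<close> (\<open>small_data_uniqueness\<close>). Inf-sup
  stability then identifies the pressures.

  \<^emph>\<open>Weak derivatives.\<close> They are arbitrary representatives, so even their linearity almost everywhere needs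
  the fundamental lemma of the calculus of variations, for which smooth bump functions are built
  from \<open>exp (- 1 / t)\<close>. The Poincare inequality, which makes \<open>\<parallel>\<nabla>u\<parallel>\<close> a norm on the velocities, comes from testing
  the weak derivative of \<open>u\<close> with \<open>x\<^sub>1 \<phi>\<close> and letting \<open>\<phi>\<close> tend to \<open>u\<close>.
\<close>

section \<open>Zeros of maps pointing outwards on a sphere\<close>

definition coord_sphere :: "nat \<Rightarrow> (nat \<Rightarrow> real) set" where
  "coord_sphere m = {x. (\<Sum>i\<le>m. (x i)\<^sup>2) = 1 \<and> (\<forall>i>m. x i = 0)}"

definition normalise :: "nat \<Rightarrow> (nat \<Rightarrow> real) \<Rightarrow> nat \<Rightarrow> real" where
  "normalise m y i = (if i \<le> m then y i / sqrt (\<Sum>j\<le>m. (y j)\<^sup>2) else 0)"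

lemma nsphere_coord_sphere: "nsphere m = top_of_set (coord_sphere m)"
  by (simp add: nsphere coord_sphere_def euclidean_product_topology)

lemma normalise_in_sphere:
  assumes "\<exists>i\<le>m. y i \<noteq> 0"
  shows "normalise m y \<in> coord_sphere m"
proof -
  from assms obtain i where "i \<le> m" "y i \<noteq> 0" by auto
  then have "0 < (\<Sum>j\<le>m. (y j)\<^sup>2)" by (intro sum_pos2[of _ i]) auto
  then have "(\<Sum>i\<le>m. (y i / sqrt (\<Sum>j\<le>m. (y j)\<^sup>2))\<^sup>2) = 1"
    by (simp add: power_divide sum_divide_distrib[symmetric])
  then show ?thesis
    by (simp add: coord_sphere_def normalise_def)
qed

lemma normalise_sphere_id: "x \<in> coord_sphere m \<Longrightarrow> normalise m x = x"
  by (auto simp: coord_sphere_def normalise_def fun_eq_iff)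

text \<open>Radial projection turns a deformation that avoids the origin into a homotopy of the sphere.\<close>

lemma homotopic_normalised:
  assumes cont: "\<And>i. i \<le> m \<Longrightarrow> continuous_on UNIV (\<lambda>z. h z i)"
    and nz: "\<And>t x. \<lbrakk>t \<in> {0..1}; x \<in> coord_sphere m\<rbrakk> \<Longrightarrow> \<exists>i\<le>m. h (t, x) i \<noteq> 0"
  shows "homotopic_with (\<lambda>x. True) (nsphere m) (nsphere m)
           (\<lambda>x. normalise m (h (0::real, x))) (\<lambda>x. normalise m (h (1, x)))"
proof -
  let ?Z = "{0..1::real} \<times> coord_sphere m"
  have "continuous_on ?Z (\<lambda>z. normalise m (h z))"
  proof (rule continuous_on_coordinatewise_then_product)
    fix i
    show "continuous_on ?Z (\<lambda>z. normalise m (h z) i)"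
    proof (cases "i \<le> m")
      case True
      have "(\<Sum>j\<le>m. (h z j)\<^sup>2) \<noteq> 0" if "z \<in> ?Z" for z
        using nz[of "fst z" "snd z"] that by (auto simp: sum_nonneg_eq_0_iff)
      then have "continuous_on ?Z (\<lambda>z. h z i / sqrt (\<Sum>j\<le>m. (h z j)\<^sup>2))"
        using True by (auto intro!: continuous_intros continuous_on_subset[OF cont])
      then show ?thesis using True by (simp add: normalise_def)
    qed (simp add: normalise_def)
  qed
  moreover have "(\<lambda>z. normalise m (h z)) \<in> ?Z \<rightarrow> coord_sphere m"
    using nz by (auto intro!: normalise_in_sphere)
  ultimately show ?thesis
    unfolding nsphere_coord_sphere homotopic_with_def
    by (intro exI[of _ "\<lambda>z. normalise m (h z)"])
       (auto simp: continuous_map_in_subtopology prod_topology_subtopology_eu)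
qed

text \<open>Without a zero, \<open>P (r t x)\<close> followed by radial projection deforms the constant map of the sphere
  into \<open>P (r x)\<close>, and the segment from \<open>P (r x)\<close> to \<open>x\<close>, which avoids the
  origin since both vectors lie on the same side of the hyperplane orthogonal to \<open>x\<close>, deforms that
  map into the identity. But the constant map has degree 0 and the identity has degree 1. Points are sequences of
  which only the first \<open>n\<close> entries matter; in this way \<open>n\<close> stays a variable, as the
  dimension of a finite element space requires.\<close>

lemma acute_angle_zero:
  fixes P :: "(nat \<Rightarrow> real) \<Rightarrow> nat \<Rightarrow> real"
  assumes r: "0 < r"
    and cont: "\<And>i. i < n \<Longrightarrow> continuous_on UNIV (\<lambda>x. P x i)"
    and acute: "\<And>x. (\<Sum>i<n. (x i)\<^sup>2) = r\<^sup>2 \<Longrightarrow> 0 < (\<Sum>i<n. P x i * x i)"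
  shows "\<exists>x. \<forall>i<n. P x i = 0"
proof (rule ccontr)
  assume nozero: "\<not> ?thesis"
  then obtain m where n: "n = Suc m" by (cases n) auto
  have nz: "\<exists>i\<le>m. P x i \<noteq> 0" for x
    using nozero n by (force simp: less_Suc_eq_le)
  have cont': "continuous_on UNIV (\<lambda>z. P (\<phi> z) i)" if "i \<le> m" "\<And>k. continuous_on UNIV (\<lambda>z. \<phi> z k)" for i \<phi>
    using that n
    by (intro continuous_on_compose2[OF cont, of i UNIV \<phi>] continuous_on_coordinatewise_then_product) auto
  have coord: "continuous_on UNIV (\<lambda>z::real \<times> (nat \<Rightarrow> real). snd z k)" for k
    by (intro continuous_on_compose2[OF continuous_on_product_coordinates continuous_on_snd]) auto
  define h1 where "h1 z = P (\<lambda>k. r * (fst z * snd z k))" for z :: "real \<times> (nat \<Rightarrow> real)"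
  define h2 where "h2 z i = (1 - fst z) * P (\<lambda>k. r * snd z k) i + fst z * snd z i"
    for z :: "real \<times> (nat \<Rightarrow> real)" and i
  have 1: "homotopic_with (\<lambda>x. True) (nsphere m) (nsphere m)
      (\<lambda>x. normalise m (h1 (0, x))) (\<lambda>x. normalise m (h1 (1, x)))"
  proof (rule homotopic_normalised)
    show "continuous_on UNIV (\<lambda>z. h1 z i)" if "i \<le> m" for i
      unfolding h1_def by (intro cont' that continuous_intros coord)
  qed (simp add: h1_def nz)
  have 2: "homotopic_with (\<lambda>x. True) (nsphere m) (nsphere m)
      (\<lambda>x. normalise m (h2 (0, x))) (\<lambda>x. normalise m (h2 (1, x)))"
  proof (rule homotopic_normalised)
    show "continuous_on UNIV (\<lambda>z. h2 z i)" if "i \<le> m" for i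
      unfolding h2_def by (intro cont' that continuous_intros coord)
    fix t :: real and x assume t: "t \<in> {0..1}" and x: "x \<in> coord_sphere m"
    have sx: "(\<Sum>i<n. (x i)\<^sup>2) = 1"
      using x n by (simp add: coord_sphere_def lessThan_Suc_atMost)
    have "0 < (\<Sum>i<n. P (\<lambda>k. r * x k) i * (r * x i))"
      using sx by (intro acute) (simp add: power_mult_distrib sum_distrib_left[symmetric])
    also have "\<dots> = r * (\<Sum>i<n. P (\<lambda>k. r * x k) i * x i)"
      by (simp add: sum_distrib_left mult_ac)
    finally have p: "0 < (\<Sum>i<n. P (\<lambda>k. r * x k) i * x i)"
      using r by (simp add: zero_less_mult_iff)
    have "(\<Sum>i<n. h2 (t, x) i * x i) = (1 - t) * (\<Sum>i<n. P (\<lambda>k. r * x k) i * x i) + t"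
      using sx by (simp add: h2_def ring_distribs sum.distrib sum_distrib_left[symmetric] power2_eq_square
          sum_subtractf mult.assoc)
    also have "\<dots> > 0"
      using p t by (cases "t = 1") (auto intro: add_pos_nonneg)
    finally have "(\<Sum>i<n. h2 (t, x) i * x i) \<noteq> 0" by simp
    then obtain i where "i < n" "h2 (t, x) i * x i \<noteq> 0"
      by (meson lessThan_iff sum.not_neutral_contains_not_neutral)
    then show "\<exists>i\<le>m. h2 (t, x) i \<noteq> 0"
      using n by (intro exI[of _ i]) auto
  qed
  have eq: "h1 (1, x) = h2 (0, x)" for x
    by (simp add: h1_def h2_def fun_eq_iff)
  have 3: "homotopic_with (\<lambda>x. True) (nsphere m) (nsphere m)
      (\<lambda>x. normalise m (h1 (0, x))) (\<lambda>x. normalise m (h2 (1, x)))"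
    using homotopic_with_trans[OF 1] 2 by (simp add: eq)
  have "Brouwer_degree2 m (\<lambda>x. normalise m (h1 (0, x))) = Brouwer_degree2 m (\<lambda>x. normalise m (h2 (1, x)))"
    by (rule Brouwer_degree2_homotopic[OF 3])
  moreover have "Brouwer_degree2 m (\<lambda>x. normalise m (h1 (0, x))) = 0"
    by (simp add: h1_def Brouwer_degree2_const)
  moreover have "h2 (1, x) = x" for x
    by (simp add: h2_def fun_eq_iff)
  then have "Brouwer_degree2 m (\<lambda>x. normalise m (h2 (1, x))) = Brouwer_degree2 m id"
    by (intro Brouwer_degree2_eq) (simp add: nsphere_coord_sphere normalise_sphere_id)
  ultimately show False by simp
qed

section \<open>Equality almost everywhere\<close>

lemma ae_eq_refl [simp]: "ae_eq \<Omega> f f"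
  by (simp add: ae_eq_def)

lemma ae_eq_sym: "ae_eq \<Omega> f g \<Longrightarrow> ae_eq \<Omega> g f"
  unfolding ae_eq_def by (auto elim: eventually_mono)

lemma ae_eq_trans [trans]: "\<lbrakk>ae_eq \<Omega> f g; ae_eq \<Omega> g h\<rbrakk> \<Longrightarrow> ae_eq \<Omega> f h"
  unfolding ae_eq_def by (auto elim: eventually_elim2)

lemma ae_eq_comp: "ae_eq \<Omega> f f' \<Longrightarrow> ae_eq \<Omega> (\<lambda>x. h (f x)) (\<lambda>x. h (f' x))"
  unfolding ae_eq_def by (auto elim: eventually_mono)

lemma ae_eq_comp2:
  "\<lbrakk>ae_eq \<Omega> f f'; ae_eq \<Omega> g g'\<rbrakk> \<Longrightarrow> ae_eq \<Omega> (\<lambda>x. h (f x) (g x)) (\<lambda>x. h (f' x) (g' x))"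
  unfolding ae_eq_def by (auto elim: eventually_elim2)

lemma ae_eq_add: "\<lbrakk>ae_eq \<Omega> f f'; ae_eq \<Omega> g g'\<rbrakk> \<Longrightarrow> ae_eq \<Omega> (\<lambda>x. f x + g x) (\<lambda>x. f' x + g' x)"
  by (rule ae_eq_comp2)

lemma ae_eq_scale: "ae_eq \<Omega> f f' \<Longrightarrow> ae_eq \<Omega> (\<lambda>x. c *\<^sub>R f x) (\<lambda>x. c *\<^sub>R f' x)"
  by (rule ae_eq_comp)

lemma ae_eq_sum:
  assumes "\<And>i. i \<in> I \<Longrightarrow> ae_eq \<Omega> (f i) (g i)"
  shows "ae_eq \<Omega> (\<lambda>x. \<Sum>i\<in>I. f i x) (\<lambda>x. \<Sum>i\<in>I. g i x)"
  using assms
proof (induction I rule: infinite_finite_induct)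
  case (insert i I)
  then show ?case using ae_eq_add[of \<Omega> "f i" "g i"] by simp
qed auto

lemma ae_eq_diff_zero: "ae_eq \<Omega> (\<lambda>x. f x - g x) (\<lambda>x. 0 :: 'a::group_add) \<longleftrightarrow> ae_eq \<Omega> f g"
  by (simp add: ae_eq_def)

section \<open>Square integrable and essentially bounded functions\<close>

lemma L2_measurable: "f \<in> L2 \<Omega> \<Longrightarrow> f \<in> borel_measurable (lebesgue_on \<Omega>)"
  by (simp add: L2_def)

lemma L2_inner_integrable:
  assumes "f \<in> L2 \<Omega>" "g \<in> L2 \<Omega>"
  shows "integrable (lebesgue_on \<Omega>) (\<lambda>x. f x \<bullet> g x)"
proof (rule Bochner_Integration.integrable_bound)
  show "integrable (lebesgue_on \<Omega>) (\<lambda>x. (norm (f x))\<^sup>2 + (norm (g x))\<^sup>2)"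
    using assms by (auto simp: L2_def)
  show "(\<lambda>x. f x \<bullet> g x) \<in> borel_measurable (lebesgue_on \<Omega>)"
    using assms by (intro borel_measurable_inner) (auto simp: L2_def)
  show "AE x in lebesgue_on \<Omega>. norm (f x \<bullet> g x) \<le> norm ((norm (f x))\<^sup>2 + (norm (g x))\<^sup>2)"
  proof (rule AE_I2)
    fix x
    have "\<bar>f x \<bullet> g x\<bar> \<le> norm (f x) * norm (g x)" by (rule Cauchy_Schwarz_ineq2)
    also have "\<dots> \<le> (norm (f x))\<^sup>2 + (norm (g x))\<^sup>2"
      using sum_squares_bound[of "norm (f x)" "norm (g x)"] by (auto intro: order_trans[rotated])
    finally show "norm (f x \<bullet> g x) \<le> norm ((norm (f x))\<^sup>2 + (norm (g x))\<^sup>2)" by simp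
  qed
qed

lemma L2I: "\<lbrakk>f \<in> borel_measurable (lebesgue_on \<Omega>); integrable (lebesgue_on \<Omega>) (\<lambda>x. f x \<bullet> f x)\<rbrakk> \<Longrightarrow> f \<in> L2 \<Omega>"
  by (simp add: L2_def power2_norm_eq_inner)

lemma L2_bound:
  assumes f: "f \<in> borel_measurable (lebesgue_on \<Omega>)" and g: "g \<in> L2 \<Omega>"
    and le: "AE x in lebesgue_on \<Omega>. norm (f x) \<le> C * norm (g x)"
  shows "f \<in> L2 \<Omega>"
proof -
  have "integrable (lebesgue_on \<Omega>) (\<lambda>x. (norm (f x))\<^sup>2)"
  proof (rule Bochner_Integration.integrable_bound)
    show "integrable (lebesgue_on \<Omega>) (\<lambda>x. C\<^sup>2 * (norm (g x))\<^sup>2)"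
      using g by (simp add: L2_def)
    show "(\<lambda>x. (norm (f x))\<^sup>2) \<in> borel_measurable (lebesgue_on \<Omega>)"
      using f by measurable
    show "AE x in lebesgue_on \<Omega>. norm ((norm (f x))\<^sup>2) \<le> norm (C\<^sup>2 * (norm (g x))\<^sup>2)"
      using le
    proof eventually_elim
      case (elim x)
      then have "(norm (f x))\<^sup>2 \<le> (C * norm (g x))\<^sup>2" by (intro power_mono) auto
      then show ?case by (simp add: power_mult_distrib)
    qed
  qed
  then show ?thesis using f by (simp add: L2_def)
qed

lemma L2_add [intro]:
  assumes "f \<in> L2 \<Omega>" "g \<in> L2 \<Omega>" shows "(\<lambda>x. f x + g x) \<in> L2 \<Omega>"
proof (rule L2I)
  show "(\<lambda>x. f x + g x) \<in> borel_measurable (lebesgue_on \<Omega>)"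
    using assms by (intro borel_measurable_add) (auto simp: L2_def)
  have "integrable (lebesgue_on \<Omega>) (\<lambda>x. f x \<bullet> f x + f x \<bullet> g x + (g x \<bullet> f x + g x \<bullet> g x))"
    using assms by (intro Bochner_Integration.integrable_add L2_inner_integrable)
  then show "integrable (lebesgue_on \<Omega>) (\<lambda>x. (f x + g x) \<bullet> (f x + g x))"
    by (simp add: inner_add_left inner_add_right add_ac)
qed

lemma L2_scale [intro]: "f \<in> L2 \<Omega> \<Longrightarrow> (\<lambda>x. c *\<^sub>R f x) \<in> L2 \<Omega>"
  by (rule L2_bound[of _ _ f "\<bar>c\<bar>"]) (auto simp: L2_def)

lemma L2_zero [simp, intro]: "(\<lambda>x. 0) \<in> L2 \<Omega>"
  by (simp add: L2_def)

lemma L2_sum [intro]: "(\<And>i. i \<in> I \<Longrightarrow> f i \<in> L2 \<Omega>) \<Longrightarrow> (\<lambda>x. \<Sum>i\<in>I. f i x) \<in> L2 \<Omega>"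
  by (induction I rule: infinite_finite_induct) auto

lemma L2_diff [intro]:
  assumes "f \<in> L2 \<Omega>" "g \<in> L2 \<Omega>" shows "(\<lambda>x. f x - g x) \<in> L2 \<Omega>"
  using L2_add[OF assms(1) L2_scale[OF assms(2), of "-1"]] by simp

lemma L2_bounded_linear:
  assumes h: "bounded_linear h" and f: "f \<in> L2 \<Omega>" shows "(\<lambda>x. h (f x)) \<in> L2 \<Omega>"
proof -
  obtain K where K: "\<forall>y. norm (h y) \<le> norm y * K"
    using bounded_linear.bounded[OF h] by (rule exE)
  have "(\<lambda>x. h (f x)) \<in> borel_measurable (lebesgue_on \<Omega>)"
    using L2_measurable[OF f] borel_measurable_continuous_onI[OF linear_continuous_on[OF h]]
    by (rule measurable_compose)
  moreover have "AE x in lebesgue_on \<Omega>. norm (h (f x)) \<le> K * norm (f x)"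
    using K by (intro AE_I2) (simp only: mult.commute[of K])
  ultimately show ?thesis by (rule L2_bound[OF _ f])
qed

lemma L2_componentwise:
  fixes f :: "real^3 \<Rightarrow> 'a::euclidean_space^'n"
  assumes "\<And>i. (\<lambda>x. f x $ i) \<in> L2 \<Omega>" shows "f \<in> L2 \<Omega>"
proof (rule L2I)
  show "f \<in> borel_measurable (lebesgue_on \<Omega>)"
    unfolding borel_measurable_euclidean_space[of f]
  proof
    fix b :: "'a^'n" assume "b \<in> Basis"
    have "(\<lambda>x. \<Sum>i\<in>UNIV. f x $ i \<bullet> b $ i) \<in> borel_measurable (lebesgue_on \<Omega>)"
      using assms[THEN L2_measurable] by measurable
    then show "(\<lambda>x. f x \<bullet> b) \<in> borel_measurable (lebesgue_on \<Omega>)"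
      by (simp add: inner_vec_def)
  qed
  show "integrable (lebesgue_on \<Omega>) (\<lambda>x. f x \<bullet> f x)"
    unfolding inner_vec_def by (intro Bochner_Integration.integrable_sum L2_inner_integrable assms)
qed

lemma L2_component: "f \<in> L2 \<Omega> \<Longrightarrow> (\<lambda>x. f x $ i) \<in> L2 \<Omega>"
  for f :: "real^3 \<Rightarrow> 'a::euclidean_space^'n"
  by (rule L2_bounded_linear[OF bounded_linear_vec_nth])

lemma l2_inner_commute: "l2_inner \<Omega> f g = l2_inner \<Omega> g f"
  by (simp add: l2_inner_def inner_commute)

lemma l2_inner_add_left:
  "\<lbrakk>f \<in> L2 \<Omega>; g \<in> L2 \<Omega>; h \<in> L2 \<Omega>\<rbrakk> \<Longrightarrow> l2_inner \<Omega> (\<lambda>x. f x + g x) h = l2_inner \<Omega> f h + l2_inner \<Omega> g h"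
  by (simp add: l2_inner_def inner_add_left L2_inner_integrable)

lemma l2_inner_add_right:
  "\<lbrakk>f \<in> L2 \<Omega>; g \<in> L2 \<Omega>; h \<in> L2 \<Omega>\<rbrakk> \<Longrightarrow> l2_inner \<Omega> h (\<lambda>x. f x + g x) = l2_inner \<Omega> h f + l2_inner \<Omega> h g"
  by (simp add: l2_inner_def inner_add_right L2_inner_integrable)

lemma l2_inner_diff_left:
  "\<lbrakk>f \<in> L2 \<Omega>; g \<in> L2 \<Omega>; h \<in> L2 \<Omega>\<rbrakk> \<Longrightarrow> l2_inner \<Omega> (\<lambda>x. f x - g x) h = l2_inner \<Omega> f h - l2_inner \<Omega> g h"
  by (simp add: l2_inner_def inner_diff_left L2_inner_integrable)

lemma l2_inner_diff_right:
  "\<lbrakk>f \<in> L2 \<Omega>; g \<in> L2 \<Omega>; h \<in> L2 \<Omega>\<rbrakk> \<Longrightarrow> l2_inner \<Omega> h (\<lambda>x. f x - g x) = l2_inner \<Omega> h f - l2_inner \<Omega> h g"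
  by (simp add: l2_inner_def inner_diff_right L2_inner_integrable)

lemma l2_inner_scale_left [simp]: "l2_inner \<Omega> (\<lambda>x. c *\<^sub>R f x) h = c * l2_inner \<Omega> f h"
  by (simp add: l2_inner_def)

lemma l2_inner_scale_right [simp]: "l2_inner \<Omega> h (\<lambda>x. c *\<^sub>R f x) = c * l2_inner \<Omega> h f"
  by (simp add: l2_inner_def)

lemma l2_inner_zero [simp]: "l2_inner \<Omega> (\<lambda>x. 0) h = 0" "l2_inner \<Omega> h (\<lambda>x. 0) = 0"
  by (simp_all add: l2_inner_def)

lemma l2_inner_sum_left:
  "\<lbrakk>\<And>i. i \<in> I \<Longrightarrow> f i \<in> L2 \<Omega>; h \<in> L2 \<Omega>\<rbrakk> \<Longrightarrow> l2_inner \<Omega> (\<lambda>x. \<Sum>i\<in>I. f i x) h = (\<Sum>i\<in>I. l2_inner \<Omega> (f i) h)"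
  by (simp add: l2_inner_def inner_sum_left L2_inner_integrable)

lemma l2_inner_cong:
  assumes "f \<in> L2 \<Omega>" "f' \<in> L2 \<Omega>" "g \<in> L2 \<Omega>" "g' \<in> L2 \<Omega>" "ae_eq \<Omega> f f'" "ae_eq \<Omega> g g'"
  shows "l2_inner \<Omega> f g = l2_inner \<Omega> f' g'"
  unfolding l2_inner_def
proof (rule integral_cong_AE)
  show "AE x in lebesgue_on \<Omega>. f x \<bullet> g x = f' x \<bullet> g' x"
    using assms(5,6) unfolding ae_eq_def by eventually_elim simp
qed (rule borel_measurable_inner[OF L2_measurable L2_measurable]; fact)+

lemma l2_inner_self_nonneg: "0 \<le> l2_inner \<Omega> f f"
  by (simp add: l2_inner_def)

lemma l2_norm_nonneg [simp]: "0 \<le> l2_norm \<Omega> f"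
  by (simp add: l2_norm_def l2_inner_self_nonneg)

lemma l2_norm_square: "(l2_norm \<Omega> f)\<^sup>2 = l2_inner \<Omega> f f"
  by (simp add: l2_norm_def l2_inner_self_nonneg)

lemma l2_norm_eq_0_iff: "f \<in> L2 \<Omega> \<Longrightarrow> l2_norm \<Omega> f = 0 \<longleftrightarrow> ae_eq \<Omega> f (\<lambda>x. 0)"
  using integral_nonneg_eq_0_iff_AE[OF L2_inner_integrable, of f \<Omega> f]
  by (simp add: l2_norm_def l2_inner_self_nonneg ae_eq_def) (simp add: l2_inner_def)

lemma l2_norm_scale: "l2_norm \<Omega> (\<lambda>x. c *\<^sub>R f x) = \<bar>c\<bar> * l2_norm \<Omega> f"
proof -
  have "l2_norm \<Omega> (\<lambda>x. c *\<^sub>R f x) = sqrt (c\<^sup>2 * l2_inner \<Omega> f f)"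
    by (simp add: l2_norm_def power2_eq_square mult.assoc)
  then show ?thesis by (simp add: real_sqrt_mult l2_norm_def)
qed

lemma l2_norm_mono:
  assumes f: "f \<in> borel_measurable (lebesgue_on \<Omega>)" and g: "g \<in> L2 \<Omega>" and C: "0 \<le> C"
    and le: "AE x in lebesgue_on \<Omega>. norm (f x) \<le> C * norm (g x)"
  shows "l2_norm \<Omega> f \<le> C * l2_norm \<Omega> g"
proof -
  have fL: "f \<in> L2 \<Omega>" by (rule L2_bound[OF f g le])
  have "l2_inner \<Omega> f f \<le> (\<integral>x. C\<^sup>2 * (g x \<bullet> g x) \<partial>lebesgue_on \<Omega>)"
    unfolding l2_inner_def
  proof (rule integral_mono_AE)
    show "AE x in lebesgue_on \<Omega>. f x \<bullet> f x \<le> C\<^sup>2 * (g x \<bullet> g x)"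
      using le
    proof eventually_elim
      case (elim x)
      then have "(norm (f x))\<^sup>2 \<le> (C * norm (g x))\<^sup>2" by (intro power_mono) auto
      then show ?case by (simp add: power_mult_distrib power2_norm_eq_inner)
    qed
  qed (use fL g in \<open>auto intro: L2_inner_integrable\<close>)
  also have "\<dots> = C\<^sup>2 * l2_inner \<Omega> g g" by (simp add: l2_inner_def)
  finally have "(l2_norm \<Omega> f)\<^sup>2 \<le> (C * l2_norm \<Omega> g)\<^sup>2"
    by (simp add: l2_norm_square power_mult_distrib)
  then show ?thesis by (rule power2_le_imp_le) (simp add: C)
qed

lemma l2_Cauchy_Schwarz:
  assumes f: "f \<in> L2 \<Omega>" and g: "g \<in> L2 \<Omega>"
  shows "\<bar>l2_inner \<Omega> f g\<bar> \<le> l2_norm \<Omega> f * l2_norm \<Omega> g"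
proof -
  define a b c where "a = l2_inner \<Omega> f f" and "b = l2_inner \<Omega> f g" and "c = l2_inner \<Omega> g g"
  have q: "0 \<le> a - 2 * t * b + t\<^sup>2 * c" for t
  proof -
    have "l2_inner \<Omega> (\<lambda>x. f x - t *\<^sub>R g x) (\<lambda>x. f x - t *\<^sub>R g x) = a - 2 * t * b + t\<^sup>2 * c"
      unfolding a_def b_def c_def using f g
      by (subst l2_inner_diff_left l2_inner_diff_right; auto)+
         (simp add: l2_inner_commute[of \<Omega> g f] power2_eq_square algebra_simps)
    then show ?thesis using l2_inner_self_nonneg by metis
  qed
  have ac: "0 \<le> a" "0 \<le> c" by (simp_all add: a_def c_def l2_inner_self_nonneg)
  have "b\<^sup>2 \<le> a * c"
  proof (cases "c = 0")
    case True
    have "b = 0"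
    proof (rule ccontr)
      assume "b \<noteq> 0"
      then show False using q[of "(a + 1) / (2 * b)"] True by simp
    qed
    then show ?thesis using True by simp
  next
    case False
    then show ?thesis using q[of "b / c"] ac
      by (simp add: power2_eq_square field_simps)
  qed
  then have "\<bar>b\<bar>\<^sup>2 \<le> (l2_norm \<Omega> f * l2_norm \<Omega> g)\<^sup>2"
    by (simp add: power_mult_distrib l2_norm_square a_def c_def)
  then show ?thesis unfolding b_def by (rule power2_le_imp_le) simp
qed

lemma l2_norm_triangle:
  assumes f: "f \<in> L2 \<Omega>" and g: "g \<in> L2 \<Omega>"
  shows "l2_norm \<Omega> (\<lambda>x. f x + g x) \<le> l2_norm \<Omega> f + l2_norm \<Omega> g"
proof (rule power2_le_imp_le)
  have "(l2_norm \<Omega> (\<lambda>x. f x + g x))\<^sup>2 = (l2_norm \<Omega> f)\<^sup>2 + 2 * l2_inner \<Omega> f g + (l2_norm \<Omega> g)\<^sup>2"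
    unfolding l2_norm_square using f g
    by (simp add: l2_inner_add_left l2_inner_add_right L2_add l2_inner_commute[of \<Omega> g f])
  also have "\<dots> \<le> (l2_norm \<Omega> f + l2_norm \<Omega> g)\<^sup>2"
    using l2_Cauchy_Schwarz[OF f g] by (simp add: power2_sum)
  finally show "(l2_norm \<Omega> (\<lambda>x. f x + g x))\<^sup>2 \<le> (l2_norm \<Omega> f + l2_norm \<Omega> g)\<^sup>2" .
qed simp

lemma l2_norm_diff_le:
  assumes f: "f \<in> L2 \<Omega>" and g: "g \<in> L2 \<Omega>"
  shows "l2_norm \<Omega> (\<lambda>x. f x - g x) \<le> l2_norm \<Omega> f + l2_norm \<Omega> g"
  using l2_norm_triangle[OF f L2_scale[OF g, of "-1"]] l2_norm_scale[of \<Omega> "-1" g] by simp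

lemma l2_norm_sum:
  assumes "finite I" "\<And>i. i \<in> I \<Longrightarrow> f i \<in> L2 \<Omega>"
  shows "l2_norm \<Omega> (\<lambda>x. \<Sum>i\<in>I. f i x) \<le> (\<Sum>i\<in>I. l2_norm \<Omega> (f i))"
  using assms
proof (induction I rule: finite_induct)
  case (insert i I)
  have "l2_norm \<Omega> (\<lambda>x. f i x + (\<Sum>i\<in>I. f i x)) \<le> l2_norm \<Omega> (f i) + l2_norm \<Omega> (\<lambda>x. \<Sum>i\<in>I. f i x)"
    using insert by (intro l2_norm_triangle L2_sum) auto
  then show ?case using insert by simp
qed (simp add: l2_norm_def)

definition ess_bounded :: "(real^3) set \<Rightarrow> (real^3 \<Rightarrow> 'a::euclidean_space) set" where
  "ess_bounded \<Omega> = {f \<in> borel_measurable (lebesgue_on \<Omega>). \<exists>M. AE x in lebesgue_on \<Omega>. norm (f x) \<le> M}"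

lemma ess_boundedE:
  assumes "f \<in> ess_bounded \<Omega>"
  obtains M where "0 \<le> M" "AE x in lebesgue_on \<Omega>. norm (f x) \<le> M"
proof -
  obtain M where M: "AE x in lebesgue_on \<Omega>. norm (f x) \<le> M"
    using assms by (auto simp: ess_bounded_def)
  from that[of "max M 0"] show ?thesis
    using eventually_mono[OF M] by (simp add: le_max_iff_disj)
qed

lemma ess_bounded_measurable: "f \<in> ess_bounded \<Omega> \<Longrightarrow> f \<in> borel_measurable (lebesgue_on \<Omega>)"
  by (simp add: ess_bounded_def)

lemma ess_bounded_L2:
  assumes \<Omega>: "\<Omega> \<in> lmeasurable" and f: "f \<in> ess_bounded \<Omega>"
  shows "f \<in> L2 \<Omega>"
proof -
  interpret finite_measure "lebesgue_on \<Omega>" by (rule finite_measure_lebesgue_on[OF \<Omega>])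
  obtain M where "AE x in lebesgue_on \<Omega>. norm (f x) \<le> M" using f by (rule ess_boundedE)
  moreover have "(\<lambda>x. 1::real) \<in> L2 \<Omega>" by (simp add: L2_def)
  ultimately show ?thesis
    using f by (intro L2_bound[of f \<Omega> "\<lambda>x. 1::real" M]) (auto simp: ess_bounded_def)
qed

lemma bounded_bilinear_measurable:
  fixes h :: "'a::euclidean_space \<Rightarrow> 'b::euclidean_space \<Rightarrow> 'c::euclidean_space"
  assumes h: "bounded_bilinear h" and f: "f \<in> borel_measurable M" and g: "g \<in> borel_measurable M"
  shows "(\<lambda>x. h (f x) (g x)) \<in> borel_measurable M"
  using f g by (rule borel_measurable_continuous_Pair)
    (intro bounded_bilinear.continuous_on[OF h] continuous_intros)

text \<open>The convection term is the product of a Jacobian, which is merely square integrable, with a bounded velocity.\<close>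

lemma L2_bilinear_bounded:
  fixes h :: "'a::euclidean_space \<Rightarrow> 'b::euclidean_space \<Rightarrow> 'c::euclidean_space"
  assumes h: "bounded_bilinear h" and f: "f \<in> L2 \<Omega>" and g: "g \<in> ess_bounded \<Omega>"
  shows "(\<lambda>x. h (f x) (g x)) \<in> L2 \<Omega>"
proof -
  obtain K where K: "0 \<le> K" "\<And>a b. norm (h a b) \<le> norm a * norm b * K"
    using bounded_bilinear.nonneg_bounded[OF h] by blast
  obtain M where M: "0 \<le> M" "AE x in lebesgue_on \<Omega>. norm (g x) \<le> M" using g by (rule ess_boundedE)
  show ?thesis
  proof (rule L2_bound[OF _ f])
    show "AE x in lebesgue_on \<Omega>. norm (h (f x) (g x)) \<le> (M * K) * norm (f x)"
      using M(2)
    proof eventually_elim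
      case (elim x)
      have "norm (h (f x) (g x)) \<le> norm (f x) * norm (g x) * K" by (rule K)
      also have "\<dots> \<le> norm (f x) * M * K" using K(1) elim by (intro mult_right_mono mult_left_mono) auto
      finally show ?case by (simp add: mult_ac)
    qed
  qed (intro bounded_bilinear_measurable[OF h] L2_measurable[OF f] ess_bounded_measurable[OF g])
qed

lemma ess_bounded_bilinear:
  fixes h :: "'a::euclidean_space \<Rightarrow> 'b::euclidean_space \<Rightarrow> 'c::euclidean_space"
  assumes h: "bounded_bilinear h" and f: "f \<in> ess_bounded \<Omega>" and g: "g \<in> ess_bounded \<Omega>"
  shows "(\<lambda>x. h (f x) (g x)) \<in> ess_bounded \<Omega>"
proof -
  obtain K where K: "0 \<le> K" "\<And>a b. norm (h a b) \<le> norm a * norm b * K"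
    using bounded_bilinear.nonneg_bounded[OF h] by blast
  obtain L where L: "0 \<le> L" "AE x in lebesgue_on \<Omega>. norm (f x) \<le> L" using f by (rule ess_boundedE)
  obtain M where M: "0 \<le> M" "AE x in lebesgue_on \<Omega>. norm (g x) \<le> M" using g by (rule ess_boundedE)
  have "AE x in lebesgue_on \<Omega>. norm (h (f x) (g x)) \<le> L * M * K"
    using L(2) M(2)
  proof eventually_elim
    case (elim x)
    have "norm (h (f x) (g x)) \<le> norm (f x) * norm (g x) * K" by (rule K)
    also have "\<dots> \<le> L * M * K" using K(1) elim L(1) by (intro mult_right_mono mult_mono) auto
    finally show ?case .
  qed
  then show ?thesis
    unfolding ess_bounded_def
    using bounded_bilinear_measurable[OF h ess_bounded_measurable[OF f] ess_bounded_measurable[OF g]] by blast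
qed

lemma ess_bounded_add [intro]:
  assumes f: "f \<in> ess_bounded \<Omega>" and g: "g \<in> ess_bounded \<Omega>"
  shows "(\<lambda>x. f x + g x) \<in> ess_bounded \<Omega>"
proof -
  obtain L where L: "AE x in lebesgue_on \<Omega>. norm (f x) \<le> L" using f by (rule ess_boundedE)
  obtain M where M: "AE x in lebesgue_on \<Omega>. norm (g x) \<le> M" using g by (rule ess_boundedE)
  have "AE x in lebesgue_on \<Omega>. norm (f x + g x) \<le> L + M"
    using L M
  proof eventually_elim
    case (elim x)
    then show ?case by (intro norm_triangle_mono)
  qed
  then show ?thesis
    using f g unfolding ess_bounded_def by (auto intro: borel_measurable_add)
qed

lemma ess_bounded_scale [intro]:
  assumes f: "f \<in> ess_bounded \<Omega>"
  shows "(\<lambda>x. c *\<^sub>R f x) \<in> ess_bounded \<Omega>"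
proof -
  obtain L where L: "AE x in lebesgue_on \<Omega>. norm (f x) \<le> L" using f by (rule ess_boundedE)
  have "AE x in lebesgue_on \<Omega>. norm (c *\<^sub>R f x) \<le> \<bar>c\<bar> * L"
    using L by eventually_elim (simp add: mult_left_mono)
  then show ?thesis
    using f unfolding ess_bounded_def by auto
qed

lemma continuous_ess_bounded:
  assumes "bounded \<Omega>" "\<Omega> \<in> sets lebesgue" and f: "continuous_on UNIV f"
  shows "f \<in> ess_bounded \<Omega>"
proof -
  have "compact (f ` closure \<Omega>)"
    using assms by (intro compact_continuous_image continuous_on_subset[OF f]) (auto simp: compact_closure)
  then obtain M where "\<forall>y\<in>f ` closure \<Omega>. norm y \<le> M"
    using compact_imp_bounded bounded_iff by blast
  then have "AE x in lebesgue_on \<Omega>. norm (f x) \<le> M"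
    using closure_subset by (intro AE_I2) (auto simp: space_restrict_space)
  moreover have "f \<in> borel_measurable (lebesgue_on \<Omega>)"
    using continuous_on_subset[OF f subset_UNIV] assms(2) by (rule continuous_imp_measurable_on_sets_lebesgue)
  ultimately show ?thesis by (auto simp: ess_bounded_def)
qed

section \<open>Linear forms and linear maps up to null sets\<close>

text \<open>Spaces are sets of functions on which equality almost everywhere is not the logical equality. The single
  condition below contains additivity, homogeneity and compatibility with null sets, and it applies to any
  representative \<open>w\<close> of the combination.\<close>

definition ae_linear_form :: "(real^3) set \<Rightarrow> (real^3 \<Rightarrow> 'a::euclidean_space) set \<Rightarrow> ((real^3 \<Rightarrow> 'a) \<Rightarrow> real) \<Rightarrow> bool" where
  "ae_linear_form \<Omega> X l \<longleftrightarrow>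
     (\<forall>u\<in>X. \<forall>v\<in>X. \<forall>w\<in>X. \<forall>c. ae_eq \<Omega> w (\<lambda>x. u x + c *\<^sub>R v x) \<longrightarrow> l w = l u + c * l v)"

definition ae_linear :: "(real^3) set \<Rightarrow> (real^3 \<Rightarrow> 'a::euclidean_space) set \<Rightarrow>
    ((real^3 \<Rightarrow> 'a) \<Rightarrow> real^3 \<Rightarrow> 'b::euclidean_space) \<Rightarrow> bool" where
  "ae_linear \<Omega> X T \<longleftrightarrow>
     (\<forall>u\<in>X. \<forall>v\<in>X. \<forall>w\<in>X. \<forall>c. ae_eq \<Omega> w (\<lambda>x. u x + c *\<^sub>R v x) \<longrightarrow> ae_eq \<Omega> (T w) (\<lambda>x. T u x + c *\<^sub>R T v x))"

lemma ae_linear_formD: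
  "\<lbrakk>ae_linear_form \<Omega> X l; u \<in> X; v \<in> X; w \<in> X; ae_eq \<Omega> w (\<lambda>x. u x + c *\<^sub>R v x)\<rbrakk> \<Longrightarrow> l w = l u + c * l v"
  by (auto simp: ae_linear_form_def)

lemma ae_linearD:
  "\<lbrakk>ae_linear \<Omega> X T; u \<in> X; v \<in> X; w \<in> X; ae_eq \<Omega> w (\<lambda>x. u x + c *\<^sub>R v x)\<rbrakk>
    \<Longrightarrow> ae_eq \<Omega> (T w) (\<lambda>x. T u x + c *\<^sub>R T v x)"
  by (auto simp: ae_linear_def)

lemma linear_spaceI:
  assumes "(\<lambda>x. 0) \<in> X" and "\<And>u v c. \<lbrakk>u \<in> X; v \<in> X\<rbrakk> \<Longrightarrow> (\<lambda>x. u x + c *\<^sub>R v x) \<in> X"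
  shows "linear_space X"
  unfolding linear_space_def
proof (intro conjI ballI allI)
  fix f g c assume "f \<in> X" "g \<in> X"
  then show "(\<lambda>x. f x + g x) \<in> X" using assms(2)[of f g 1] by simp
next
  fix f c assume "f \<in> X"
  then show "(\<lambda>x. c *\<^sub>R f x) \<in> X" using assms(2)[OF assms(1), of f c] by simp
qed (rule assms(1))

lemma linear_space_zero: "linear_space X \<Longrightarrow> (\<lambda>x. 0) \<in> X"
  by (simp add: linear_space_def)

lemma linear_space_add: "\<lbrakk>linear_space X; f \<in> X; g \<in> X\<rbrakk> \<Longrightarrow> (\<lambda>x. f x + g x) \<in> X"
  by (simp add: linear_space_def)

lemma linear_space_scale: "\<lbrakk>linear_space X; f \<in> X\<rbrakk> \<Longrightarrow> (\<lambda>x. c *\<^sub>R f x) \<in> X"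
  by (simp add: linear_space_def)

lemma linear_space_diff: "\<lbrakk>linear_space X; f \<in> X; g \<in> X\<rbrakk> \<Longrightarrow> (\<lambda>x. f x - g x) \<in> X"
  using linear_space_add[of X f "\<lambda>x. (-1) *\<^sub>R g x"] linear_space_scale[of X g "-1"] by simp

lemma linear_space_sum:
  "\<lbrakk>linear_space X; \<And>i. i \<in> I \<Longrightarrow> f i \<in> X\<rbrakk> \<Longrightarrow> (\<lambda>x. \<Sum>i\<in>I. f i x) \<in> X"
  by (induction I rule: infinite_finite_induct) (auto intro: linear_space_zero linear_space_add)

lemma linear_space_lincomb:
  "\<lbrakk>linear_space X; \<And>i. i \<in> I \<Longrightarrow> f i \<in> X\<rbrakk> \<Longrightarrow> (\<lambda>x. \<Sum>i\<in>I. c i *\<^sub>R f i x) \<in> X"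
  by (intro linear_space_sum linear_space_scale)

context
  fixes \<Omega> :: "(real^3) set" and X :: "(real^3 \<Rightarrow> 'a::euclidean_space) set"
  assumes X: "linear_space X"
begin

lemma ae_linear_form_zero:
  assumes l: "ae_linear_form \<Omega> X l" and u: "u \<in> X" "ae_eq \<Omega> u (\<lambda>x. 0)" shows "l u = 0"
proof -
  have "ae_eq \<Omega> (\<lambda>x. 0) (\<lambda>x. u x + 1 *\<^sub>R u x)"
    using u(2) by (auto simp: ae_eq_def elim: eventually_mono)
  then have "l (\<lambda>x. 0) = l u + l u"
    using ae_linear_formD[OF l u(1) u(1) linear_space_zero[OF X], of 1] by simp
  moreover have "ae_eq \<Omega> (\<lambda>x. 0) (\<lambda>x. u x + 0 *\<^sub>R u x)"
    using u(2) by (auto simp: ae_eq_def elim: eventually_mono)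
  then have "l (\<lambda>x. 0) = l u"
    using ae_linear_formD[OF l u(1) u(1) linear_space_zero[OF X], of 0] by simp
  ultimately show ?thesis by simp
qed

lemma ae_linear_form_cong:
  assumes l: "ae_linear_form \<Omega> X l" and "u \<in> X" "v \<in> X" "ae_eq \<Omega> u v" shows "l u = l v"
  using ae_linear_formD[OF l \<open>v \<in> X\<close> \<open>v \<in> X\<close> \<open>u \<in> X\<close>, of 0] assms(4) by simp

lemma ae_linear_form_add:
  "\<lbrakk>ae_linear_form \<Omega> X l; u \<in> X; v \<in> X\<rbrakk> \<Longrightarrow> l (\<lambda>x. u x + v x) = l u + l v"
  using ae_linear_formD[of \<Omega> X l u v "\<lambda>x. u x + v x" 1] linear_space_add[OF X] by simp

lemma ae_linear_form_scale:
  "\<lbrakk>ae_linear_form \<Omega> X l; u \<in> X\<rbrakk> \<Longrightarrow> l (\<lambda>x. c *\<^sub>R u x) = c * l u"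
  using ae_linear_formD[of \<Omega> X l "\<lambda>x. 0" u "\<lambda>x. c *\<^sub>R u x" c] linear_space_scale[OF X]
    ae_linear_form_zero[of l "\<lambda>x. 0"] linear_space_zero[OF X] by simp

lemma ae_linear_form_diff:
  "\<lbrakk>ae_linear_form \<Omega> X l; u \<in> X; v \<in> X\<rbrakk> \<Longrightarrow> l (\<lambda>x. u x - v x) = l u - l v"
  using ae_linear_formD[of \<Omega> X l u v "\<lambda>x. u x - v x" "-1"] linear_space_diff[OF X] by simp

lemma ae_linear_form_lincomb:
  assumes l: "ae_linear_form \<Omega> X l" and "finite I" "\<And>i. i \<in> I \<Longrightarrow> e i \<in> X"
  shows "l (\<lambda>x. \<Sum>i\<in>I. c i *\<^sub>R e i x) = (\<Sum>i\<in>I. c i * l (e i))"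
  using assms(2,3)
proof (induction I rule: finite_induct)
  case empty
  then show ?case using ae_linear_form_zero[OF l linear_space_zero[OF X]] by simp
next
  case (insert i I)
  then have "l (\<lambda>x. c i *\<^sub>R e i x + (\<Sum>i\<in>I. c i *\<^sub>R e i x)) = c i * l (e i) + (\<Sum>i\<in>I. c i * l (e i))"
    by (subst ae_linear_form_add[OF l])
       (auto simp: ae_linear_form_scale[OF l] intro!: linear_space_scale[OF X] linear_space_lincomb[OF X])
  then show ?case using insert by simp
qed

lemma ae_linear_cong:
  assumes T: "ae_linear \<Omega> X T" and "u \<in> X" "v \<in> X" "ae_eq \<Omega> u v" shows "ae_eq \<Omega> (T u) (T v)"
  using ae_linearD[OF T \<open>v \<in> X\<close> \<open>v \<in> X\<close> \<open>u \<in> X\<close>, of 0] assms(4) by simp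

lemma ae_linear_add:
  "\<lbrakk>ae_linear \<Omega> X T; u \<in> X; v \<in> X\<rbrakk> \<Longrightarrow> ae_eq \<Omega> (T (\<lambda>x. u x + v x)) (\<lambda>x. T u x + T v x)"
  using ae_linearD[of \<Omega> X T u v "\<lambda>x. u x + v x" 1] linear_space_add[OF X] by simp

lemma ae_linear_diff:
  "\<lbrakk>ae_linear \<Omega> X T; u \<in> X; v \<in> X\<rbrakk> \<Longrightarrow> ae_eq \<Omega> (T (\<lambda>x. u x - v x)) (\<lambda>x. T u x - T v x)"
  using ae_linearD[of \<Omega> X T u v "\<lambda>x. u x - v x" "-1"] linear_space_diff[OF X] by simp

lemma ae_linear_zero:
  assumes T: "ae_linear \<Omega> X T" and u: "u \<in> X" "ae_eq \<Omega> u (\<lambda>x. 0)" shows "ae_eq \<Omega> (T u) (\<lambda>x. 0)"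
proof -
  have "ae_eq \<Omega> u (\<lambda>x. u x + 1 *\<^sub>R u x)"
    using u(2) by (auto simp: ae_eq_def elim: eventually_mono)
  then have "ae_eq \<Omega> (T u) (\<lambda>x. T u x + T u x)"
    using ae_linearD[OF T u(1) u(1) u(1), of 1] by simp
  then show ?thesis by (auto simp: ae_eq_def elim: eventually_mono)
qed

lemma ae_linear_scale:
  assumes T: "ae_linear \<Omega> X T" and u: "u \<in> X" shows "ae_eq \<Omega> (T (\<lambda>x. c *\<^sub>R u x)) (\<lambda>x. c *\<^sub>R T u x)"
proof -
  have "ae_eq \<Omega> (T (\<lambda>x. c *\<^sub>R u x)) (\<lambda>x. T (\<lambda>x. 0) x + c *\<^sub>R T u x)"
    using ae_linearD[OF T linear_space_zero[OF X] u linear_space_scale[OF X u], of c c] by simp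
  also have "ae_eq \<Omega> \<dots> (\<lambda>x. c *\<^sub>R T u x)"
    using ae_linear_zero[OF T linear_space_zero[OF X]]
    by (auto simp: ae_eq_def elim: eventually_mono)
  finally show ?thesis .
qed

lemma ae_linear_lincomb:
  assumes T: "ae_linear \<Omega> X T" and "finite I" "\<And>i. i \<in> I \<Longrightarrow> e i \<in> X"
  shows "ae_eq \<Omega> (T (\<lambda>x. \<Sum>i\<in>I. c i *\<^sub>R e i x)) (\<lambda>x. \<Sum>i\<in>I. c i *\<^sub>R T (e i) x)"
  using assms(2,3)
proof (induction I rule: finite_induct)
  case empty
  then show ?case using ae_linear_zero[OF T linear_space_zero[OF X]] by simp
next
  case (insert i I)
  have "ae_eq \<Omega> (T (\<lambda>x. c i *\<^sub>R e i x + (\<Sum>i\<in>I. c i *\<^sub>R e i x)))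
          (\<lambda>x. T (\<lambda>x. c i *\<^sub>R e i x) x + T (\<lambda>x. \<Sum>i\<in>I. c i *\<^sub>R e i x) x)"
    using insert by (intro ae_linear_add[OF T]) (auto intro!: linear_space_scale[OF X] linear_space_lincomb[OF X])
  also have "ae_eq \<Omega> \<dots> (\<lambda>x. c i *\<^sub>R T (e i) x + (\<Sum>i\<in>I. c i *\<^sub>R T (e i) x))"
    using insert by (intro ae_eq_add ae_linear_scale[OF T]) auto
  finally show ?case using insert by simp
qed

end

lemma ae_linear_form_subset: "\<lbrakk>ae_linear_form \<Omega> Y l; X \<subseteq> Y\<rbrakk> \<Longrightarrow> ae_linear_form \<Omega> X l"
  by (auto simp: ae_linear_form_def)

lemma ae_linear_subset: "\<lbrakk>ae_linear \<Omega> Y T; X \<subseteq> Y\<rbrakk> \<Longrightarrow> ae_linear \<Omega> X T"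
  unfolding ae_linear_def by blast

lemma ae_linear_form_compose:
  "\<lbrakk>ae_linear_form \<Omega> Y l; ae_linear \<Omega> X T; \<And>u. u \<in> X \<Longrightarrow> T u \<in> Y\<rbrakk> \<Longrightarrow> ae_linear_form \<Omega> X (\<lambda>u. l (T u))"
  unfolding ae_linear_form_def[of \<Omega> X]
  by (intro ballI allI impI, rule ae_linear_formD[of \<Omega> Y l]) (auto intro: ae_linearD)

lemma ae_linear_form_l2_inner_left:
  fixes g :: "real^3 \<Rightarrow> 'a::euclidean_space"
  assumes "g \<in> L2 \<Omega>" shows "ae_linear_form \<Omega> (L2 \<Omega>) (\<lambda>u. l2_inner \<Omega> u g)"
  unfolding ae_linear_form_def
proof (intro ballI allI impI)
  fix u v w :: "real^3 \<Rightarrow> 'a" and c assume *: "u \<in> L2 \<Omega>" "v \<in> L2 \<Omega>" "w \<in> L2 \<Omega>" "ae_eq \<Omega> w (\<lambda>x. u x + c *\<^sub>R v x)"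
  then have "l2_inner \<Omega> w g = l2_inner \<Omega> (\<lambda>x. u x + c *\<^sub>R v x) g"
    using assms by (intro l2_inner_cong) auto
  then show "l2_inner \<Omega> w g = l2_inner \<Omega> u g + c * l2_inner \<Omega> v g"
    using * assms by (simp add: l2_inner_add_left L2_scale)
qed

lemma ae_linear_form_l2_inner_right:
  "g \<in> L2 \<Omega> \<Longrightarrow> ae_linear_form \<Omega> (L2 \<Omega>) (\<lambda>u. l2_inner \<Omega> g u)"
  using ae_linear_form_l2_inner_left[of g \<Omega>] by (simp add: l2_inner_commute[of \<Omega> g])

lemma ae_linear_form_plus:
  "\<lbrakk>ae_linear_form \<Omega> X l; ae_linear_form \<Omega> X m\<rbrakk> \<Longrightarrow> ae_linear_form \<Omega> X (\<lambda>u. l u + m u)"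
  unfolding ae_linear_form_def by (simp add: algebra_simps)

lemma ae_linear_form_minus:
  "\<lbrakk>ae_linear_form \<Omega> X l; ae_linear_form \<Omega> X m\<rbrakk> \<Longrightarrow> ae_linear_form \<Omega> X (\<lambda>u. l u - m u)"
  unfolding ae_linear_form_def by (simp add: algebra_simps)

lemma ae_linear_form_mult:
  "ae_linear_form \<Omega> X l \<Longrightarrow> ae_linear_form \<Omega> X (\<lambda>u. k * l u)"
  unfolding ae_linear_form_def by (simp add: algebra_simps)

lemma ae_linear_ident: "ae_linear \<Omega> X (\<lambda>u. u)"
  by (simp add: ae_linear_def)

lemma ae_linear_bilinear_left:
  assumes h: "bounded_bilinear h" and T: "ae_linear \<Omega> X T"
  shows "ae_linear \<Omega> X (\<lambda>u x. h (T u x) (g x))"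
  unfolding ae_linear_def
proof (intro ballI allI impI)
  fix u v w c assume "u \<in> X" "v \<in> X" "w \<in> X" "ae_eq \<Omega> w (\<lambda>x. u x + c *\<^sub>R v x)"
  then have "ae_eq \<Omega> (T w) (\<lambda>x. T u x + c *\<^sub>R T v x)" by (rule ae_linearD[OF T])
  then have "ae_eq \<Omega> (\<lambda>x. h (T w x) (g x)) (\<lambda>x. h (T u x + c *\<^sub>R T v x) (g x))"
    by (rule ae_eq_comp2) simp
  then show "ae_eq \<Omega> (\<lambda>x. h (T w x) (g x)) (\<lambda>x. h (T u x) (g x) + c *\<^sub>R h (T v x) (g x))"
    by (simp add: bounded_bilinear.add_left[OF h] bounded_bilinear.scaleR_left[OF h])
qed

lemma ae_linear_bilinear_right:
  assumes h: "bounded_bilinear h" and T: "ae_linear \<Omega> X T"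
  shows "ae_linear \<Omega> X (\<lambda>u x. h (g x) (T u x))"
  using ae_linear_bilinear_left[OF bounded_bilinear.flip[OF h] T] by simp

section \<open>Smooth functions\<close>

lemma partial_eqI: "(f has_derivative D) (at x) \<Longrightarrow> partial i f x = D (axis i 1)"
  unfolding partial_def using frechet_derivative_at by metis

lemma smooth_differentiable: "smooth f \<Longrightarrow> f differentiable (at x)"
  by (erule smooth.cases) auto

lemma smooth_partial: "smooth f \<Longrightarrow> smooth (partial i f)"
  by (erule smooth.cases) auto

lemma smooth_continuous: "smooth f \<Longrightarrow> continuous_on UNIV f"
  by (simp add: smooth_differentiable continuous_at_imp_continuous_on differentiable_imp_continuous_within)

lemma partial_add:
  assumes "f differentiable (at x)" "g differentiable (at x)"
  shows "partial i (\<lambda>y. f y + g y) x = partial i f x + partial i g x"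
  using has_derivative_add[OF assms[unfolded frechet_derivative_works]]
  by (subst partial_eqI, assumption) (simp add: partial_def)

lemma partial_mult:
  assumes "f differentiable (at x)" "g differentiable (at x)"
  shows "partial i (\<lambda>y. f y * g y) x = f x * partial i g x + partial i f x * g x"
  using has_derivative_mult[OF assms[unfolded frechet_derivative_works]]
  by (subst partial_eqI, assumption) (simp add: partial_def)

text \<open>The product rule turns one product into two, so products of smooth functions alone are not closed under partial
  derivatives. Their closure under sums and products is, and can serve as coinduction hypothesis.\<close>

inductive smooth_algebra :: "scalar_field \<Rightarrow> bool" where
  base: "smooth f \<Longrightarrow> smooth_algebra f"
| add: "smooth_algebra f \<Longrightarrow> smooth_algebra g \<Longrightarrow> smooth_algebra (\<lambda>x. f x + g x)"
| mult: "smooth_algebra f \<Longrightarrow> smooth_algebra g \<Longrightarrow> smooth_algebra (\<lambda>x. f x * g x)"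

lemma smooth_algebra_step:
  "smooth_algebra f \<Longrightarrow> (\<forall>x. f differentiable (at x)) \<and> (\<forall>i. smooth_algebra (partial i f))"
proof (induction rule: smooth_algebra.induct)
  case (base f)
  then show ?case by (auto intro: smooth_differentiable smooth_partial smooth_algebra.base)
next
  case (add f g)
  then have d: "f differentiable (at x)" "g differentiable (at x)" for x by blast+
  have p: "partial i (\<lambda>x. f x + g x) = (\<lambda>x. partial i f x + partial i g x)" for i
    by (rule ext, rule partial_add) (rule d)+
  show ?case
    unfolding p using add d by (intro conjI allI differentiable_add smooth_algebra.add) blast+
next
  case (mult f g)
  then have d: "f differentiable (at x)" "g differentiable (at x)" for x by blast+
  have p: "partial i (\<lambda>x. f x * g x) = (\<lambda>x. f x * partial i g x + partial i f x * g x)" for i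
    by (rule ext, rule partial_mult) (rule d)+
  show ?case
    unfolding p using mult d
    by (intro conjI allI differentiable_mult smooth_algebra.add smooth_algebra.mult) blast+
qed

lemma smooth_coinduct_set:
  assumes "X f"
    and "\<And>f x. X f \<Longrightarrow> f differentiable (at x)" and "\<And>f i. X f \<Longrightarrow> X (partial i f)"
  shows "smooth f"
  using assms(1)
proof (rule smooth.coinduct[of X])
  fix g assume "X g"
  then have "(\<forall>x. g differentiable at x) \<and> (\<forall>i. X (partial i g) \<or> smooth (partial i g))"
    using assms(2,3) by blast
  then show "\<exists>f. g = f \<and> (\<forall>x. f differentiable at x) \<and> (\<forall>i. X (partial i f) \<or> smooth (partial i f))"
    by blast
qed

lemma smooth_algebra_smooth: "smooth_algebra f \<Longrightarrow> smooth f"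
  by (rule smooth_coinduct_set[of smooth_algebra]) (blast dest: smooth_algebra_step)+

lemma smooth_add: "\<lbrakk>smooth f; smooth g\<rbrakk> \<Longrightarrow> smooth (\<lambda>x. f x + g x)"
  by (rule smooth_algebra_smooth) (intro smooth_algebra.intros)

lemma smooth_mult: "\<lbrakk>smooth f; smooth g\<rbrakk> \<Longrightarrow> smooth (\<lambda>x. f x * g x)"
  by (rule smooth_algebra_smooth) (intro smooth_algebra.intros)

lemma partial_const: "partial i (\<lambda>x. c) = (\<lambda>x. 0)"
  by (simp add: partial_def fun_eq_iff)

lemma smooth_const: "smooth (\<lambda>x. c)"
  by (rule smooth_coinduct_set[where X = "\<lambda>f. \<exists>c. f = (\<lambda>x. c)"]) (auto simp: partial_const)

lemma smooth_cmult: "smooth f \<Longrightarrow> smooth (\<lambda>x. c * f x)"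
  by (intro smooth_mult smooth_const)

lemma smooth_diff: "\<lbrakk>smooth f; smooth g\<rbrakk> \<Longrightarrow> smooth (\<lambda>x. f x - g x)"
  using smooth_add[OF _ smooth_cmult, of f g "-1"] by simp

lemma smooth_prod: "(\<And>i. i \<in> I \<Longrightarrow> smooth (f i)) \<Longrightarrow> smooth (\<lambda>x. \<Prod>i\<in>I. f i x)"
  by (induction I rule: infinite_finite_induct) (auto intro: smooth_mult smooth_const)

lemma partial_coordinate: "partial i (\<lambda>x. x $ j) = (\<lambda>x. if i = j then 1 else 0)"
proof
  fix x :: "real^3"
  have "((\<lambda>x::real^3. x $ j) has_derivative (\<lambda>x. x $ j)) (at x)"
    by (intro bounded_linear_imp_has_derivative bounded_linear_vec_nth)
  from partial_eqI[OF this, of i] show "partial i (\<lambda>x. x $ j) x = (if i = j then 1 else 0)"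
    by (simp add: axis_def)
qed

lemma smooth_coordinate: "smooth (\<lambda>x. x $ j)"
proof (rule smooth.intros)
  show "\<forall>x::real^3. (\<lambda>x. x $ j) differentiable (at x)"
    using bounded_linear_imp_differentiable[OF bounded_linear_vec_nth] by blast
  show "\<forall>i. smooth (partial i (\<lambda>x. x $ j))"
    unfolding partial_coordinate using smooth_const by blast
qed

section \<open>Bump functions\<close>

text \<open>The functions \<open>p (1 / t) exp (- 1 / t)\<close>, extended by zero, for all polynomials \<open>p\<close> at
  once: this family is closed under differentiation.\<close>

definition flat :: "real poly \<Rightarrow> real \<Rightarrow> real" where
  "flat p t = (if t > 0 then poly p (inverse t) * exp (- inverse t) else 0)"

lemma poly_times_exp_neg_tendsto_0: "((\<lambda>s. poly p s * exp (- s)) \<longlongrightarrow> (0::real)) at_top"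
proof -
  have "((\<lambda>s. \<Sum>i\<le>Polynomial.degree p. poly.coeff p i * (s ^ i / exp s)) \<longlongrightarrow> (\<Sum>i\<le>Polynomial.degree p. poly.coeff p i * 0)) at_top"
    by (intro tendsto_sum tendsto_mult tendsto_const tendsto_power_div_exp_0)
  then show ?thesis
    by (simp add: poly_altdef sum_distrib_right exp_minus divide_inverse mult.assoc)
qed

lemma flat_has_derivative:
  "(flat p has_real_derivative flat ([:0, 0, 1:] * (p - pderiv p)) t) (at t)"
proof -
  consider "t > 0" | "t < 0" | "t = 0" by linarith
  then show ?thesis
  proof cases
    case 1
    have "((\<lambda>t. poly p (inverse t) * exp (- inverse t)) has_real_derivative
        flat ([:0, 0, 1:] * (p - pderiv p)) t) (at t)"
      using 1 by (auto intro!: derivative_eq_intros simp: flat_def field_simps power2_eq_square)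
    then show ?thesis
      by (rule has_field_derivative_transform_within_open[of _ _ _ "{0<..}"]) (use 1 in \<open>auto simp: flat_def\<close>)
  next
    case 2
    have "((\<lambda>t. 0) has_real_derivative 0) (at t)" by simp
    then have "(flat p has_real_derivative 0) (at t)"
      by (rule has_field_derivative_transform_within_open[of _ _ _ "{..<0}"]) (use 2 in \<open>auto simp: flat_def\<close>)
    then show ?thesis using 2 by (simp add: flat_def)
  next
    case 3
    have "((\<lambda>h. poly ([:0, 1:] * p) (inverse h) * exp (- inverse h)) \<longlongrightarrow> 0) (at_right 0)"
      by (rule filterlim_compose[OF poly_times_exp_neg_tendsto_0 filterlim_inverse_at_top_right])
    then have "((\<lambda>h. flat p h / h) \<longlongrightarrow> 0) (at_right 0)"
      by (rule Lim_transform_eventually)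
         (auto simp: eventually_at_right_less flat_def divide_inverse mult_ac eventually_at_filter)
    moreover have "((\<lambda>h. flat p h / h) \<longlongrightarrow> 0) (at_left 0)"
      by (rule Lim_transform_eventually[OF tendsto_const]) (auto simp: flat_def eventually_at_filter)
    ultimately have "((\<lambda>h. flat p h / h) \<longlongrightarrow> 0) (at 0)"
      by (simp add: filterlim_at_split)
    then show ?thesis
      using 3 by (simp add: DERIV_def flat_def)
  qed
qed

text \<open>The factor \<open>k\<close> absorbs the constants of the chain rule, so that the derivatives stay in the family.\<close>

lemma smooth_flat: "smooth (\<lambda>x. k * flat p (c * x $ i + d))"
proof (rule smooth_coinduct_set[where X = "\<lambda>f. \<exists>k p. f = (\<lambda>x. k * flat p (c * x $ i + d))"])
  fix f :: scalar_field assume "\<exists>k p. f = (\<lambda>x. k * flat p (c * x $ i + d))"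
  then obtain k p where f: "f = (\<lambda>x. k * flat p (c * x $ i + d))" by blast
  let ?f = "\<lambda>x::real^3. k * flat p (c * x $ i + d)"
  let ?q = "[:0, 0, 1:] * (p - pderiv p)"
  have der: "(?f has_derivative (\<lambda>h. k * (flat ?q (c * x $ i + d) * (c * h $ i)))) (at x)" for x
  proof -
    have "((\<lambda>x::real^3. c * x $ i + d) has_derivative (\<lambda>h. c * h $ i)) (at x)"
      by (auto intro!: derivative_eq_intros bounded_linear_imp_has_derivative bounded_linear_vec_nth)
    moreover have "(flat p has_derivative (\<lambda>h. flat ?q (c * x $ i + d) * h)) (at (c * x $ i + d))"
      using flat_has_derivative unfolding has_field_derivative_def .
    ultimately have "((\<lambda>x. flat p (c * x $ i + d)) has_derivative (\<lambda>h. flat ?q (c * x $ i + d) * (c * h $ i))) (at x)"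
      by (rule has_derivative_compose)
    then show ?thesis by (rule has_derivative_mult_right)
  qed
  have "partial j ?f = (\<lambda>x. (k * c * axis j 1 $ i) * flat ?q (c * x $ i + d))" for j
    by (rule ext) (subst partial_eqI[OF der], simp)
  then show "\<exists>k p. partial j f = (\<lambda>x. k * flat p (c * x $ i + d))" for j
    unfolding f by blast
  show "f differentiable (at x)" for x
    unfolding f differentiable_def using der by blast
qed blast

text \<open>The shift by 1 keeps the support at distance at least \<open>1 / n\<close> from the boundary of the box.\<close>

definition box_bump :: "real^3 \<Rightarrow> real^3 \<Rightarrow> nat \<Rightarrow> scalar_field" where
  "box_bump a b n x = (\<Prod>i\<in>UNIV. flat 1 (real n * (x $ i - a $ i) - 1) * flat 1 (real n * (b $ i - x $ i) - 1))"

lemma flat_1_bounds: "0 \<le> flat 1 t" "flat 1 t \<le> 1"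
  by (auto simp: flat_def)

lemma box_bump_bounds: "0 \<le> box_bump a b n x" "box_bump a b n x \<le> 1"
  unfolding box_bump_def
  by (auto intro!: prod_nonneg prod_le_1 mult_nonneg_nonneg mult_le_one flat_1_bounds)

lemma smooth_box_bump: "smooth (box_bump a b n)"
proof -
  have "smooth (\<lambda>x. (1 * flat 1 (real n * x $ i + (- real n * a $ i - 1))) *
            (1 * flat 1 (- real n * x $ i + (real n * b $ i - 1))))" for i
    by (intro smooth_mult smooth_flat)
  then show ?thesis
    unfolding box_bump_def[abs_def] by (intro smooth_prod) (simp add: algebra_simps)
qed

lemma box_bump_support:
  assumes n: "0 < n"
  shows "compact_support_in (box a b) (box_bump a b n)"
proof -
  let ?C = "cbox (\<chi> i. a $ i + 1 / real n) (\<chi> i. b $ i - 1 / real n)"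
  have "{x. box_bump a b n x \<noteq> 0} \<subseteq> ?C"
  proof
    fix x assume "x \<in> {x. box_bump a b n x \<noteq> 0}"
    then have "\<forall>i. real n * (x $ i - a $ i) - 1 > 0 \<and> real n * (b $ i - x $ i) - 1 > 0"
      by (auto simp: box_bump_def flat_def split: if_splits)
    with n show "x \<in> ?C" by (auto simp: mem_box_cart field_simps less_imp_le)
  qed
  then have cl: "closure {x. box_bump a b n x \<noteq> 0} \<subseteq> ?C"
    by (rule closure_minimal) (rule closed_cbox)
  have "a $ i < x $ i \<and> x $ i < b $ i" if "x \<in> ?C" for x i
  proof -
    have "a $ i + 1 / real n \<le> x $ i" "x $ i \<le> b $ i - 1 / real n" "1 / real n > 0"
      using that n by (auto simp: mem_box_cart)
    then show ?thesis by linarith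
  qed
  then have "?C \<subseteq> box a b"
    by (auto simp: mem_box_cart)
  moreover have "compact (closure {x. box_bump a b n x \<noteq> 0})"
    using cl bounded_subset[OF bounded_cbox] by (simp add: compact_eq_bounded_closed)
  ultimately show ?thesis using cl by (auto simp: compact_support_in_def)
qed

lemma flat_1_scaled_tendsto:
  assumes "0 < t" shows "(\<lambda>n. flat 1 (real n * t - 1)) \<longlonglongrightarrow> 1"
proof -
  have inf: "filterlim (\<lambda>n. real n * t - 1) at_top sequentially"
    using assms by real_asymp
  have "(\<lambda>n. exp (- inverse (real n * t - 1))) \<longlonglongrightarrow> exp (- 0)"
    by (intro tendsto_exp tendsto_minus tendsto_inverse_0_at_top inf)
  moreover have "eventually (\<lambda>n. exp (- inverse (real n * t - 1)) = flat 1 (real n * t - 1)) sequentially"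
    using filterlim_at_top_dense[THEN iffD1, OF inf, rule_format, of 0]
    by eventually_elim (simp add: flat_def)
  ultimately show ?thesis by (auto intro: Lim_transform_eventually)
qed

lemma box_bump_tendsto: "(\<lambda>n. box_bump a b n x) \<longlonglongrightarrow> indicator (box a b) x"
proof (cases "x \<in> box a b")
  case True
  then have "(\<lambda>n. box_bump a b n x) \<longlonglongrightarrow> (\<Prod>i\<in>(UNIV::3 set). 1 * 1)"
    unfolding box_bump_def by (intro tendsto_prod tendsto_mult flat_1_scaled_tendsto) (auto simp: mem_box_cart)
  then show ?thesis using True by simp
next
  case False
  then obtain i where i: "\<not> (a $ i < x $ i \<and> x $ i < b $ i)" by (auto simp: mem_box_cart)
  have "box_bump a b n x = 0" for n
  proof -
    have "real n * (x $ i - a $ i) \<le> 0 \<or> real n * (b $ i - x $ i) \<le> 0"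
      using i by (auto simp: mult_le_0_iff)
    then have "flat 1 (real n * (x $ i - a $ i) - 1) * flat 1 (real n * (b $ i - x $ i) - 1) = 0"
      by (auto simp: flat_def)
    then show ?thesis unfolding box_bump_def by (intro prod_zero) auto
  qed
  then show ?thesis using False by simp
qed

section \<open>The fundamental lemma of the calculus of variations\<close>

text \<open>The sets over which \<open>g\<close> integrates to zero form a Dynkin system that contains the
  intersection-stable generator of the Borel sets given by the boxes.\<close>

lemma integral_boxes_zero_imp_AE_zero:
  fixes g :: "'a::euclidean_space \<Rightarrow> real"
  assumes g: "integrable lborel g"
    and box: "\<And>a b. (\<integral>x. indicator (box a b) x *\<^sub>R g x \<partial>lborel) = 0"
  shows "AE x in lborel. g x = 0"
proof -
  \<comment> \<open>Complements need the integral over the whole space, a limit of integrals over boxes.\<close>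
  have total: "(\<integral>x. g x \<partial>lborel) = 0"
  proof -
    have "(\<lambda>n. \<integral>x. indicator (box (- real n *\<^sub>R One) (real n *\<^sub>R One)) x *\<^sub>R g x \<partial>lborel) \<longlonglongrightarrow> (\<integral>x. g x \<partial>lborel)"
    proof (rule integral_dominated_convergence[where w = "\<lambda>x. norm (g x)"])
      show "AE x in lborel. (\<lambda>n. indicator (box (- real n *\<^sub>R One) (real n *\<^sub>R One)) x *\<^sub>R g x) \<longlonglongrightarrow> g x"
      proof (rule AE_I2)
        fix x :: 'a
        obtain m where m: "norm x < real m" using reals_Archimedean2 by blast
        have "x \<in> box (- real n *\<^sub>R One) (real n *\<^sub>R One)" if "m \<le> n" for n
        proof -
          have "- real n < x \<bullet> i \<and> x \<bullet> i < real n" if "i \<in> Basis" for i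
            using Basis_le_norm[OF that, of x] m \<open>m \<le> n\<close> by linarith
          then show ?thesis by (simp add: mem_box)
        qed
        then have "eventually (\<lambda>n. g x = indicator (box (- real n *\<^sub>R One) (real n *\<^sub>R One)) x *\<^sub>R g x) sequentially"
          by (intro eventually_sequentiallyI[of m]) simp
        then show "(\<lambda>n. indicator (box (- real n *\<^sub>R One) (real n *\<^sub>R One)) x *\<^sub>R g x) \<longlonglongrightarrow> g x"
          by (rule Lim_transform_eventually[OF tendsto_const])
      qed
    qed (use g in \<open>auto simp: indicator_def\<close>)
    then have "(\<lambda>n::nat. 0::real) \<longlonglongrightarrow> (\<integral>x. g x \<partial>lborel)" by (simp only: box)
    then show ?thesis by (simp add: LIMSEQ_const_iff)
  qed
  have "(\<integral>x\<in>A. g x \<partial>lborel) = 0" if "A \<in> sets borel" for A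
  proof -
    have "Int_stable (range (\<lambda>(a, b). box a b :: 'a set))"
      by (auto simp: Int_stable_def box_Int_box)
    moreover have "range (\<lambda>(a, b). box a b :: 'a set) \<subseteq> Pow UNIV" by simp
    moreover have "A \<in> sigma_sets UNIV (range (\<lambda>(a, b). box a b))"
      using that unfolding borel_eq_box by simp
    ultimately show ?thesis
    proof (induction rule: sigma_sets_induct_disjoint)
      case (basic A)
      then show ?case using box by (auto simp: set_lebesgue_integral_def)
    next
      case (compl A)
      then have A: "A \<in> sets lborel" by (simp add: borel_eq_box)
      have "(\<integral>x. indicator (UNIV - A) x *\<^sub>R g x \<partial>lborel) = (\<integral>x. g x - indicator A x *\<^sub>R g x \<partial>lborel)"
        by (intro Bochner_Integration.integral_cong) (auto simp: indicator_def)
      also have "\<dots> = 0"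
        using compl total g integrable_mult_indicator[OF A g]
        by (simp add: set_lebesgue_integral_def)
      finally show ?case by (simp add: set_lebesgue_integral_def)
    next
      case (union A)
      then have A: "A i \<in> sets lborel" for i by (auto simp: borel_eq_box)
      have "(\<integral>x\<in>(\<Union>i. A i). g x \<partial>lborel) = suminf (\<lambda>i. \<integral>x\<in>A i. g x \<partial>lborel)"
      proof (rule lebesgue_integral_countable_add)
        show "A i \<inter> A j = {}" if "i \<noteq> j" for i j
          using union(1) that by (auto simp: disjoint_family_on_def)
        show "set_integrable lborel (\<Union>i. A i) g"
          unfolding set_integrable_def using A by (intro integrable_mult_indicator g) auto
      qed (rule A)
      then show ?case using union by simp
    qed (auto simp: set_lebesgue_integral_def)
  qed
  then have "AE x in lborel. g x = (\<lambda>x. 0) x"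
    using g by (intro density_unique_real) auto
  then show ?thesis by simp
qed

text \<open>Bump functions converge boundedly to the indicator of a box, hence \<open>d\<close> integrates to zero over all
  boxes in \<open>\<Omega>\<close>; finally \<open>\<Omega>\<close> is a countable union of boxes.\<close>

lemma fundamental_lemma:
  fixes d :: scalar_field
  assumes \<Omega>: "open \<Omega>" "bounded \<Omega>" and d: "d \<in> L2 \<Omega>"
    and orth: "\<And>\<phi>. \<phi> \<in> test_functions \<Omega> \<Longrightarrow> l2_inner \<Omega> d \<phi> = 0"
  shows "ae_eq \<Omega> d (\<lambda>x. 0)"
proof -
  have \<Omega>': "\<Omega> \<in> lmeasurable" "\<Omega> \<in> sets lebesgue"
    using lmeasurable_open[OF \<Omega>(2,1)] by (auto simp: fmeasurableD)
  have "continuous_on UNIV (\<lambda>x::real^3. 1::real)" by simp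
  then have "(\<lambda>x. 1::real) \<in> L2 \<Omega>"
    by (rule ess_bounded_L2[OF \<Omega>'(1) continuous_ess_bounded[OF \<Omega>(2) \<Omega>'(2)]])
  from L2_inner_integrable[OF d this]
  have int: "integrable (lebesgue_on \<Omega>) d" by simp
  have boxm: "box a b \<in> sets (lebesgue_on \<Omega>)" if "box a b \<subseteq> \<Omega>" for a b
    using that \<Omega>'(2) by (simp add: sets_restrict_space_iff)
  have box0: "(\<integral>x. indicator (box a b) x * d x \<partial>lebesgue_on \<Omega>) = 0" if ab: "box a b \<subseteq> \<Omega>" for a b
  proof -
    have "(\<lambda>n. \<integral>x. box_bump a b (Suc n) x * d x \<partial>lebesgue_on \<Omega>)
        \<longlonglongrightarrow> (\<integral>x. indicator (box a b) x * d x \<partial>lebesgue_on \<Omega>)"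
    proof (rule integral_dominated_convergence[where w = "\<lambda>x. norm (d x)"])
      show "AE x in lebesgue_on \<Omega>. (\<lambda>n. box_bump a b (Suc n) x * d x) \<longlonglongrightarrow> indicator (box a b) x * d x"
        by (intro AE_I2 tendsto_mult tendsto_const LIMSEQ_Suc[OF box_bump_tendsto])
      show "AE x in lebesgue_on \<Omega>. norm (box_bump a b (Suc n) x * d x) \<le> norm (d x)" for n
        using box_bump_bounds[of a b "Suc n"] by (intro AE_I2) (simp add: abs_mult mult_left_le_one_le)
      show "(\<lambda>x. indicator (box a b) x * d x) \<in> borel_measurable (lebesgue_on \<Omega>)"
        by (intro borel_measurable_times borel_measurable_indicator boxm[OF ab] L2_measurable[OF d])
      show "(\<lambda>x. box_bump a b (Suc n) x * d x) \<in> borel_measurable (lebesgue_on \<Omega>)" for n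
        by (intro borel_measurable_times L2_measurable[OF d]
            continuous_imp_measurable_on_sets_lebesgue[OF continuous_on_subset[OF smooth_continuous[OF smooth_box_bump]]] \<Omega>') auto
    qed (use int in auto)
    moreover have "(\<integral>x. box_bump a b (Suc n) x * d x \<partial>lebesgue_on \<Omega>) = 0" for n
    proof -
      have "compact_support_in \<Omega> (box_bump a b (Suc n))"
        using box_bump_support[of "Suc n" a b] ab by (auto simp: compact_support_in_def)
      then have "l2_inner \<Omega> d (box_bump a b (Suc n)) = 0"
        by (intro orth) (simp add: test_functions_def smooth_box_bump)
      then show ?thesis by (simp add: l2_inner_def mult.commute)
    qed
    ultimately show ?thesis by (simp add: LIMSEQ_const_iff)
  qed
  have box_AE: "AE x in lebesgue. x \<in> box a b \<longrightarrow> d x = 0" if ab: "box a b \<subseteq> \<Omega>" for a b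
  proof -
    let ?e = "\<lambda>x. indicator (box a b) x *\<^sub>R d x"
    have ind: "indicator \<Omega> x *\<^sub>R (indicator (box u v) x * (indicator (box a b) x * d x)) = indicator (box u v) x *\<^sub>R ?e x" for u v x
      using ab by (auto simp: indicator_def)
    have "integrable (lebesgue_on \<Omega>) (\<lambda>x. indicator (box a b) x *\<^sub>R d x)"
      by (intro integrable_mult_indicator int boxm[OF ab])
    then have "integrable lebesgue (\<lambda>x. indicator \<Omega> x *\<^sub>R ?e x)"
      using \<Omega>'(2) by (simp add: integrable_restrict_space)
    moreover have "(\<lambda>x. indicator \<Omega> x *\<^sub>R ?e x) = ?e"
      using ab by (auto simp: fun_eq_iff indicator_def)
    ultimately have e: "integrable lebesgue ?e" by simp
    \<comment> \<open>Boxes generate the Borel sets only, so \<open>d\<close> is replaced by a Borel representative.\<close>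
    obtain g where g: "g \<in> borel_measurable lborel" "AE x in lborel. ?e x = g x"
      using completion_ex_borel_measurable_real[OF borel_measurable_integrable[OF e]] by blast
    have g': "AE x in lebesgue. ?e x = g x" using g(2) by (rule AE_completion)
    have gl: "g \<in> borel_measurable lebesgue" using g(1) by (rule measurable_completion)
    have "integrable lebesgue g"
      using integrable_cong_AE[OF borel_measurable_integrable[OF e] gl g'] e by simp
    then have gi: "integrable lborel g" using g(1) by (simp add: integrable_completion)
    have "(\<integral>x. indicator (box u v) x *\<^sub>R g x \<partial>lborel) = 0" for u v
    proof -
      obtain s t where st: "box u v \<inter> box a b = box s t" using box_Int_box by blast
      have m: "(\<lambda>x. indicator (box u v) x *\<^sub>R g x) \<in> borel_measurable lborel"
        using g(1) by (intro borel_measurable_scaleR borel_measurable_indicator) auto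
      have "(\<integral>x. indicator (box u v) x *\<^sub>R g x \<partial>lborel) = (\<integral>x. indicator (box u v) x *\<^sub>R g x \<partial>lebesgue)"
        using m by (simp add: integral_completion)
      also have "\<dots> = (\<integral>x. indicator (box u v) x *\<^sub>R ?e x \<partial>lebesgue)"
      proof (rule integral_cong_AE)
        show "(\<lambda>x. indicator (box u v) x *\<^sub>R g x) \<in> borel_measurable lebesgue"
          using m by (rule measurable_completion)
        show "(\<lambda>x. indicator (box u v) x *\<^sub>R ?e x) \<in> borel_measurable lebesgue"
          by (rule borel_measurable_scaleR[OF borel_measurable_indicator borel_measurable_integrable[OF e]]) simp
        show "AE x in lebesgue. indicator (box u v) x *\<^sub>R g x = indicator (box u v) x *\<^sub>R ?e x"
          using g' by eventually_elim simp
      qed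
      also have "\<dots> = (\<integral>x. indicator \<Omega> x *\<^sub>R (indicator (box s t) x * d x) \<partial>lebesgue)"
        using ab by (intro Bochner_Integration.integral_cong) (auto simp: st[symmetric] indicator_def)
      also have "\<dots> = (\<integral>x. indicator (box s t) x * d x \<partial>lebesgue_on \<Omega>)"
        using \<Omega>'(2) by (simp add: integral_restrict_space)
      also have "\<dots> = 0" using ab st by (intro box0) auto
      finally show ?thesis .
    qed
    then have "AE x in lborel. g x = 0" by (rule integral_boxes_zero_imp_AE_zero[OF gi])
    then have "AE x in lebesgue. g x = 0" by (rule AE_completion)
    with g' show ?thesis by eventually_elim (auto simp: indicator_def)
  qed
  obtain \<D> where D: "countable \<D>" "\<D> \<subseteq> Pow \<Omega>" "\<And>X. X \<in> \<D> \<Longrightarrow> \<exists>a b. X = box a b" "\<Union>\<D> = \<Omega>"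
    using open_countable_Union_open_box[OF \<Omega>(1)] by metis
  have "AE x in lebesgue. \<forall>X\<in>\<D>. x \<in> X \<longrightarrow> d x = 0"
  proof (subst AE_ball_countable[OF D(1)], intro ballI)
    fix X assume "X \<in> \<D>"
    then obtain a b where "X = box a b" "box a b \<subseteq> \<Omega>" using D by blast
    then show "AE x in lebesgue. x \<in> X \<longrightarrow> d x = 0" using box_AE by simp
  qed
  then have "AE x in lebesgue. x \<in> \<Omega> \<longrightarrow> d x = 0"
    using D(4) by (auto elim!: eventually_mono)
  then show ?thesis using \<Omega>'(2) by (simp add: ae_eq_def AE_restrict_space_iff)
qed

section \<open>Weak derivatives\<close>

lemma compact_support_in_mono_support:
  assumes "compact_support_in \<Omega> \<phi>" "{x. \<psi> x \<noteq> 0} \<subseteq> closure {x. \<phi> x \<noteq> 0}"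
  shows "compact_support_in \<Omega> \<psi>"
proof -
  have cl: "closure {x. \<psi> x \<noteq> 0} \<subseteq> closure {x. \<phi> x \<noteq> 0}"
    using assms(2) closed_closure by (rule closure_minimal)
  moreover have "compact (closure {x. \<phi> x \<noteq> 0})" "closure {x. \<phi> x \<noteq> 0} \<subseteq> \<Omega>"
    using assms(1) by (auto simp: compact_support_in_def)
  ultimately show ?thesis
    unfolding compact_support_in_def
    by (meson closed_closure bounded_subset compact_eq_bounded_closed order_trans)
qed

lemma partial_zero_outside_support:
  assumes "x \<notin> closure {x. \<phi> x \<noteq> 0}" shows "partial i \<phi> x = 0"
proof -
  have "((\<lambda>x. 0) has_derivative (\<lambda>x. 0)) (at x)" by simp
  then have "(\<phi> has_derivative (\<lambda>x. 0)) (at x)"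
    by (rule has_derivative_transform_within_open[of _ _ _ _ "- closure {x. \<phi> x \<noteq> 0}"])
       (use assms closure_subset[of "{x. \<phi> x \<noteq> 0}"] in auto)
  from partial_eqI[OF this] show ?thesis by simp
qed

lemma test_functions_partial: "\<phi> \<in> test_functions \<Omega> \<Longrightarrow> partial i \<phi> \<in> test_functions \<Omega>"
  unfolding test_functions_def
  using partial_zero_outside_support
  by (auto intro!: smooth_partial elim!: compact_support_in_mono_support)

lemma test_functions_mult: "\<lbrakk>\<phi> \<in> test_functions \<Omega>; smooth \<psi>\<rbrakk> \<Longrightarrow> (\<lambda>x. \<psi> x * \<phi> x) \<in> test_functions \<Omega>"
  unfolding test_functions_def
  by (auto intro!: smooth_mult closure_subset[THEN subsetD] elim!: compact_support_in_mono_support)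

text \<open>Vector-valued test functions see each component separately, which reduces the uniqueness of the weak curl to
  scalar functions.\<close>

lemma test_functions_axis:
  assumes "\<phi> \<in> test_functions \<Omega>" shows "(\<lambda>x. \<phi> x *\<^sub>R axis i 1) \<in> test_vec \<Omega>"
proof -
  have "smooth (\<lambda>x. axis i 1 $ j * \<phi> x)" for j
    using assms by (intro smooth_cmult) (simp add: test_functions_def)
  then have "smooth_vec (\<lambda>x. \<phi> x *\<^sub>R axis i 1)"
    by (simp add: smooth_vec_def mult.commute)
  moreover have "{x. \<phi> x *\<^sub>R (axis i 1 :: real^3) \<noteq> 0} = {x. \<phi> x \<noteq> 0}"
    by (auto simp: axis_eq_0_iff)
  ultimately show ?thesis
    using assms by (simp add: test_vec_def test_functions_def compact_support_in_def)
qed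

locale bounded_open =
  fixes \<Omega> :: "(real^3) set"
  assumes open_domain: "open \<Omega>" and bounded_domain: "bounded \<Omega>"
begin

lemma domain_lmeasurable: "\<Omega> \<in> lmeasurable"
  by (rule lmeasurable_open[OF bounded_domain open_domain])

lemma domain_sets: "\<Omega> \<in> sets lebesgue"
  using domain_lmeasurable by (rule fmeasurableD)

lemma ess_bounded_imp_L2: "f \<in> ess_bounded \<Omega> \<Longrightarrow> f \<in> L2 \<Omega>"
  by (rule ess_bounded_L2[OF domain_lmeasurable])

lemma smooth_ess_bounded: "smooth \<phi> \<Longrightarrow> \<phi> \<in> ess_bounded \<Omega>"
  by (rule continuous_ess_bounded[OF bounded_domain domain_sets smooth_continuous])

lemma smooth_L2: "smooth \<phi> \<Longrightarrow> \<phi> \<in> L2 \<Omega>"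
  by (intro ess_bounded_imp_L2 smooth_ess_bounded)

lemma smooth_vec_L2: "smooth_vec \<phi> \<Longrightarrow> \<phi> \<in> L2 \<Omega>"
  by (intro L2_componentwise smooth_L2) (simp add: smooth_vec_def)

lemma test_functions_L2: "\<phi> \<in> test_functions \<Omega> \<Longrightarrow> \<phi> \<in> L2 \<Omega>"
  by (simp add: test_functions_def smooth_L2)

lemma grad_L2: "smooth \<phi> \<Longrightarrow> grad \<phi> \<in> L2 \<Omega>"
  by (intro smooth_vec_L2) (simp add: smooth_vec_def grad_def smooth_partial)

lemma curl_L2:
  assumes "smooth_vec \<phi>" shows "curl \<phi> \<in> L2 \<Omega>"
proof (rule L2_componentwise)
  fix i :: 3
  have s: "smooth (\<lambda>x. partial j (\<lambda>y. \<phi> y $ k) x - partial l (\<lambda>y. \<phi> y $ m) x)" for j k l m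
    using assms by (intro smooth_diff smooth_partial) (simp_all add: smooth_vec_def)
  have "\<forall>i. (\<lambda>x. curl \<phi> x $ i) \<in> L2 \<Omega>"
    unfolding curl_def forall_3 by (simp add: vector_3 smooth_L2[OF s])
  then show "(\<lambda>x. curl \<phi> x $ i) \<in> L2 \<Omega>" by blast
qed

lemma ae_eq_if_same_moments:
  fixes d d' :: scalar_field
  assumes "d \<in> L2 \<Omega>" "d' \<in> L2 \<Omega>"
    and "\<And>\<phi>. \<phi> \<in> test_functions \<Omega> \<Longrightarrow> l2_inner \<Omega> d \<phi> = l2_inner \<Omega> d' \<phi>"
  shows "ae_eq \<Omega> d d'"
proof -
  have "ae_eq \<Omega> (\<lambda>x. d x - d' x) (\<lambda>x. 0)"
    using assms by (intro fundamental_lemma open_domain bounded_domain)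
      (auto simp: l2_inner_diff_left test_functions_L2)
  then show ?thesis by (simp add: ae_eq_diff_zero)
qed

lemma ae_eq_vec:
  fixes f g :: "real^3 \<Rightarrow> 'a^'n"
  assumes "\<And>i. ae_eq \<Omega> (\<lambda>x. f x $ i) (\<lambda>x. g x $ i)" shows "ae_eq \<Omega> f g"
proof -
  have "AE x in lebesgue_on \<Omega>. \<forall>i. f x $ i = g x $ i"
    using assms by (simp add: ae_eq_def AE_all_countable)
  then show ?thesis by (simp add: ae_eq_def vec_eq_iff)
qed

lemma has_weak_grad_unique:
  assumes "has_weak_grad \<Omega> u g" "has_weak_grad \<Omega> u g'" shows "ae_eq \<Omega> g g'"
proof (intro ae_eq_vec ae_eq_if_same_moments)
  fix i \<phi> assume \<phi>: "\<phi> \<in> test_functions \<Omega>"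
  with assms have "- l2_inner \<Omega> (\<lambda>x. g x $ i) \<phi> = - l2_inner \<Omega> (\<lambda>x. g' x $ i) \<phi>"
    unfolding has_weak_grad_def by metis
  then show "l2_inner \<Omega> (\<lambda>x. g x $ i) \<phi> = l2_inner \<Omega> (\<lambda>x. g' x $ i) \<phi>" by simp
qed (use assms in \<open>auto simp: has_weak_grad_def intro: L2_component\<close>)

lemma has_weak_curl_unique:
  assumes "has_weak_curl \<Omega> E w" "has_weak_curl \<Omega> E w'" shows "ae_eq \<Omega> w w'"
proof (intro ae_eq_vec ae_eq_if_same_moments)
  fix i \<phi> assume \<phi>: "\<phi> \<in> test_functions \<Omega>"
  then have "l2_inner \<Omega> w (\<lambda>x. \<phi> x *\<^sub>R axis i 1) = l2_inner \<Omega> w' (\<lambda>x. \<phi> x *\<^sub>R axis i 1)"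
    using assms test_functions_axis unfolding has_weak_curl_def by metis
  then show "l2_inner \<Omega> (\<lambda>x. w x $ i) \<phi> = l2_inner \<Omega> (\<lambda>x. w' x $ i) \<phi>"
    by (simp add: l2_inner_def inner_axis mult.commute)
qed (use assms in \<open>auto simp: has_weak_curl_def intro: L2_component\<close>)

lemma has_weak_div_unique:
  assumes "has_weak_div \<Omega> B d" "has_weak_div \<Omega> B d'" shows "ae_eq \<Omega> d d'"
proof (intro ae_eq_if_same_moments)
  fix \<phi> assume \<phi>: "\<phi> \<in> test_functions \<Omega>"
  with assms have "- l2_inner \<Omega> d \<phi> = - l2_inner \<Omega> d' \<phi>"
    unfolding has_weak_div_def by metis
  then show "l2_inner \<Omega> d \<phi> = l2_inner \<Omega> d' \<phi>" by simp
qed (use assms in \<open>auto simp: has_weak_div_def\<close>)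

lemma has_weak_grad_weak_grad: "\<exists>g. has_weak_grad \<Omega> u g \<Longrightarrow> has_weak_grad \<Omega> u (weak_grad \<Omega> u)"
  unfolding weak_grad_def by (erule someI_ex)

lemma has_weak_curl_weak_curl: "\<exists>w. has_weak_curl \<Omega> E w \<Longrightarrow> has_weak_curl \<Omega> E (weak_curl \<Omega> E)"
  unfolding weak_curl_def by (erule someI_ex)

lemma has_weak_div_weak_div: "\<exists>d. has_weak_div \<Omega> B d \<Longrightarrow> has_weak_div \<Omega> B (weak_div \<Omega> B)"
  unfolding weak_div_def by (erule someI_ex)

lemma l2_inner_ae_lincomb:
  assumes "u \<in> L2 \<Omega>" "v \<in> L2 \<Omega>" "w \<in> L2 \<Omega>" "ae_eq \<Omega> w (\<lambda>x. u x + c *\<^sub>R v x)" "g \<in> L2 \<Omega>"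
  shows "l2_inner \<Omega> w g = l2_inner \<Omega> u g + c * l2_inner \<Omega> v g"
  using ae_linear_formD[OF ae_linear_form_l2_inner_left[OF assms(5)] assms(1-4)] .

text \<open>Together with uniqueness, these closure properties make the representatives selected by
  \<open>weak_grad\<close>, \<open>weak_curl\<close> and \<open>weak_div\<close> linear almost everywhere.\<close>

lemma has_weak_grad_lincomb:
  assumes "has_weak_grad \<Omega> u g" "has_weak_grad \<Omega> v g'"
    and "u \<in> L2 \<Omega>" "v \<in> L2 \<Omega>" "w \<in> L2 \<Omega>" "ae_eq \<Omega> w (\<lambda>x. u x + c *\<^sub>R v x)"
  shows "has_weak_grad \<Omega> w (\<lambda>x. g x + c *\<^sub>R g' x)"
  unfolding has_weak_grad_def
proof (intro conjI ballI allI)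
  have g: "g \<in> L2 \<Omega>" "g' \<in> L2 \<Omega>" using assms(1,2) by (auto simp: has_weak_grad_def)
  then show "(\<lambda>x. g x + c *\<^sub>R g' x) \<in> L2 \<Omega>" by (intro L2_add L2_scale)
  fix \<phi> i assume \<phi>: "\<phi> \<in> test_functions \<Omega>"
  have "l2_inner \<Omega> w (partial i \<phi>) = l2_inner \<Omega> u (partial i \<phi>) + c * l2_inner \<Omega> v (partial i \<phi>)"
    by (rule l2_inner_ae_lincomb) (use assms \<phi> in \<open>auto intro: test_functions_L2 test_functions_partial\<close>)
  also have "\<dots> = - (l2_inner \<Omega> (\<lambda>x. g x $ i) \<phi> + c * l2_inner \<Omega> (\<lambda>x. g' x $ i) \<phi>)"
    using assms(1,2) \<phi> by (simp add: has_weak_grad_def)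
  also have "l2_inner \<Omega> (\<lambda>x. g x $ i) \<phi> + c * l2_inner \<Omega> (\<lambda>x. g' x $ i) \<phi>
      = l2_inner \<Omega> (\<lambda>x. g x $ i + c *\<^sub>R g' x $ i) \<phi>"
    using g \<phi> by (subst l2_inner_add_left) (auto intro: L2_component L2_scale test_functions_L2 simp del: real_scaleR_def)
  finally show "l2_inner \<Omega> w (partial i \<phi>) = - l2_inner \<Omega> (\<lambda>x. (g x + c *\<^sub>R g' x) $ i) \<phi>"
    by simp
qed

lemma has_weak_curl_lincomb:
  assumes "has_weak_curl \<Omega> u g" "has_weak_curl \<Omega> v g'"
    and "u \<in> L2 \<Omega>" "v \<in> L2 \<Omega>" "w \<in> L2 \<Omega>" "ae_eq \<Omega> w (\<lambda>x. u x + c *\<^sub>R v x)"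
  shows "has_weak_curl \<Omega> w (\<lambda>x. g x + c *\<^sub>R g' x)"
  unfolding has_weak_curl_def
proof (intro conjI ballI)
  have g: "g \<in> L2 \<Omega>" "g' \<in> L2 \<Omega>" using assms(1,2) by (auto simp: has_weak_curl_def)
  then show "(\<lambda>x. g x + c *\<^sub>R g' x) \<in> L2 \<Omega>" by (intro L2_add L2_scale)
  fix \<phi> assume \<phi>: "\<phi> \<in> test_vec \<Omega>"
  then have s: "smooth_vec \<phi>" by (simp add: test_vec_def)
  have "l2_inner \<Omega> w (curl \<phi>) = l2_inner \<Omega> u (curl \<phi>) + c * l2_inner \<Omega> v (curl \<phi>)"
    by (rule l2_inner_ae_lincomb) (use assms s in \<open>auto intro: curl_L2\<close>)
  also have "\<dots> = l2_inner \<Omega> g \<phi> + c * l2_inner \<Omega> g' \<phi>"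
    using assms(1,2) \<phi> by (simp add: has_weak_curl_def)
  also have "\<dots> = l2_inner \<Omega> (\<lambda>x. g x + c *\<^sub>R g' x) \<phi>"
    using g smooth_vec_L2[OF s] by (simp add: l2_inner_add_left L2_scale)
  finally show "l2_inner \<Omega> w (curl \<phi>) = l2_inner \<Omega> (\<lambda>x. g x + c *\<^sub>R g' x) \<phi>" .
qed

lemma has_weak_div_lincomb:
  assumes "has_weak_div \<Omega> u g" "has_weak_div \<Omega> v g'"
    and "u \<in> L2 \<Omega>" "v \<in> L2 \<Omega>" "w \<in> L2 \<Omega>" "ae_eq \<Omega> w (\<lambda>x. u x + c *\<^sub>R v x)"
  shows "has_weak_div \<Omega> w (\<lambda>x. g x + c *\<^sub>R g' x)"
  unfolding has_weak_div_def
proof (intro conjI ballI)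
  have g: "g \<in> L2 \<Omega>" "g' \<in> L2 \<Omega>" using assms(1,2) by (auto simp: has_weak_div_def)
  then show "(\<lambda>x. g x + c *\<^sub>R g' x) \<in> L2 \<Omega>" by (intro L2_add L2_scale)
  fix \<phi> assume \<phi>: "\<phi> \<in> test_functions \<Omega>"
  then have s: "smooth \<phi>" by (simp add: test_functions_def)
  have "l2_inner \<Omega> w (grad \<phi>) = l2_inner \<Omega> u (grad \<phi>) + c * l2_inner \<Omega> v (grad \<phi>)"
    by (rule l2_inner_ae_lincomb) (use assms s in \<open>auto intro: grad_L2\<close>)
  also have "\<dots> = - (l2_inner \<Omega> g \<phi> + c * l2_inner \<Omega> g' \<phi>)"
    using assms(1,2) \<phi> by (simp add: has_weak_div_def)
  also have "l2_inner \<Omega> g \<phi> + c * l2_inner \<Omega> g' \<phi> = l2_inner \<Omega> (\<lambda>x. g x + c *\<^sub>R g' x) \<phi>"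
    using g smooth_L2[OF s] by (subst l2_inner_add_left) (auto intro: L2_scale simp del: real_scaleR_def)
  finally show "l2_inner \<Omega> w (grad \<phi>) = - l2_inner \<Omega> (\<lambda>x. g x + c *\<^sub>R g' x) \<phi>" .
qed

lemma ae_linear_weak_grad: "ae_linear \<Omega> {u \<in> L2 \<Omega>. \<exists>g. has_weak_grad \<Omega> u g} (weak_grad \<Omega>)"
  unfolding ae_linear_def
proof (intro ballI allI impI)
  fix u v w c
  assume u: "u \<in> {u \<in> L2 \<Omega>. \<exists>g. has_weak_grad \<Omega> u g}" and v: "v \<in> {u \<in> L2 \<Omega>. \<exists>g. has_weak_grad \<Omega> u g}"
    and w: "w \<in> {u \<in> L2 \<Omega>. \<exists>g. has_weak_grad \<Omega> u g}" and eq: "ae_eq \<Omega> w (\<lambda>x. u x + c *\<^sub>R v x)"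
  then have "has_weak_grad \<Omega> u (weak_grad \<Omega> u)" "has_weak_grad \<Omega> v (weak_grad \<Omega> v)" "has_weak_grad \<Omega> w (weak_grad \<Omega> w)"
    using has_weak_grad_weak_grad by blast+
  with u v w show "ae_eq \<Omega> (weak_grad \<Omega> w) (\<lambda>x. weak_grad \<Omega> u x + c *\<^sub>R weak_grad \<Omega> v x)"
    by (intro has_weak_grad_unique[OF _ has_weak_grad_lincomb[OF _ _ _ _ _ eq]]) blast+
qed

lemma ae_linear_weak_curl: "ae_linear \<Omega> {u \<in> L2 \<Omega>. \<exists>g. has_weak_curl \<Omega> u g} (weak_curl \<Omega>)"
  unfolding ae_linear_def
proof (intro ballI allI impI)
  fix u v w c
  assume u: "u \<in> {u \<in> L2 \<Omega>. \<exists>g. has_weak_curl \<Omega> u g}" and v: "v \<in> {u \<in> L2 \<Omega>. \<exists>g. has_weak_curl \<Omega> u g}"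
    and w: "w \<in> {u \<in> L2 \<Omega>. \<exists>g. has_weak_curl \<Omega> u g}" and eq: "ae_eq \<Omega> w (\<lambda>x. u x + c *\<^sub>R v x)"
  then have "has_weak_curl \<Omega> u (weak_curl \<Omega> u)" "has_weak_curl \<Omega> v (weak_curl \<Omega> v)" "has_weak_curl \<Omega> w (weak_curl \<Omega> w)"
    using has_weak_curl_weak_curl by blast+
  with u v w show "ae_eq \<Omega> (weak_curl \<Omega> w) (\<lambda>x. weak_curl \<Omega> u x + c *\<^sub>R weak_curl \<Omega> v x)"
    by (intro has_weak_curl_unique[OF _ has_weak_curl_lincomb[OF _ _ _ _ _ eq]]) blast+
qed

lemma ae_linear_weak_div: "ae_linear \<Omega> {u \<in> L2 \<Omega>. \<exists>g. has_weak_div \<Omega> u g} (weak_div \<Omega>)"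
  unfolding ae_linear_def
proof (intro ballI allI impI)
  fix u v w c
  assume u: "u \<in> {u \<in> L2 \<Omega>. \<exists>g. has_weak_div \<Omega> u g}" and v: "v \<in> {u \<in> L2 \<Omega>. \<exists>g. has_weak_div \<Omega> u g}"
    and w: "w \<in> {u \<in> L2 \<Omega>. \<exists>g. has_weak_div \<Omega> u g}" and eq: "ae_eq \<Omega> w (\<lambda>x. u x + c *\<^sub>R v x)"
  then have "has_weak_div \<Omega> u (weak_div \<Omega> u)" "has_weak_div \<Omega> v (weak_div \<Omega> v)" "has_weak_div \<Omega> w (weak_div \<Omega> w)"
    using has_weak_div_weak_div by blast+
  with u v w show "ae_eq \<Omega> (weak_div \<Omega> w) (\<lambda>x. weak_div \<Omega> u x + c *\<^sub>R weak_div \<Omega> v x)"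
    by (intro has_weak_div_unique[OF _ has_weak_div_lincomb[OF _ _ _ _ _ eq]]) blast+
qed

text \<open>The boundary condition refers to the selected representative of the curl, which agrees with the linear
  combination of the curls only up to a null set.\<close>

lemma linear_space_H0_curl: "linear_space (H0_curl \<Omega>)"
proof -
  have lin: "w \<in> H0_curl \<Omega>" if u: "u \<in> H0_curl \<Omega>" and v: "v \<in> H0_curl \<Omega>" and w: "w = (\<lambda>x. u x + c *\<^sub>R v x)" for u v w c
  proof -
    have uv: "u \<in> L2 \<Omega>" "v \<in> L2 \<Omega>" "\<exists>g. has_weak_curl \<Omega> u g" "\<exists>g. has_weak_curl \<Omega> v g"
      using u v by (auto simp: H0_curl_def)
    have wL: "w \<in> L2 \<Omega>" unfolding w using uv by (intro L2_add L2_scale)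
    let ?g = "weak_curl \<Omega> u" and ?g' = "weak_curl \<Omega> v"
    have g: "has_weak_curl \<Omega> u ?g" "has_weak_curl \<Omega> v ?g'"
      using uv by (auto intro: has_weak_curl_weak_curl)
    have h: "has_weak_curl \<Omega> w (\<lambda>x. ?g x + c *\<^sub>R ?g' x)"
      by (rule has_weak_curl_lincomb[OF g uv(1,2) wL]) (simp add: w)
    then have hw: "has_weak_curl \<Omega> w (weak_curl \<Omega> w)" by (blast intro: has_weak_curl_weak_curl)
    have gL: "?g \<in> L2 \<Omega>" "?g' \<in> L2 \<Omega>" "weak_curl \<Omega> w \<in> L2 \<Omega>"
      using g hw by (auto simp: has_weak_curl_def)
    have "l2_inner \<Omega> (weak_curl \<Omega> w) \<phi> - l2_inner \<Omega> w (curl \<phi>) = 0" if \<phi>: "smooth_vec \<phi>" for \<phi>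
    proof -
      have "l2_inner \<Omega> (weak_curl \<Omega> w) \<phi> = l2_inner \<Omega> ?g \<phi> + c * l2_inner \<Omega> ?g' \<phi>"
        by (rule l2_inner_ae_lincomb[OF gL has_weak_curl_unique[OF hw h] smooth_vec_L2[OF \<phi>]])
      moreover have "l2_inner \<Omega> w (curl \<phi>) = l2_inner \<Omega> u (curl \<phi>) + c * l2_inner \<Omega> v (curl \<phi>)"
        by (rule l2_inner_ae_lincomb[OF uv(1,2) wL _ curl_L2[OF \<phi>]]) (simp add: w)
      moreover have "l2_inner \<Omega> ?g \<phi> = l2_inner \<Omega> u (curl \<phi>)" "l2_inner \<Omega> ?g' \<phi> = l2_inner \<Omega> v (curl \<phi>)"
        using u v \<phi> by (auto simp: H0_curl_def)
      ultimately show ?thesis by simp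
    qed
    then show ?thesis using wL h by (auto simp: H0_curl_def)
  qed
  have zero: "(\<lambda>x. 0) \<in> H0_curl \<Omega>"
  proof -
    have z: "has_weak_curl \<Omega> (\<lambda>x. 0) (\<lambda>x. 0)" by (simp add: has_weak_curl_def)
    then have hw: "has_weak_curl \<Omega> (\<lambda>x. 0) (weak_curl \<Omega> (\<lambda>x. 0))" by (blast intro: has_weak_curl_weak_curl)
    have "l2_inner \<Omega> (weak_curl \<Omega> (\<lambda>x. 0)) \<phi> = 0" if "smooth_vec \<phi>" for \<phi>
      using l2_inner_cong[OF _ _ _ _ has_weak_curl_unique[OF hw z] ae_eq_refl, of \<phi>] hw smooth_vec_L2[OF that]
      by (simp add: has_weak_curl_def)
    then show ?thesis using z by (auto simp: H0_curl_def)
  qed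
  show ?thesis by (rule linear_spaceI[OF zero lin[OF _ _ refl]])
qed

lemma linear_space_H0_div: "linear_space (H0_div \<Omega>)"
proof -
  have lin: "w \<in> H0_div \<Omega>" if u: "u \<in> H0_div \<Omega>" and v: "v \<in> H0_div \<Omega>" and w: "w = (\<lambda>x. u x + c *\<^sub>R v x)" for u v w c
  proof -
    have uv: "u \<in> L2 \<Omega>" "v \<in> L2 \<Omega>" "\<exists>g. has_weak_div \<Omega> u g" "\<exists>g. has_weak_div \<Omega> v g"
      using u v by (auto simp: H0_div_def)
    have wL: "w \<in> L2 \<Omega>" unfolding w using uv by (intro L2_add L2_scale)
    let ?g = "weak_div \<Omega> u" and ?g' = "weak_div \<Omega> v"
    have g: "has_weak_div \<Omega> u ?g" "has_weak_div \<Omega> v ?g'"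
      using uv by (auto intro: has_weak_div_weak_div)
    have h: "has_weak_div \<Omega> w (\<lambda>x. ?g x + c *\<^sub>R ?g' x)"
      by (rule has_weak_div_lincomb[OF g uv(1,2) wL]) (simp add: w)
    then have hw: "has_weak_div \<Omega> w (weak_div \<Omega> w)" by (blast intro: has_weak_div_weak_div)
    have gL: "?g \<in> L2 \<Omega>" "?g' \<in> L2 \<Omega>" "weak_div \<Omega> w \<in> L2 \<Omega>"
      using g hw by (auto simp: has_weak_div_def)
    have "l2_inner \<Omega> (weak_div \<Omega> w) \<phi> + l2_inner \<Omega> w (grad \<phi>) = 0" if \<phi>: "smooth \<phi>" for \<phi>
    proof -
      have "l2_inner \<Omega> (weak_div \<Omega> w) \<phi> = l2_inner \<Omega> ?g \<phi> + c * l2_inner \<Omega> ?g' \<phi>"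
        by (rule l2_inner_ae_lincomb[OF gL has_weak_div_unique[OF hw h] smooth_L2[OF \<phi>]])
      moreover have "l2_inner \<Omega> w (grad \<phi>) = l2_inner \<Omega> u (grad \<phi>) + c * l2_inner \<Omega> v (grad \<phi>)"
        by (rule l2_inner_ae_lincomb[OF uv(1,2) wL _ grad_L2[OF \<phi>]]) (simp add: w)
      moreover have "l2_inner \<Omega> ?g \<phi> = - l2_inner \<Omega> u (grad \<phi>)" "l2_inner \<Omega> ?g' \<phi> = - l2_inner \<Omega> v (grad \<phi>)"
        using u v \<phi> by (auto simp: H0_div_def eq_neg_iff_add_eq_0)
      ultimately show ?thesis by simp
    qed
    then show ?thesis using wL h by (auto simp: H0_div_def)
  qed
  have zero: "(\<lambda>x. 0) \<in> H0_div \<Omega>"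
  proof -
    have z: "has_weak_div \<Omega> (\<lambda>x. 0) (\<lambda>x. 0)" by (simp add: has_weak_div_def)
    then have hw: "has_weak_div \<Omega> (\<lambda>x. 0) (weak_div \<Omega> (\<lambda>x. 0))" by (blast intro: has_weak_div_weak_div)
    have "l2_inner \<Omega> (weak_div \<Omega> (\<lambda>x. 0)) \<phi> = 0" if "smooth \<phi>" for \<phi>
      using l2_inner_cong[OF _ _ _ _ has_weak_div_unique[OF hw z] ae_eq_refl, of \<phi>] hw smooth_L2[OF that]
      by (simp add: has_weak_div_def)
    then show ?thesis using z by (auto simp: H0_div_def)
  qed
  show ?thesis by (rule linear_spaceI[OF zero lin[OF _ _ refl]])
qed

lemma H01_vec_component: "v \<in> H01_vec \<Omega> \<Longrightarrow> (\<lambda>x. v x $ i) \<in> H01 \<Omega>"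
  by (simp add: H01_vec_def)

lemma H01_has_weak_grad: "u \<in> H01 \<Omega> \<Longrightarrow> has_weak_grad \<Omega> u (weak_grad \<Omega> u)"
  by (auto simp: H01_def intro: has_weak_grad_weak_grad)

lemma H01_L2: "u \<in> H01 \<Omega> \<Longrightarrow> u \<in> L2 \<Omega>"
  by (simp add: H01_def)

lemma weak_grad_L2: "u \<in> H01 \<Omega> \<Longrightarrow> weak_grad \<Omega> u \<in> L2 \<Omega>"
  using H01_has_weak_grad by (auto simp: has_weak_grad_def)

lemma H01_vec_L2: "v \<in> H01_vec \<Omega> \<Longrightarrow> v \<in> L2 \<Omega>"
  by (intro L2_componentwise H01_L2 H01_vec_component)

lemma weak_jacobian_L2: "v \<in> H01_vec \<Omega> \<Longrightarrow> weak_jacobian \<Omega> v \<in> L2 \<Omega>"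
  by (rule L2_componentwise) (simp add: weak_jacobian_def weak_grad_L2 H01_vec_component)

lemma ae_linear_weak_jacobian: "ae_linear \<Omega> (H01_vec \<Omega>) (weak_jacobian \<Omega>)"
  unfolding ae_linear_def
proof (intro ballI allI impI ae_eq_vec[where f = "weak_jacobian \<Omega> _"])
  fix u v w c i
  assume *: "u \<in> H01_vec \<Omega>" "v \<in> H01_vec \<Omega>" "w \<in> H01_vec \<Omega>" "ae_eq \<Omega> w (\<lambda>x. u x + c *\<^sub>R v x)"
  have mem: "(\<lambda>x. z x $ i) \<in> {u \<in> L2 \<Omega>. \<exists>g. has_weak_grad \<Omega> u g}" if "z \<in> H01_vec \<Omega>" for z
    using H01_vec_component[OF that, of i] by (simp add: H01_def)
  have "ae_eq \<Omega> (\<lambda>x. w x $ i) (\<lambda>x. u x $ i + c *\<^sub>R v x $ i)"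
    using ae_eq_comp[OF *(4), of "\<lambda>y. y $ i"] by simp
  then show "ae_eq \<Omega> (\<lambda>x. weak_jacobian \<Omega> w x $ i) (\<lambda>x. (weak_jacobian \<Omega> u x + c *\<^sub>R weak_jacobian \<Omega> v x) $ i)"
    using ae_linearD[OF ae_linear_weak_grad mem[OF *(1)] mem[OF *(2)] mem[OF *(3)], of c]
    by (simp add: weak_jacobian_def)
qed

lemma H01_vec_has_weak_div:
  assumes v: "v \<in> H01_vec \<Omega>"
  shows "has_weak_div \<Omega> v (\<lambda>x. \<Sum>i\<in>UNIV. weak_grad \<Omega> (\<lambda>y. v y $ i) x $ i)"
  unfolding has_weak_div_def
proof (intro conjI ballI)
  have L: "(\<lambda>x. weak_grad \<Omega> (\<lambda>y. v y $ i) x $ i) \<in> L2 \<Omega>" for i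
    by (intro L2_component weak_grad_L2 H01_vec_component v)
  then show "(\<lambda>x. \<Sum>i\<in>UNIV. weak_grad \<Omega> (\<lambda>y. v y $ i) x $ i) \<in> L2 \<Omega>" by (rule L2_sum)
  fix \<phi> assume \<phi>: "\<phi> \<in> test_functions \<Omega>"
  have "l2_inner \<Omega> v (grad \<phi>) = (\<Sum>i\<in>UNIV. l2_inner \<Omega> (\<lambda>x. v x $ i) (partial i \<phi>))"
    unfolding l2_inner_def inner_vec_def grad_def vec_lambda_beta
    by (intro Bochner_Integration.integral_sum L2_inner_integrable H01_L2 H01_vec_component v
        test_functions_L2 test_functions_partial \<phi>)
  also have "\<dots> = (\<Sum>i\<in>UNIV. - l2_inner \<Omega> (\<lambda>x. weak_grad \<Omega> (\<lambda>y. v y $ i) x $ i) \<phi>)"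
    using H01_has_weak_grad[OF H01_vec_component[OF v]] \<phi> by (simp add: has_weak_grad_def)
  also have "\<dots> = - l2_inner \<Omega> (\<lambda>x. \<Sum>i\<in>UNIV. weak_grad \<Omega> (\<lambda>y. v y $ i) x $ i) \<phi>"
    by (simp add: l2_inner_sum_left[OF L test_functions_L2[OF \<phi>]] sum_negf)
  finally show "l2_inner \<Omega> v (grad \<phi>) = - l2_inner \<Omega> (\<lambda>x. \<Sum>i\<in>UNIV. weak_grad \<Omega> (\<lambda>y. v y $ i) x $ i) \<phi>" .
qed

section \<open>The Poincare inequality\<close>

lemma l2_inner_tendsto:
  assumes f: "\<And>n. f n \<in> L2 \<Omega>" and g: "g \<in> L2 \<Omega>" and h: "h \<in> L2 \<Omega>"
    and lim: "(\<lambda>n. l2_norm \<Omega> (\<lambda>x. f n x - g x)) \<longlonglongrightarrow> 0"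
  shows "(\<lambda>n. l2_inner \<Omega> h (f n)) \<longlonglongrightarrow> l2_inner \<Omega> h g"
proof -
  have "(\<lambda>n. l2_inner \<Omega> h (f n) - l2_inner \<Omega> h g) \<longlonglongrightarrow> 0"
  proof (rule Lim_null_comparison)
    show "\<forall>\<^sub>F n in sequentially. norm (l2_inner \<Omega> h (f n) - l2_inner \<Omega> h g)
        \<le> l2_norm \<Omega> h * l2_norm \<Omega> (\<lambda>x. f n x - g x)"
      using l2_Cauchy_Schwarz[OF h L2_diff[OF f g]] by (simp add: l2_inner_diff_right[OF f g h])
    show "(\<lambda>n. l2_norm \<Omega> h * l2_norm \<Omega> (\<lambda>x. f n x - g x)) \<longlonglongrightarrow> 0"
      using tendsto_mult[OF tendsto_const lim] by simp
  qed
  then show ?thesis by (simp add: LIM_zero_iff)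
qed

text \<open>For a test function \<open>\<phi>\<close> the definition of the weak derivative gives \<open>(u, \<phi> +
  x\<^sub>1 \<partial>\<^sub>1\<phi>) = - (\<partial>\<^sub>1u, x\<^sub>1 \<phi>)\<close>. Letting
  \<open>\<phi>\<close> tend to \<open>u\<close> in \<open>H\<^sup>1\<close> yields
  \<open>\<parallel>u\<parallel>\<^sup>2 = - 2 (\<partial>\<^sub>1u, x\<^sub>1 u)\<close>, and
  \<open>x\<^sub>1\<close> is bounded on \<open>\<Omega>\<close>.\<close>

lemma Poincare_H01:
  assumes R: "\<And>x. x \<in> \<Omega> \<Longrightarrow> \<bar>x $ 1\<bar> \<le> R" "0 \<le> R" and u: "u \<in> H01 \<Omega>"
  shows "l2_norm \<Omega> u \<le> 2 * R * l2_norm \<Omega> (weak_grad \<Omega> u)"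
proof -
  let ?g = "weak_grad \<Omega> u" and ?x = "\<lambda>x::real^3. x $ 1"
  obtain \<phi> where \<phi>: "\<And>n::nat. \<phi> n \<in> test_functions \<Omega>"
    and lim: "(\<lambda>n. l2_norm \<Omega> (\<lambda>x. \<phi> n x - u x)) \<longlonglongrightarrow> 0"
    and glim: "(\<lambda>n. l2_norm \<Omega> (\<lambda>x. grad (\<phi> n) x - ?g x)) \<longlonglongrightarrow> 0"
    using u by (auto simp: H01_def)
  have uL: "u \<in> L2 \<Omega>" and gL: "?g \<in> L2 \<Omega>" and g1L: "(\<lambda>x. ?g x $ 1) \<in> L2 \<Omega>"
    using u by (auto intro: H01_L2 weak_grad_L2 L2_component)
  have s: "smooth (\<phi> n)" for n using \<phi> by (simp add: test_functions_def)
  have mult_L2: "(\<lambda>x. x $ 1 * f x) \<in> L2 \<Omega>"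
    and mult_norm: "l2_norm \<Omega> (\<lambda>x. x $ 1 * f x) \<le> R * l2_norm \<Omega> f" if f: "f \<in> L2 \<Omega>" for f
  proof -
    have m: "(\<lambda>x. x $ 1 * f x) \<in> borel_measurable (lebesgue_on \<Omega>)"
      by (intro borel_measurable_times L2_measurable[OF f] L2_measurable[OF smooth_L2[OF smooth_coordinate]])
    have le: "AE x in lebesgue_on \<Omega>. norm (x $ 1 * f x) \<le> R * norm (f x)"
      using R by (intro AE_I2) (auto simp: space_restrict_space abs_mult intro!: mult_right_mono)
    show "(\<lambda>x. x $ 1 * f x) \<in> L2 \<Omega>" by (rule L2_bound[OF m f le])
    show "l2_norm \<Omega> (\<lambda>x. x $ 1 * f x) \<le> R * l2_norm \<Omega> f" by (rule l2_norm_mono[OF m f R(2) le])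
  qed
  have mult_lim: "(\<lambda>n. l2_norm \<Omega> (\<lambda>x. x $ 1 * f n x - x $ 1 * h x)) \<longlonglongrightarrow> 0"
    if "\<And>n. f n \<in> L2 \<Omega>" "h \<in> L2 \<Omega>" "(\<lambda>n. l2_norm \<Omega> (\<lambda>x. f n x - h x)) \<longlonglongrightarrow> 0" for f h
  proof (rule Lim_null_comparison)
    show "\<forall>\<^sub>F n in sequentially. norm (l2_norm \<Omega> (\<lambda>x. x $ 1 * f n x - x $ 1 * h x)) \<le> R * l2_norm \<Omega> (\<lambda>x. f n x - h x)"
      using mult_norm[OF L2_diff[OF that(1,2)]] by (simp add: right_diff_distrib)
    show "(\<lambda>n. R * l2_norm \<Omega> (\<lambda>x. f n x - h x)) \<longlonglongrightarrow> 0"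
      using tendsto_mult[OF tendsto_const that(3)] by simp
  qed
  have p1: "partial 1 (\<phi> n) = (\<lambda>x. grad (\<phi> n) x $ 1)" for n by (simp add: grad_def)
  have p1L: "partial 1 (\<phi> n) \<in> L2 \<Omega>" for n by (intro test_functions_L2 test_functions_partial \<phi>)
  have p1lim: "(\<lambda>n. l2_norm \<Omega> (\<lambda>x. partial 1 (\<phi> n) x - ?g x $ 1)) \<longlonglongrightarrow> 0"
  proof (rule Lim_null_comparison[OF always_eventually glim], rule allI)
    fix n
    have "l2_norm \<Omega> (\<lambda>x. partial 1 (\<phi> n) x - ?g x $ 1) \<le> 1 * l2_norm \<Omega> (\<lambda>x. grad (\<phi> n) x - ?g x)"
    proof (rule l2_norm_mono)
      show "(\<lambda>x. partial 1 (\<phi> n) x - ?g x $ 1) \<in> borel_measurable (lebesgue_on \<Omega>)"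
        by (rule L2_measurable[OF L2_diff[OF p1L g1L]])
      show "AE x in lebesgue_on \<Omega>. norm (partial 1 (\<phi> n) x - ?g x $ 1) \<le> 1 * norm (grad (\<phi> n) x - ?g x)"
        using component_le_norm_cart[of "grad (\<phi> n) _ - ?g _" 1] by (intro AE_I2) (simp add: p1)
    qed (auto intro: L2_diff grad_L2 s gL)
    then show "norm (l2_norm \<Omega> (\<lambda>x. partial 1 (\<phi> n) x - ?g x $ 1)) \<le> l2_norm \<Omega> (\<lambda>x. grad (\<phi> n) x - ?g x)"
      by simp
  qed
  have \<phi>L: "\<phi> n \<in> L2 \<Omega>" for n by (intro test_functions_L2 \<phi>)
  have ibp: "l2_inner \<Omega> u (\<phi> n) + l2_inner \<Omega> u (\<lambda>x. x $ 1 * partial 1 (\<phi> n) x)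
      = - l2_inner \<Omega> (\<lambda>x. ?g x $ 1) (\<lambda>x. x $ 1 * \<phi> n x)" for n
  proof -
    have t: "(\<lambda>x. x $ 1 * \<phi> n x) \<in> test_functions \<Omega>" by (intro test_functions_mult \<phi> smooth_coordinate)
    have "partial 1 (\<lambda>x. x $ 1 * \<phi> n x) = (\<lambda>x. \<phi> n x + x $ 1 * partial 1 (\<phi> n) x)"
      by (rule ext, subst partial_mult)
         (simp_all add: smooth_differentiable[OF smooth_coordinate] smooth_differentiable[OF s] partial_coordinate)
    then have "l2_inner \<Omega> u (partial 1 (\<lambda>x. x $ 1 * \<phi> n x))
        = l2_inner \<Omega> u (\<phi> n) + l2_inner \<Omega> u (\<lambda>x. x $ 1 * partial 1 (\<phi> n) x)"
      by (simp add: l2_inner_add_right[OF \<phi>L mult_L2[OF p1L] uL])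
    then show ?thesis
      using H01_has_weak_grad[OF u] t by (simp add: has_weak_grad_def)
  qed
  have "(\<lambda>n. l2_inner \<Omega> u (\<phi> n) + l2_inner \<Omega> u (\<lambda>x. x $ 1 * partial 1 (\<phi> n) x))
      \<longlonglongrightarrow> l2_inner \<Omega> u u + l2_inner \<Omega> u (\<lambda>x. x $ 1 * ?g x $ 1)"
    by (intro tendsto_add l2_inner_tendsto \<phi>L uL lim mult_L2 p1L g1L mult_lim p1lim)
  moreover have "(\<lambda>n. - l2_inner \<Omega> (\<lambda>x. ?g x $ 1) (\<lambda>x. x $ 1 * \<phi> n x))
      \<longlonglongrightarrow> - l2_inner \<Omega> (\<lambda>x. ?g x $ 1) (\<lambda>x. x $ 1 * u x)"
    by (intro tendsto_minus l2_inner_tendsto \<phi>L uL lim mult_L2 g1L mult_lim)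
  ultimately have "l2_inner \<Omega> u u + l2_inner \<Omega> u (\<lambda>x. x $ 1 * ?g x $ 1) = - l2_inner \<Omega> (\<lambda>x. ?g x $ 1) (\<lambda>x. x $ 1 * u x)"
    unfolding ibp by (rule LIMSEQ_unique)
  moreover have "l2_inner \<Omega> u (\<lambda>x. x $ 1 * ?g x $ 1) = l2_inner \<Omega> (\<lambda>x. ?g x $ 1) (\<lambda>x. x $ 1 * u x)"
    by (simp add: l2_inner_def mult_ac)
  ultimately have "(l2_norm \<Omega> u)\<^sup>2 = - 2 * l2_inner \<Omega> (\<lambda>x. ?g x $ 1) (\<lambda>x. x $ 1 * u x)"
    by (simp add: l2_norm_square)
  also have "\<dots> \<le> 2 * (l2_norm \<Omega> (\<lambda>x. ?g x $ 1) * l2_norm \<Omega> (\<lambda>x. x $ 1 * u x))"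
    using l2_Cauchy_Schwarz[OF g1L mult_L2[OF uL]] by linarith
  also have "\<dots> \<le> 2 * (l2_norm \<Omega> ?g * (R * l2_norm \<Omega> u))"
  proof -
    have "l2_norm \<Omega> (\<lambda>x. ?g x $ 1) \<le> 1 * l2_norm \<Omega> ?g"
      using component_le_norm_cart[of "?g _" 1]
      by (intro l2_norm_mono L2_measurable[OF g1L] gL AE_I2) simp_all
    then show ?thesis using mult_norm[OF uL] by (intro mult_left_mono mult_mono) auto
  qed
  finally have "l2_norm \<Omega> u * l2_norm \<Omega> u \<le> (2 * R * l2_norm \<Omega> ?g) * l2_norm \<Omega> u"
    by (simp add: power2_eq_square mult_ac)
  then show ?thesis
    using R(2) by (cases "l2_norm \<Omega> u = 0") (simp_all add: mult_le_cancel_right order_less_le)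
qed

lemma Poincare_H01_vec: "\<exists>C\<ge>0. \<forall>v\<in>H01_vec \<Omega>. l2_norm \<Omega> v \<le> C * l2_norm \<Omega> (weak_jacobian \<Omega> v)"
proof -
  obtain R where R: "\<And>x. x \<in> \<Omega> \<Longrightarrow> norm x \<le> R" and R0: "0 < R"
    using bounded_domain bounded_pos by metis
  have R1: "\<bar>x $ 1\<bar> \<le> R" if "x \<in> \<Omega>" for x
    using R[OF that] component_le_norm_cart[of x 1] by linarith
  have "l2_norm \<Omega> v \<le> 2 * R * l2_norm \<Omega> (weak_jacobian \<Omega> v)" if v: "v \<in> H01_vec \<Omega>" for v
  proof (rule power2_le_imp_le)
    let ?g = "\<lambda>i. weak_grad \<Omega> (\<lambda>y. v y $ i)"
    have "(l2_norm \<Omega> v)\<^sup>2 = (\<Sum>i\<in>UNIV. (l2_norm \<Omega> (\<lambda>x. v x $ i))\<^sup>2)"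
      unfolding l2_norm_square l2_inner_def inner_vec_def
      by (intro Bochner_Integration.integral_sum L2_inner_integrable H01_L2 H01_vec_component v)
    also have "\<dots> \<le> (\<Sum>i\<in>UNIV. (2 * R * l2_norm \<Omega> (?g i))\<^sup>2)"
      using R1 R0 by (intro sum_mono power_mono Poincare_H01 H01_vec_component v) auto
    also have "\<dots> = (2 * R)\<^sup>2 * (\<Sum>i\<in>UNIV. (l2_norm \<Omega> (?g i))\<^sup>2)"
      by (simp add: power_mult_distrib sum_distrib_left)
    also have "(\<Sum>i\<in>UNIV. (l2_norm \<Omega> (?g i))\<^sup>2) = (l2_norm \<Omega> (weak_jacobian \<Omega> v))\<^sup>2"
      unfolding l2_norm_square l2_inner_def weak_jacobian_def inner_vec_def[where 'b = 3 and 'a = "real^3"] vec_lambda_beta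
      by (intro Bochner_Integration.integral_sum[symmetric] L2_inner_integrable weak_grad_L2 H01_vec_component v)
    finally show "(l2_norm \<Omega> v)\<^sup>2 \<le> (2 * R * l2_norm \<Omega> (weak_jacobian \<Omega> v))\<^sup>2"
      by (simp add: power_mult_distrib)
  qed (use R0 in simp)
  then show ?thesis using R0 by (intro exI[of _ "2 * R"]) auto
qed

end

section \<open>Finite-dimensional spaces of functions\<close>

text \<open>The linear span, as an inductive set: the images of generators under pointwise linear maps then need not be
  distinct, as they would in a sum over a set of generators.\<close>

inductive_set lspan :: "('a \<Rightarrow> 'b::real_vector) set \<Rightarrow> ('a \<Rightarrow> 'b) set" for G where
  zero: "(\<lambda>x. 0) \<in> lspan G"
| step: "\<lbrakk>f \<in> lspan G; g \<in> G\<rbrakk> \<Longrightarrow> (\<lambda>x. f x + c *\<^sub>R g x) \<in> lspan G"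

lemma lspan_base: "g \<in> G \<Longrightarrow> g \<in> lspan G"
  using lspan.step[OF lspan.zero, of g G 1] by simp

lemma lspan_add:
  assumes "f \<in> lspan G" "h \<in> lspan G" shows "(\<lambda>x. f x + h x) \<in> lspan G"
  using assms(2)
proof induction
  case zero
  then show ?case using assms(1) by simp
next
  case (step h g c)
  then show ?case using lspan.step[of "\<lambda>x. f x + h x" G g c] by (simp add: add.assoc)
qed

lemma lspan_scale:
  assumes "f \<in> lspan G" shows "(\<lambda>x. c *\<^sub>R f x) \<in> lspan G"
  using assms
proof induction
  case zero
  then show ?case by (simp add: lspan.zero)
next
  case (step h g k)
  then show ?case using lspan.step[of "\<lambda>x. c *\<^sub>R h x" G g "c * k"] by (simp add: scaleR_add_right)
qed

lemma lspan_sum: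
  assumes "\<And>i. i \<in> I \<Longrightarrow> f i \<in> lspan G" shows "(\<lambda>x. \<Sum>i\<in>I. f i x) \<in> lspan G"
  using assms by (induction I rule: infinite_finite_induct) (auto intro: lspan.zero lspan_add)

lemma lspan_mono:
  assumes "f \<in> lspan G" "G \<subseteq> H" shows "f \<in> lspan H"
  using assms(1) by induction (use assms(2) in \<open>auto intro: lspan.intros\<close>)

lemma lspan_image:
  assumes "f \<in> lspan G" and T: "\<And>x. linear (T x)"
  shows "(\<lambda>x. T x (f x)) \<in> lspan ((\<lambda>g x. T x (g x)) ` G)"
  using assms(1)
proof induction
  case zero
  then show ?case by (simp add: linear_0[OF T] lspan.zero)
next
  case (step f g c)
  then have "(\<lambda>x. T x (f x) + c *\<^sub>R T x (g x)) \<in> lspan ((\<lambda>g x. T x (g x)) ` G)"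
    by (intro lspan.step) auto
  then show ?case by (simp add: linear_add[OF T] linear_scale[OF T])
qed

lemma lspan_insert:
  assumes "h \<in> lspan (insert g G)" shows "\<exists>f\<in>lspan G. \<exists>c. h = (\<lambda>x. f x + c *\<^sub>R g x)"
  using assms
proof induction
  case zero
  then show ?case by (intro bexI[OF _ lspan.zero] exI[of _ 0]) simp
next
  case (step h k d)
  then obtain f c where f: "f \<in> lspan G" "h = (\<lambda>x. f x + c *\<^sub>R g x)" by blast
  show ?case
  proof (cases "k = g")
    case True
    then show ?thesis using f by (intro bexI[OF _ f(1)] exI[of _ "c + d"]) (simp add: scaleR_add_left add.assoc)
  next
    case False
    then have "k \<in> G" using step by auto
    from lspan.step[OF f(1) this, of d] show ?thesis
      using f(2) by (intro bexI[of _ "\<lambda>x. f x + d *\<^sub>R k x"] exI[of _ c]) (auto simp: fun_eq_iff)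
  qed
qed

lemma lspan_subset:
  assumes X: "linear_space X" and G: "G \<subseteq> X" shows "lspan G \<subseteq> X"
proof
  fix f assume "f \<in> lspan G"
  then show "f \<in> X"
  proof induction
    case (step f g c)
    then show ?case
      using G by (intro linear_space_add[OF X] linear_space_scale[OF X]) auto
  qed (rule linear_space_zero[OF X])
qed

definition ae_finite_dim :: "(real^3) set \<Rightarrow> (real^3 \<Rightarrow> 'a::euclidean_space) set \<Rightarrow> bool" where
  "ae_finite_dim \<Omega> X \<longleftrightarrow> (\<exists>G. finite G \<and> G \<subseteq> L2 \<Omega> \<and> (\<forall>f\<in>X. \<exists>h\<in>lspan G. ae_eq \<Omega> f h))"

definition orthonormal :: "(real^3) set \<Rightarrow> nat \<Rightarrow> (nat \<Rightarrow> real^3 \<Rightarrow> 'a::euclidean_space) \<Rightarrow> bool" where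
  "orthonormal \<Omega> n e \<longleftrightarrow> (\<forall>i<n. \<forall>j<n. l2_inner \<Omega> (e i) (e j) = (if i = j then 1 else 0))"

definition orthonormal_basis ::
    "(real^3) set \<Rightarrow> (real^3 \<Rightarrow> 'a::euclidean_space) set \<Rightarrow> nat \<Rightarrow> (nat \<Rightarrow> real^3 \<Rightarrow> 'a) \<Rightarrow> bool" where
  "orthonormal_basis \<Omega> X n e \<longleftrightarrow> (\<forall>i<n. e i \<in> X) \<and> orthonormal \<Omega> n e \<and>
     (\<forall>f\<in>X. ae_eq \<Omega> f (\<lambda>x. \<Sum>i<n. l2_inner \<Omega> f (e i) *\<^sub>R e i x))"

lemma l2_inner_lincomb_left:
  assumes "\<And>i. i \<in> I \<Longrightarrow> e i \<in> L2 \<Omega>" "g \<in> L2 \<Omega>"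
  shows "l2_inner \<Omega> (\<lambda>x. \<Sum>i\<in>I. a i *\<^sub>R e i x) g = (\<Sum>i\<in>I. a i * l2_inner \<Omega> (e i) g)"
  using assms by (subst l2_inner_sum_left) auto

lemma orthonormal_coefficient:
  assumes on: "orthonormal \<Omega> n e" and e: "\<And>i. i < n \<Longrightarrow> e i \<in> L2 \<Omega>" and f: "f \<in> L2 \<Omega>"
    and eq: "ae_eq \<Omega> f (\<lambda>x. \<Sum>i<n. a i *\<^sub>R e i x)" and j: "j < n"
  shows "l2_inner \<Omega> f (e j) = a j"
proof -
  have "l2_inner \<Omega> f (e j) = l2_inner \<Omega> (\<lambda>x. \<Sum>i<n. a i *\<^sub>R e i x) (e j)"
    using e f j by (intro l2_inner_cong eq ae_eq_refl L2_sum L2_scale) auto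
  also have "\<dots> = (\<Sum>i<n. a i * l2_inner \<Omega> (e i) (e j))"
    using e j by (intro l2_inner_lincomb_left) auto
  also have "\<dots> = (\<Sum>i<n. if i = j then a i else 0)"
    using on j by (intro sum.cong) (auto simp: orthonormal_def)
  also have "\<dots> = a j" using j by simp
  finally show ?thesis .
qed

lemma orthonormal_basisI:
  assumes X: "X \<subseteq> L2 \<Omega>" and e: "\<And>i. i < n \<Longrightarrow> e i \<in> X" and on: "orthonormal \<Omega> n e"
    and ex: "\<And>f. f \<in> X \<Longrightarrow> \<exists>a. ae_eq \<Omega> f (\<lambda>x. \<Sum>i<n. a i *\<^sub>R e i x)"
  shows "orthonormal_basis \<Omega> X n e"
  unfolding orthonormal_basis_def
proof (intro conjI ballI allI impI e on)
  fix f assume f: "f \<in> X"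
  then obtain a where a: "ae_eq \<Omega> f (\<lambda>x. \<Sum>i<n. a i *\<^sub>R e i x)" using ex by blast
  have "l2_inner \<Omega> f (e i) = a i" if "i < n" for i
    using X e f by (intro orthonormal_coefficient[OF on _ _ a that]) auto
  then show "ae_eq \<Omega> f (\<lambda>x. \<Sum>i<n. l2_inner \<Omega> f (e i) *\<^sub>R e i x)" using a by simp
qed

text \<open>Gram-Schmidt, by induction on the generators of a space containing \<open>X\<close>: the elements of
  \<open>X\<close> that do without the generator \<open>g\<close> form a subspace of codimension at most one.\<close>

lemma finite_span_orthonormal_basis:
  assumes "finite G" "G \<subseteq> L2 \<Omega>" "linear_space X" "X \<subseteq> L2 \<Omega>" "\<And>f. f \<in> X \<Longrightarrow> \<exists>h\<in>lspan G. ae_eq \<Omega> f h"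
  shows "\<exists>n e. orthonormal_basis \<Omega> X n e"
  using assms
proof (induction G arbitrary: X rule: finite_induct)
  case empty
  have z: "h = (\<lambda>x. 0)" if "h \<in> lspan {}" for h :: "real^3 \<Rightarrow> 'a"
    using that by induction auto
  have "ae_eq \<Omega> f (\<lambda>x. 0)" if "f \<in> X" for f
    using empty(4)[OF that] z by blast
  then have "orthonormal_basis \<Omega> X 0 (\<lambda>i x. 0)"
    by (simp add: orthonormal_basis_def orthonormal_def)
  then show ?case by blast
next
  case (insert g G)
  define X' where "X' = {f \<in> X. \<exists>h\<in>lspan G. ae_eq \<Omega> f h}"
  have X'X: "X' \<subseteq> X" by (auto simp: X'_def)
  have linX': "linear_space X'"
  proof (rule linear_spaceI)
    show "(\<lambda>x. 0) \<in> X'"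
      using linear_space_zero[OF insert.prems(2)] lspan.zero[of G] unfolding X'_def by (auto intro: ae_eq_refl)
    fix u v c assume "u \<in> X'" "v \<in> X'"
    then obtain h k where "h \<in> lspan G" "ae_eq \<Omega> u h" "k \<in> lspan G" "ae_eq \<Omega> v k" "u \<in> X" "v \<in> X"
      by (auto simp: X'_def)
    then show "(\<lambda>x. u x + c *\<^sub>R v x) \<in> X'"
      unfolding X'_def
      by (intro CollectI conjI linear_space_add[OF insert.prems(2)] linear_space_scale[OF insert.prems(2)]
           bexI[of _ "\<lambda>x. h x + c *\<^sub>R k x"] ae_eq_add ae_eq_scale lspan_add lspan_scale)
  qed
  have "\<exists>n e. orthonormal_basis \<Omega> X' n e"
    using insert.prems X'X by (intro insert.IH linX') (auto simp: X'_def)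
  then obtain n e where ne: "orthonormal_basis \<Omega> X' n e" by blast
  have eX': "e i \<in> X'" if "i < n" for i using ne that by (simp add: orthonormal_basis_def)
  have eL: "e i \<in> L2 \<Omega>" if "i < n" for i using eX'[OF that] X'X insert.prems(3) by blast
  have on: "orthonormal \<Omega> n e" using ne by (simp add: orthonormal_basis_def)
  show ?case
  proof (cases "X' = X")
    case True
    then show ?thesis using ne by blast
  next
    case False
    then obtain f0 where f0: "f0 \<in> X" "f0 \<notin> X'" using X'X by blast
    obtain h0 c0 where h0: "h0 \<in> lspan G" "ae_eq \<Omega> f0 (\<lambda>x. h0 x + c0 *\<^sub>R g x)"
      using insert.prems(4)[OF f0(1)] lspan_insert by blast
    \<comment> \<open>Since \<open>f0\<close> involves \<open>g\<close>, subtracting a multiple of \<open>f0\<close>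
      removes \<open>g\<close> from any other element.\<close>
    have c0: "c0 \<noteq> 0"
      using f0 h0 by (auto simp: X'_def)
    define p where "p = (\<lambda>x. \<Sum>i<n. l2_inner \<Omega> f0 (e i) *\<^sub>R e i x)"
    have pX': "p \<in> X'" unfolding p_def using eX' by (intro linear_space_lincomb[OF linX']) auto
    define w where "w = (\<lambda>x. f0 x - p x)"
    have wX: "w \<in> X" unfolding w_def using f0 pX' X'X by (intro linear_space_diff[OF insert.prems(2)]) auto
    have wL: "w \<in> L2 \<Omega>" and f0L: "f0 \<in> L2 \<Omega>" and pL: "p \<in> L2 \<Omega>"
      using wX f0 pX' X'X insert.prems(3) by auto
    define k where "k = l2_norm \<Omega> w"
    have k: "k > 0"
    proof (rule ccontr)
      assume "\<not> k > 0"
      then have "k = 0" using l2_norm_nonneg[of \<Omega> w] unfolding k_def by linarith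
      then have "ae_eq \<Omega> w (\<lambda>x. 0)" using l2_norm_eq_0_iff[OF wL] by (simp add: k_def)
      then have "ae_eq \<Omega> f0 p" by (simp add: w_def ae_eq_diff_zero)
      moreover obtain h where "h \<in> lspan G" "ae_eq \<Omega> p h" using pX' by (auto simp: X'_def)
      ultimately have "f0 \<in> X'" using f0 ae_eq_trans unfolding X'_def by blast
      then show False using f0 by simp
    qed
    define e' where "e' = e(n := (\<lambda>x. (1 / k) *\<^sub>R w x))"
    have orth: "l2_inner \<Omega> w (e j) = 0" if j: "j < n" for j
    proof -
      have "l2_inner \<Omega> w (e j) = l2_inner \<Omega> f0 (e j) - l2_inner \<Omega> p (e j)"
        unfolding w_def by (rule l2_inner_diff_left[OF f0L pL eL[OF j]])
      also have "l2_inner \<Omega> p (e j) = l2_inner \<Omega> f0 (e j)"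
        unfolding p_def by (rule orthonormal_coefficient[OF on eL _ ae_eq_refl j]) (use pL in \<open>simp_all add: p_def\<close>)
      finally show ?thesis by simp
    qed
    have ww: "l2_inner \<Omega> w w = k\<^sup>2" by (simp add: k_def l2_norm_square)
    have on': "orthonormal \<Omega> (Suc n) e'"
      unfolding orthonormal_def
    proof (intro allI impI)
      fix i j assume "i < Suc n" "j < Suc n"
      then show "l2_inner \<Omega> (e' i) (e' j) = (if i = j then 1 else 0)"
        using on orth[of i] orth[of j] ww k
        by (auto simp: e'_def orthonormal_def less_Suc_eq l2_inner_commute[of \<Omega> "e _" w] power2_eq_square)
    qed
    have e'X: "e' i \<in> X" if "i < Suc n" for i
      using that eX' X'X wX by (auto simp: e'_def less_Suc_eq intro: linear_space_scale[OF insert.prems(2)])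
    have "\<exists>a. ae_eq \<Omega> f (\<lambda>x. \<Sum>i<Suc n. a i *\<^sub>R e' i x)" if f: "f \<in> X" for f
    proof -
      obtain h c where h: "h \<in> lspan G" "ae_eq \<Omega> f (\<lambda>x. h x + c *\<^sub>R g x)"
        using insert.prems(4)[OF f] lspan_insert by blast
      define t where "t = c / c0"
      define y where "y = (\<lambda>x. f x - t *\<^sub>R f0 x)"
      have yX: "y \<in> X" unfolding y_def using f f0 by (intro linear_space_diff[OF insert.prems(2)] linear_space_scale[OF insert.prems(2)])
      have "ae_eq \<Omega> y (\<lambda>x. (h x + c *\<^sub>R g x) - t *\<^sub>R (h0 x + c0 *\<^sub>R g x))"
        unfolding y_def by (intro ae_eq_comp2[where h = "\<lambda>a b. a - t *\<^sub>R b"] h(2) h0(2))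
      also have "(\<lambda>x. (h x + c *\<^sub>R g x) - t *\<^sub>R (h0 x + c0 *\<^sub>R g x)) = (\<lambda>x. h x + (- t) *\<^sub>R h0 x)"
        using c0 by (auto simp: t_def algebra_simps)
      finally have "y \<in> X'"
        using yX lspan_add[OF h(1) lspan_scale[OF h0(1), of "- t"]] unfolding X'_def by blast
      then have yeq: "ae_eq \<Omega> y (\<lambda>x. \<Sum>i<n. l2_inner \<Omega> y (e i) *\<^sub>R e i x)"
        using ne by (simp add: orthonormal_basis_def)
      define a where "a = (\<lambda>i. if i < n then l2_inner \<Omega> y (e i) + t * l2_inner \<Omega> f0 (e i) else t * k)"
      have f_eq: "(\<lambda>x. y x + t *\<^sub>R (p x + k *\<^sub>R e' n x)) = f"
        using k by (simp add: y_def w_def e'_def)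
      have "ae_eq \<Omega> (\<lambda>x. y x + t *\<^sub>R (p x + k *\<^sub>R e' n x)) (\<lambda>x. (\<Sum>i<n. l2_inner \<Omega> y (e i) *\<^sub>R e i x) + t *\<^sub>R (p x + k *\<^sub>R e' n x))"
        by (intro ae_eq_add yeq ae_eq_refl)
      also have "(\<lambda>x. (\<Sum>i<n. l2_inner \<Omega> y (e i) *\<^sub>R e i x) + t *\<^sub>R (p x + k *\<^sub>R e' n x))
          = (\<lambda>x. \<Sum>i<Suc n. a i *\<^sub>R e' i x)"
        by (simp add: a_def p_def e'_def scaleR_add_right scaleR_add_left sum.distrib scaleR_sum_right fun_eq_iff)
      finally show ?thesis unfolding f_eq by blast
    qed
    then have "orthonormal_basis \<Omega> X (Suc n) e'"
      by (intro orthonormal_basisI insert.prems(3) e'X on')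
    then show ?thesis by blast
  qed
qed

lemma ae_finite_dim_orthonormal_basis:
  assumes "ae_finite_dim \<Omega> X" "linear_space X" "X \<subseteq> L2 \<Omega>"
  obtains n e where "orthonormal_basis \<Omega> X n e"
  using assms finite_span_orthonormal_basis unfolding ae_finite_dim_def by metis

lemma ae_finite_dim_subset: "\<lbrakk>ae_finite_dim \<Omega> Y; X \<subseteq> Y\<rbrakk> \<Longrightarrow> ae_finite_dim \<Omega> X"
  unfolding ae_finite_dim_def by blast

lemma orthonormal_norm:
  assumes on: "orthonormal \<Omega> n e" and e: "\<And>i. i < n \<Longrightarrow> e i \<in> L2 \<Omega>"
  shows "(l2_norm \<Omega> (\<lambda>x. \<Sum>i<n. a i *\<^sub>R e i x))\<^sup>2 = (\<Sum>i<n. (a i)\<^sup>2)"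
proof -
  let ?f = "\<lambda>x. \<Sum>i<n. a i *\<^sub>R e i x"
  have fL: "?f \<in> L2 \<Omega>" using e by (intro L2_sum L2_scale) auto
  have "l2_inner \<Omega> ?f ?f = (\<Sum>i<n. a i * l2_inner \<Omega> (e i) ?f)"
    using e fL by (intro l2_inner_lincomb_left) auto
  also have "\<dots> = (\<Sum>i<n. (a i)\<^sup>2)"
    using orthonormal_coefficient[OF on e fL ae_eq_refl]
    by (intro sum.cong) (auto simp: power2_eq_square l2_inner_commute[of \<Omega> "e _"])
  finally show ?thesis by (simp add: l2_norm_square)
qed

lemma orthonormal_coefficient_le:
  assumes on: "orthonormal \<Omega> n e" and e: "\<And>i. i < n \<Longrightarrow> e i \<in> L2 \<Omega>" and f: "f \<in> L2 \<Omega>" and i: "i < n"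
  shows "\<bar>l2_inner \<Omega> f (e i)\<bar> \<le> l2_norm \<Omega> f"
  using l2_Cauchy_Schwarz[OF f e[OF i]] on i by (simp add: orthonormal_def l2_norm_def)

text \<open>All norms on a finite-dimensional space are equivalent; here each coefficient with respect to an orthonormal
  basis is bounded by the \<open>L\<^sup>2\<close> norm.\<close>

lemma finite_dim_sup_bound:
  assumes ne: "orthonormal_basis \<Omega> X n e" and X: "X \<subseteq> L2 \<Omega>" "X \<subseteq> ess_bounded \<Omega>"
  shows "\<exists>K\<ge>0. \<forall>u\<in>X. AE x in lebesgue_on \<Omega>. norm (u x) \<le> K * l2_norm \<Omega> u"
proof -
  have e: "e i \<in> X" if "i < n" for i using ne that by (simp add: orthonormal_basis_def)
  have on: "orthonormal \<Omega> n e" using ne by (simp add: orthonormal_basis_def)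
  have "\<forall>i. \<exists>M. 0 \<le> M \<and> (i < n \<longrightarrow> (AE x in lebesgue_on \<Omega>. norm (e i x) \<le> M))"
    using e X(2) by (metis ess_boundedE order_refl subsetD)
  then obtain M where M: "\<And>i. 0 \<le> M i" "\<And>i. i < n \<Longrightarrow> AE x in lebesgue_on \<Omega>. norm (e i x) \<le> M i"
    by metis
  have "AE x in lebesgue_on \<Omega>. norm (u x) \<le> (\<Sum>i<n. M i) * l2_norm \<Omega> u" if u: "u \<in> X" for u
  proof -
    have uL: "u \<in> L2 \<Omega>" using u X by blast
    have "AE x in lebesgue_on \<Omega>. u x = (\<Sum>i<n. l2_inner \<Omega> u (e i) *\<^sub>R e i x)"
      using ne u by (simp add: orthonormal_basis_def ae_eq_def)
    moreover have "AE x in lebesgue_on \<Omega>. \<forall>i\<in>{..<n}. norm (e i x) \<le> M i"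
      using M(2) by (subst AE_ball_countable) auto
    ultimately show ?thesis
    proof eventually_elim
      case (elim x)
      have "norm (u x) \<le> (\<Sum>i<n. norm (l2_inner \<Omega> u (e i) *\<^sub>R e i x))"
        unfolding elim(1) by (rule norm_sum)
      also have "\<dots> \<le> (\<Sum>i<n. l2_norm \<Omega> u * M i)"
      proof (rule sum_mono)
        fix i assume i: "i \<in> {..<n}"
        have "\<bar>l2_inner \<Omega> u (e i)\<bar> \<le> l2_norm \<Omega> u"
          using e X i by (intro orthonormal_coefficient_le[OF on _ uL]) auto
        then show "norm (l2_inner \<Omega> u (e i) *\<^sub>R e i x) \<le> l2_norm \<Omega> u * M i"
          using elim(2) i by (auto intro!: mult_mono)
      qed
      finally show ?case by (simp add: sum_distrib_left mult.commute)
    qed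
  qed
  then show ?thesis using M(1) by (intro exI[of _ "\<Sum>i<n. M i"]) (auto intro: sum_nonneg)
qed

section \<open>The Galerkin method\<close>

text \<open>Continuity along all coordinate systems, in the product topology on coefficient sequences. It avoids a topology
  on the space of functions, where equality is only almost everywhere.\<close>

definition coord_continuous :: "(real^3 \<Rightarrow> 'a::euclidean_space) set \<Rightarrow> ((real^3 \<Rightarrow> 'a) \<Rightarrow> real) \<Rightarrow> bool" where
  "coord_continuous X \<phi> \<longleftrightarrow>
     (\<forall>n e. (\<forall>i<n. e i \<in> X) \<longrightarrow> continuous_on UNIV (\<lambda>c::nat \<Rightarrow> real. \<phi> (\<lambda>x. \<Sum>i<n. c i *\<^sub>R e i x)))"

lemma coord_continuous_const: "coord_continuous X (\<lambda>w. k)"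
  by (simp add: coord_continuous_def)

lemma coord_continuous_add:
  "\<lbrakk>coord_continuous X \<phi>; coord_continuous X \<psi>\<rbrakk> \<Longrightarrow> coord_continuous X (\<lambda>w. \<phi> w + \<psi> w)"
  unfolding coord_continuous_def by (auto intro: continuous_on_add)

lemma coord_continuous_diff:
  "\<lbrakk>coord_continuous X \<phi>; coord_continuous X \<psi>\<rbrakk> \<Longrightarrow> coord_continuous X (\<lambda>w. \<phi> w - \<psi> w)"
  unfolding coord_continuous_def by (auto intro: continuous_on_diff)

lemma coord_continuous_mult: "coord_continuous X \<phi> \<Longrightarrow> coord_continuous X (\<lambda>w. k * \<phi> w)"
  unfolding coord_continuous_def by (auto intro: continuous_on_mult_left)

text \<open>Repeated use, once for each argument, gives the continuity of the diagonal of any multilinear form, and thereby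
  of the quadratic and cubic terms of the equations.\<close>

lemma coord_continuous_bilinear:
  fixes X :: "(real^3 \<Rightarrow> 'a::euclidean_space) set"
  assumes X: "linear_space X"
    and lin: "\<And>w. w \<in> X \<Longrightarrow> ae_linear_form \<Omega> X (\<lambda>u. b u w)"
    and cont: "\<And>u. u \<in> X \<Longrightarrow> coord_continuous X (\<lambda>w. b u w)"
  shows "coord_continuous X (\<lambda>w. b w w)"
  unfolding coord_continuous_def
proof (intro allI impI)
  fix n :: nat and e :: "nat \<Rightarrow> real^3 \<Rightarrow> 'a" assume e: "\<forall>i<n. e i \<in> X"
  have "b (\<lambda>x. \<Sum>i<n. c i *\<^sub>R e i x) (\<lambda>x. \<Sum>i<n. c i *\<^sub>R e i x)
      = (\<Sum>i<n. c i * b (e i) (\<lambda>x. \<Sum>i<n. c i *\<^sub>R e i x))" for c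
  proof -
    have "(\<lambda>x. \<Sum>i<n. c i *\<^sub>R e i x) \<in> X" using e by (intro linear_space_lincomb[OF X]) auto
    from ae_linear_form_lincomb[OF X lin[OF this] finite_lessThan, of n e c] e show ?thesis by simp
  qed
  moreover have "continuous_on UNIV (\<lambda>c. \<Sum>i<n. c i * b (e i) (\<lambda>x. \<Sum>i<n. c i *\<^sub>R e i x))"
    using e cont by (intro continuous_on_sum continuous_on_mult continuous_on_product_coordinates)
      (auto simp: coord_continuous_def)
  ultimately show "continuous_on UNIV (\<lambda>c. b (\<lambda>x. \<Sum>i<n. c i *\<^sub>R e i x) (\<lambda>x. \<Sum>i<n. c i *\<^sub>R e i x))"
    by simp
qed

lemma coord_continuous_linear:
  assumes X: "linear_space X" and l: "ae_linear_form \<Omega> X l"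
  shows "coord_continuous X l"
  using coord_continuous_bilinear[OF X, of \<Omega> "\<lambda>u w. l u"] l coord_continuous_const by blast

text \<open>In orthonormal coordinates the \<open>L\<^sup>2\<close> norm is the Euclidean one, so the sign condition says
  that the coordinate map points outwards on a sphere.\<close>

lemma galerkin_solution:
  assumes X: "linear_space X" "X \<subseteq> L2 \<Omega>" and ne: "orthonormal_basis \<Omega> X n e" and r: "0 < r"
    and lin: "\<And>w. w \<in> X \<Longrightarrow> ae_linear_form \<Omega> X (A w)"
    and cont: "\<And>v. v \<in> X \<Longrightarrow> coord_continuous X (\<lambda>w. A w v)"
    and acute: "\<And>w. \<lbrakk>w \<in> X; l2_norm \<Omega> w = r\<rbrakk> \<Longrightarrow> 0 < A w w"
  shows "\<exists>w\<in>X. \<forall>v\<in>X. A w v = 0"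
proof -
  have e: "e i \<in> X" if "i < n" for i using ne that by (simp add: orthonormal_basis_def)
  have on: "orthonormal \<Omega> n e" using ne by (simp add: orthonormal_basis_def)
  define w where "w c = (\<lambda>x. \<Sum>i<n. c i *\<^sub>R e i x)" for c
  have wX: "w c \<in> X" for c unfolding w_def using e by (intro linear_space_lincomb[OF X(1)]) auto
  have Alin: "A (w c) (w d) = (\<Sum>i<n. d i * A (w c) (e i))" for c d
    unfolding w_def[of d] using e by (intro ae_linear_form_lincomb[OF X(1) lin[OF wX]]) auto
  have "\<exists>c. \<forall>i<n. A (w c) (e i) = 0"
  proof (rule acute_angle_zero[OF r])
    show "continuous_on UNIV (\<lambda>c. A (w c) (e i))" if "i < n" for i
      using cont[OF e[OF that]] e unfolding coord_continuous_def w_def by blast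
    fix c assume c: "(\<Sum>i<n. (c i)\<^sup>2) = r\<^sup>2"
    have "(l2_norm \<Omega> (w c))\<^sup>2 = r\<^sup>2"
      unfolding w_def using e X(2) c by (subst orthonormal_norm[OF on]) auto
    then have "l2_norm \<Omega> (w c) = r" using r by (simp add: power2_eq_iff_nonneg)
    then have "0 < A (w c) (w c)" using acute wX by blast
    then show "0 < (\<Sum>i<n. A (w c) (e i) * c i)" by (simp add: Alin mult.commute)
  qed
  then obtain c where c: "\<And>i. i < n \<Longrightarrow> A (w c) (e i) = 0" by blast
  have "A (w c) v = 0" if v: "v \<in> X" for v
  proof -
    have "A (w c) v = A (w c) (w (\<lambda>i. l2_inner \<Omega> v (e i)))"
      using ne v by (intro ae_linear_form_cong[OF X(1) lin[OF wX] v wX]) (simp add: orthonormal_basis_def w_def)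
    then show ?thesis using c by (simp add: Alin)
  qed
  then show ?thesis using wX by blast
qed

text \<open>By induction: on the kernel of the last form the others suffice, and the remainder vanishes on that kernel,
  hence is a multiple of the last form.\<close>

lemma linear_form_in_span:
  fixes n :: nat
  assumes "linear_space X" "\<And>k. k < n \<Longrightarrow> ae_linear_form \<Omega> X (b k)" "ae_linear_form \<Omega> X l"
    and "\<And>v. \<lbrakk>v \<in> X; \<forall>k<n. b k v = 0\<rbrakk> \<Longrightarrow> l v = 0"
  shows "\<exists>c. \<forall>v\<in>X. l v = (\<Sum>k<n. c k * b k v)"
  using assms
proof (induction n arbitrary: X)
  case 0
  then show ?case by simp
next
  case (Suc n)
  note X = Suc.prems(1) and b = Suc.prems(2) and l = Suc.prems(3)
  have bn: "ae_linear_form \<Omega> X (b n)" by (intro b) simp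
  define X' where "X' = {v \<in> X. b n v = 0}"
  have X'X: "X' \<subseteq> X" by (auto simp: X'_def)
  have linX': "linear_space X'"
  proof (rule linear_spaceI)
    show "(\<lambda>x. 0) \<in> X'"
      using linear_space_zero[OF X] ae_linear_form_zero[OF X bn] by (simp add: X'_def)
    fix u v c assume "u \<in> X'" "v \<in> X'"
    moreover from this have m: "(\<lambda>x. u x + c *\<^sub>R v x) \<in> X"
      using X'X by (intro linear_space_add[OF X] linear_space_scale[OF X]) auto
    ultimately show "(\<lambda>x. u x + c *\<^sub>R v x) \<in> X'"
      using ae_linear_formD[OF bn _ _ m ae_eq_refl] by (simp add: X'_def)
  qed
  have "\<exists>c. \<forall>v\<in>X'. l v = (\<Sum>k<n. c k * b k v)"
  proof (rule Suc.IH[OF linX'])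
    show "ae_linear_form \<Omega> X' (b k)" if "k < n" for k
      using that by (intro ae_linear_form_subset[OF b X'X]) simp
    show "ae_linear_form \<Omega> X' l" by (rule ae_linear_form_subset[OF l X'X])
    show "l v = 0" if "v \<in> X'" "\<forall>k<n. b k v = 0" for v
      using that by (intro Suc.prems(4)) (auto simp: X'_def less_Suc_eq)
  qed
  then obtain c where c: "\<And>v. v \<in> X' \<Longrightarrow> l v = (\<Sum>k<n. c k * b k v)" by blast
  show ?case
  proof (cases "X' = X")
    case True
    have "l v = (\<Sum>k<Suc n. (c(n := 0)) k * b k v)" if "v \<in> X" for v
      using c[of v] that True by simp
    then show ?thesis by blast
  next
    case False
    then obtain v0 where v0: "v0 \<in> X" "b n v0 \<noteq> 0" using X'X by (auto simp: X'_def)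
    define d where "d = (l v0 - (\<Sum>k<n. c k * b k v0)) / b n v0"
    have "l v = (\<Sum>k<Suc n. (c(n := d)) k * b k v)" if v: "v \<in> X" for v
    proof -
      define t where "t = b n v / b n v0"
      define y where "y = (\<lambda>x. v x + (- t) *\<^sub>R v0 x)"
      have yX: "y \<in> X" unfolding y_def using v v0 by (intro linear_space_add[OF X] linear_space_scale[OF X])
      have lin: "m y = m v - t * m v0" if "ae_linear_form \<Omega> X m" for m
        using ae_linear_formD[OF that v v0(1) yX, of "- t"] by (simp add: y_def)
      have "y \<in> X'" using yX lin[OF bn] v0 by (simp add: X'_def t_def)
      then have "l y = (\<Sum>k<n. c k * b k y)" by (rule c)
      also have "\<dots> = (\<Sum>k<n. c k * b k v) - t * (\<Sum>k<n. c k * b k v0)"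
      proof -
        have "c k * b k y = c k * b k v - t * (c k * b k v0)" if "k < n" for k
          using lin[OF b[of k]] that by (simp add: right_diff_distrib mult.left_commute)
        then show ?thesis by (simp add: sum_distrib_left sum_subtractf[symmetric])
      qed
      finally have "l v = t * l v0 + (\<Sum>k<n. c k * b k v) - t * (\<Sum>k<n. c k * b k v0)"
        using lin[OF l] by simp
      also have "\<dots> = (\<Sum>k<n. c k * b k v) + d * b n v"
        using v0 by (simp add: t_def d_def field_simps)
      finally show ?thesis by simp
    qed
    then show ?thesis by blast
  qed
qed

section \<open>Finite element spaces\<close>

definition finitely_generated :: "(real^3 \<Rightarrow> 'a::euclidean_space) set \<Rightarrow> bool" where
  "finitely_generated P \<longleftrightarrow> (\<exists>G. finite G \<and> (\<forall>g\<in>G. continuous_on UNIV g) \<and> P \<subseteq> lspan G)"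

lemma finitely_generated_poly_deg: "finitely_generated (poly_deg k)"
proof -
  define I where "I = {(a, b, d). a + b + d \<le> (k::nat)}"
  define m where "m = (\<lambda>(a, b, d) (x::real^3). x$1 ^ a * x$2 ^ b * x$3 ^ d)"
  have "I \<subseteq> {..k} \<times> {..k} \<times> {..k}" by (auto simp: I_def)
  then have "finite I" by (rule finite_subset) auto
  moreover have "continuous_on UNIV (m i)" for i
    by (auto simp: m_def split_beta intro!: continuous_intros)
  moreover have "p \<in> lspan (m ` I)" if "p \<in> poly_deg k" for p
  proof -
    obtain c where c: "\<And>x. p x = (\<Sum>(a, b, d)\<in>I. c a b d * x$1 ^ a * x$2 ^ b * x$3 ^ d)"
      using \<open>p \<in> poly_deg k\<close> by (auto simp: poly_deg_def I_def)
    have "(\<lambda>x. \<Sum>i\<in>I. (case i of (a, b, d) \<Rightarrow> c a b d) *\<^sub>R m i x) \<in> lspan (m ` I)"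
      by (intro lspan_sum lspan_scale lspan_base) auto
    then show ?thesis by (simp add: c[abs_def] m_def split_beta mult.assoc)
  qed
  ultimately show ?thesis
    unfolding finitely_generated_def by (intro exI[of _ "m ` I"]) auto
qed

text \<open>Shape functions are sums of polynomials transformed by linear maps that depend on the point, such as \<open>b
  \<mapsto> x \<times> b\<close>; the degree of the result need not be computed.\<close>

lemma finitely_generated_image_sum:
  fixes P :: "'i \<Rightarrow> (real^3 \<Rightarrow> 'a::euclidean_space) set" and S :: "(real^3 \<Rightarrow> 'b::euclidean_space) set"
  assumes I: "finite I" and P: "\<And>i. i \<in> I \<Longrightarrow> finitely_generated (P i)"
    and T: "\<And>i x. linear (T i x)"
    and cont: "\<And>i g. \<lbrakk>i \<in> I; continuous_on UNIV g\<rbrakk> \<Longrightarrow> continuous_on UNIV (\<lambda>x. T i x (g x))"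
    and S: "\<And>f. f \<in> S \<Longrightarrow> \<exists>p. (\<forall>i\<in>I. p i \<in> P i) \<and> f = (\<lambda>x. \<Sum>i\<in>I. T i x (p i x))"
  shows "finitely_generated S"
proof -
  have "\<forall>i\<in>I. \<exists>G. finite G \<and> (\<forall>g\<in>G. continuous_on UNIV g) \<and> P i \<subseteq> lspan G"
    using P by (auto simp: finitely_generated_def)
  then obtain G where G: "\<And>i. i \<in> I \<Longrightarrow> finite (G i)" "\<And>i g. \<lbrakk>i \<in> I; g \<in> G i\<rbrakk> \<Longrightarrow> continuous_on UNIV g"
    "\<And>i. i \<in> I \<Longrightarrow> P i \<subseteq> lspan (G i)"
    by metis
  define H where "H = (\<Union>i\<in>I. (\<lambda>g x. T i x (g x)) ` G i)"
  have "f \<in> lspan H" if fS: "f \<in> S" for f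
  proof -
    obtain p where p: "\<forall>i\<in>I. p i \<in> P i" "f = (\<lambda>x. \<Sum>i\<in>I. T i x (p i x))" using S[OF fS] by blast
    have "(\<lambda>x. T i x (p i x)) \<in> lspan H" if "i \<in> I" for i
    proof (rule lspan_mono[OF lspan_image[OF _ T]])
      show "p i \<in> lspan (G i)" using p G(3) that by blast
    qed (use that in \<open>auto simp: H_def\<close>)
    then show ?thesis unfolding p(2) by (rule lspan_sum)
  qed
  moreover have "finite H" using I G by (auto simp: H_def)
  moreover have "\<forall>g\<in>H. continuous_on UNIV g" using cont G by (auto simp: H_def)
  ultimately show ?thesis unfolding finitely_generated_def by blast
qed

lemma finitely_generated_poly_deg_vec: "finitely_generated (poly_deg_vec k)"
proof (rule finitely_generated_image_sum[where I = UNIV and P = "\<lambda>i::3. poly_deg k" and T = "\<lambda>i x y. y *\<^sub>R axis i 1"])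
  fix f assume f: "f \<in> poly_deg_vec k"
  have "f = (\<lambda>x. \<Sum>i\<in>UNIV. f x $ i *\<^sub>R axis i 1)"
    by (simp add: fun_eq_iff vec_eq_iff axis_def if_distrib cong: if_cong)
  then show "\<exists>p. (\<forall>i\<in>UNIV. p i \<in> poly_deg k) \<and> f = (\<lambda>x. \<Sum>i\<in>UNIV. p i x *\<^sub>R axis i 1)"
    using f by (intro exI[of _ "\<lambda>i x. f x $ i"]) (auto simp: poly_deg_vec_def)
qed (auto intro: finitely_generated_poly_deg linearI continuous_intros simp: scaleR_add_left)

lemma linear_cross3: "linear (cross3 x)"
  by (rule linearI) (simp_all add: cross_add_right cross_mult_right)

lemma finitely_generated_nedelec1_shape: "finitely_generated (nedelec1_shape k)"
proof (rule finitely_generated_image_sum[where I = UNIV and P = "\<lambda>b::bool. poly_deg_vec (k - 1)"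
      and T = "\<lambda>b x y. if b then y else cross3 x y"])
  fix f assume "f \<in> nedelec1_shape k"
  then obtain a b where ab: "a \<in> poly_deg_vec (k - 1)" "b \<in> poly_deg_vec (k - 1)" "f = (\<lambda>x. a x + cross3 x (b x))"
    by (auto simp: nedelec1_shape_def)
  then show "\<exists>p. (\<forall>i\<in>UNIV. p i \<in> poly_deg_vec (k - 1)) \<and> f = (\<lambda>x. \<Sum>i\<in>UNIV. if i then p i x else cross3 x (p i x))"
    by (intro exI[of _ "\<lambda>i. if i then a else b"]) (auto simp: UNIV_bool add.commute)
next
  fix i x show "linear (\<lambda>y. if i then y else cross3 x y)"
    by (cases i) (simp_all add: linear_cross3 linear_ident)
next
  fix i and g :: "real^3 \<Rightarrow> real^3" assume "continuous_on UNIV g"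
  then show "continuous_on UNIV (\<lambda>x. if i then g x else cross3 x (g x))"
    by (cases i) (auto intro: continuous_on_cross continuous_on_id)
qed (auto intro: finitely_generated_poly_deg_vec)

lemma finitely_generated_raviart_thomas_shape: "finitely_generated (raviart_thomas_shape k)"
proof -
  have x: "finitely_generated {\<lambda>x. b x *\<^sub>R x | b. b \<in> poly_deg (k - 1)}"
    by (rule finitely_generated_image_sum[where I = "{()}" and P = "\<lambda>_. poly_deg (k - 1)" and T = "\<lambda>_ x y. y *\<^sub>R x"])
       (auto intro: finitely_generated_poly_deg linearI continuous_intros simp: scaleR_add_left)
  show ?thesis
  proof (rule finitely_generated_image_sum[where I = UNIV and T = "\<lambda>_ _ y. y"
        and P = "\<lambda>i. if i then poly_deg_vec (k - 1) else {\<lambda>x. b x *\<^sub>R x | b. b \<in> poly_deg (k - 1)}"])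
    fix f assume "f \<in> raviart_thomas_shape k"
    then obtain a b where ab: "a \<in> poly_deg_vec (k - 1)" "b \<in> poly_deg (k - 1)" "f = (\<lambda>x. a x + b x *\<^sub>R x)"
      by (auto simp: raviart_thomas_shape_def)
    then show "\<exists>p. (\<forall>i\<in>UNIV. p i \<in> (if i then poly_deg_vec (k - 1) else {\<lambda>x. b x *\<^sub>R x | b. b \<in> poly_deg (k - 1)}))
        \<and> f = (\<lambda>x. \<Sum>i\<in>UNIV. p i x)"
      by (intro exI[of _ "\<lambda>i. if i then a else (\<lambda>x. b x *\<^sub>R x)"]) (auto simp: UNIV_bool add.commute)
  qed (use x in \<open>auto intro: finitely_generated_poly_deg_vec linear_ident\<close>)
qed

lemma linear_space_poly_deg: "linear_space (poly_deg k)"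
proof (rule linear_spaceI)
  show "(\<lambda>x. 0) \<in> poly_deg k"
    unfolding poly_deg_def by (intro CollectI exI[of _ "\<lambda>a b d. 0"]) simp
  fix u v :: scalar_field and s assume "u \<in> poly_deg k" "v \<in> poly_deg k"
  then obtain c c' where
    "\<And>x. u x = (\<Sum>(a, b, d)\<in>{(a, b, d). a + b + d \<le> k}. c a b d * x$1 ^ a * x$2 ^ b * x$3 ^ d)"
    "\<And>x. v x = (\<Sum>(a, b, d)\<in>{(a, b, d). a + b + d \<le> k}. c' a b d * x$1 ^ a * x$2 ^ b * x$3 ^ d)"
    by (auto simp: poly_deg_def)
  then show "(\<lambda>x. u x + s *\<^sub>R v x) \<in> poly_deg k"
    unfolding poly_deg_def
    by (intro CollectI exI[of _ "\<lambda>a b d. c a b d + s * c' a b d"])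
       (simp add: sum_distrib_left sum.distrib[symmetric] split_beta algebra_simps)
qed

lemma linear_space_poly_deg_vec: "linear_space (poly_deg_vec k)"
proof (rule linear_spaceI)
  show "(\<lambda>x. 0) \<in> poly_deg_vec k"
    using linear_space_zero[OF linear_space_poly_deg] by (simp add: poly_deg_vec_def)
  fix u v :: vector_field and s assume "u \<in> poly_deg_vec k" "v \<in> poly_deg_vec k"
  then have "(\<lambda>x. u x $ i + s *\<^sub>R v x $ i) \<in> poly_deg k" for i
    by (intro linear_space_add[OF linear_space_poly_deg] linear_space_scale[OF linear_space_poly_deg])
       (auto simp: poly_deg_vec_def)
  then show "(\<lambda>x. u x + s *\<^sub>R v x) \<in> poly_deg_vec k" by (simp add: poly_deg_vec_def)
qed

lemma linear_space_nedelec1_shape: "linear_space (nedelec1_shape k)"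
proof (rule linear_spaceI)
  note P = linear_space_poly_deg_vec[of "k - 1"]
  show "(\<lambda>x. 0) \<in> nedelec1_shape k"
    unfolding nedelec1_shape_def using linear_space_zero[OF P]
    by (intro CollectI exI[of _ "\<lambda>x. 0"]) simp
  fix u v :: vector_field and s assume "u \<in> nedelec1_shape k" "v \<in> nedelec1_shape k"
  then obtain a b a' b' where *: "a \<in> poly_deg_vec (k - 1)" "b \<in> poly_deg_vec (k - 1)" "u = (\<lambda>x. a x + cross3 x (b x))"
    "a' \<in> poly_deg_vec (k - 1)" "b' \<in> poly_deg_vec (k - 1)" "v = (\<lambda>x. a' x + cross3 x (b' x))"
    by (auto simp: nedelec1_shape_def)
  then have "(\<lambda>x. a x + s *\<^sub>R a' x) \<in> poly_deg_vec (k - 1)" "(\<lambda>x. b x + s *\<^sub>R b' x) \<in> poly_deg_vec (k - 1)"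
    by (intro linear_space_add[OF P] linear_space_scale[OF P]; simp)+
  moreover have "(\<lambda>x. u x + s *\<^sub>R v x) = (\<lambda>x. (a x + s *\<^sub>R a' x) + cross3 x (b x + s *\<^sub>R b' x))"
    unfolding * by (simp add: cross_add_right cross_mult_right scaleR_add_right add_ac)
  ultimately show "(\<lambda>x. u x + s *\<^sub>R v x) \<in> nedelec1_shape k"
    unfolding nedelec1_shape_def
    by (intro CollectI exI[of _ "\<lambda>x. a x + s *\<^sub>R a' x"] exI[of _ "\<lambda>x. b x + s *\<^sub>R b' x"] conjI)
qed

lemma linear_space_raviart_thomas_shape: "linear_space (raviart_thomas_shape k)"
proof (rule linear_spaceI)
  note P = linear_space_poly_deg_vec[of "k - 1"] and p = linear_space_poly_deg[of "k - 1"]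
  show "(\<lambda>x. 0) \<in> raviart_thomas_shape k"
    unfolding raviart_thomas_shape_def using linear_space_zero[OF P] linear_space_zero[OF p]
    by (intro CollectI exI[of _ "\<lambda>x. 0"]) simp
  fix u v :: vector_field and s assume "u \<in> raviart_thomas_shape k" "v \<in> raviart_thomas_shape k"
  then obtain a b a' b' where *: "a \<in> poly_deg_vec (k - 1)" "b \<in> poly_deg (k - 1)" "u = (\<lambda>x. a x + b x *\<^sub>R x)"
    "a' \<in> poly_deg_vec (k - 1)" "b' \<in> poly_deg (k - 1)" "v = (\<lambda>x. a' x + b' x *\<^sub>R x)"
    by (auto simp: raviart_thomas_shape_def)
  then have "(\<lambda>x. a x + s *\<^sub>R a' x) \<in> poly_deg_vec (k - 1)" "(\<lambda>x. b x + s *\<^sub>R b' x) \<in> poly_deg (k - 1)"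
    by (intro linear_space_add[OF P] linear_space_scale[OF P] linear_space_add[OF p] linear_space_scale[OF p]; simp)+
  moreover have "(\<lambda>x. u x + s *\<^sub>R v x) = (\<lambda>x. (a x + s *\<^sub>R a' x) + (b x + s *\<^sub>R b' x) *\<^sub>R x)"
    unfolding * by (simp add: scaleR_add_right scaleR_add_left add_ac)
  ultimately show "(\<lambda>x. u x + s *\<^sub>R v x) \<in> raviart_thomas_shape k"
    unfolding raviart_thomas_shape_def
    by (intro CollectI exI[of _ "\<lambda>x. a x + s *\<^sub>R a' x"] exI[of _ "\<lambda>x. b x + s *\<^sub>R b' x"] conjI)
qed

lemma linear_space_piecewise:
  fixes P :: "(real^3 \<Rightarrow> 'a::euclidean_space) set"
  assumes P: "linear_space P" shows "linear_space (piecewise T P)"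
proof (rule linear_spaceI)
  show "(\<lambda>x. 0) \<in> piecewise T P"
    using linear_space_zero[OF P] by (auto simp: piecewise_def intro!: bexI[of _ "\<lambda>x. 0"])
  fix u v :: "real^3 \<Rightarrow> 'a" and s assume uv: "u \<in> piecewise T P" "v \<in> piecewise T P"
  show "(\<lambda>x. u x + s *\<^sub>R v x) \<in> piecewise T P"
    unfolding piecewise_def
  proof (intro CollectI ballI)
    fix K assume "K \<in> T"
    then obtain p q where "p \<in> P" "q \<in> P" "ae_eq K u p" "ae_eq K v q"
      using uv unfolding piecewise_def by blast
    then show "\<exists>p\<in>P. ae_eq K (\<lambda>x. u x + s *\<^sub>R v x) p"
      by (intro bexI[of _ "\<lambda>x. p x + s *\<^sub>R q x"] ae_eq_add ae_eq_scale linear_space_add[OF P] linear_space_scale[OF P])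
  qed
qed

lemma linear_space_Int: "\<lbrakk>linear_space X; linear_space Y\<rbrakk> \<Longrightarrow> linear_space (X \<inter> Y)"
  by (auto simp: linear_space_def)

lemma linear_space_L2_mean_zero:
  assumes "\<Omega> \<in> lmeasurable" shows "linear_space (L2_mean_zero \<Omega>)"
proof (rule linear_spaceI)
  have int: "integrable (lebesgue_on \<Omega>) q" if "q \<in> L2 \<Omega>" for q :: scalar_field
  proof -
    interpret finite_measure "lebesgue_on \<Omega>" by (rule finite_measure_lebesgue_on[OF assms])
    have "(\<lambda>x. 1::real) \<in> L2 \<Omega>" by (simp add: L2_def)
    from L2_inner_integrable[OF that this] show ?thesis by simp
  qed
  show "(\<lambda>x. 0) \<in> L2_mean_zero \<Omega>" by (simp add: L2_mean_zero_def)
  fix u v :: scalar_field and s assume *: "u \<in> L2_mean_zero \<Omega>" "v \<in> L2_mean_zero \<Omega>"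
  then have L: "u \<in> L2 \<Omega>" "v \<in> L2 \<Omega>" by (auto simp: L2_mean_zero_def)
  then have "(\<lambda>x. u x + s *\<^sub>R v x) \<in> L2 \<Omega>" by (intro L2_add L2_scale)
  moreover have "(\<integral>x. u x + s *\<^sub>R v x \<partial>lebesgue_on \<Omega>) = 0"
    using int[OF L(1)] int[OF L(2)] * by (simp add: L2_mean_zero_def)
  ultimately show "(\<lambda>x. u x + s *\<^sub>R v x) \<in> L2_mean_zero \<Omega>" by (simp add: L2_mean_zero_def)
qed

context bounded_open
begin

lemma ess_bounded_indicator:
  assumes "K \<in> sets lebesgue" shows "(\<lambda>x. indicator K x :: real) \<in> ess_bounded \<Omega>"
proof -
  have "indicator K \<in> borel_measurable (lebesgue_on \<Omega>)"
    using assms by (intro measurable_restrict_space1) simp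
  moreover have "AE x in lebesgue_on \<Omega>. norm (indicator K x :: real) \<le> 1"
    by (intro AE_I2) (simp add: indicator_def)
  ultimately show ?thesis unfolding ess_bounded_def by blast
qed

lemma ess_bounded_indicator_scale:
  assumes "K \<in> sets lebesgue" "g \<in> ess_bounded \<Omega>"
  shows "(\<lambda>x. indicator K x *\<^sub>R g x) \<in> ess_bounded \<Omega>"
  by (rule ess_bounded_bilinear[OF bounded_bilinear_scaleR ess_bounded_indicator[OF assms(1)] assms(2)])

text \<open>The elements of a mesh overlap along faces. Restricting the earlier generators to the complement of each new
  element makes the pieces disjoint without an argument that faces are null sets.\<close>

lemma piecewise_generators:
  fixes P :: "(real^3 \<Rightarrow> 'a::euclidean_space) set"
  assumes "finite T" "\<And>K. K \<in> T \<Longrightarrow> K \<in> sets lebesgue" and P: "finitely_generated P"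
  shows "\<exists>G. finite G \<and> G \<subseteq> ess_bounded \<Omega> \<and>
    (\<forall>f\<in>piecewise T P. \<exists>h\<in>lspan G. AE x in lebesgue. x \<in> \<Union>T \<longrightarrow> f x = h x)"
  using assms(1,2)
proof (induction T rule: finite_induct)
  case empty
  show ?case using lspan.zero[of "{}"] by (intro exI[of _ "{}"]) auto
next
  case (insert K T)
  then obtain G where G: "finite G" "G \<subseteq> ess_bounded \<Omega>"
    "\<And>f. f \<in> piecewise T P \<Longrightarrow> \<exists>h\<in>lspan G. AE x in lebesgue. x \<in> \<Union>T \<longrightarrow> f x = h x"
    by auto
  obtain H where H: "finite H" "\<And>g. g \<in> H \<Longrightarrow> continuous_on UNIV g" "P \<subseteq> lspan H"
    using P by (auto simp: finitely_generated_def)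
  have K: "K \<in> sets lebesgue" "- K \<in> sets lebesgue"
    using insert.prems by (auto simp: Compl_in_sets_lebesgue)
  define G' where "G' = (\<lambda>g x. indicator K x *\<^sub>R g x) ` H \<union> (\<lambda>g x. indicator (- K) x *\<^sub>R g x) ` G"
  have "finite G'" using G(1) H(1) by (simp add: G'_def)
  moreover have "G' \<subseteq> ess_bounded \<Omega>"
  proof -
    have "H \<subseteq> ess_bounded \<Omega>"
      using H(2) continuous_ess_bounded[OF bounded_domain domain_sets] by blast
    then show ?thesis
      using G(2) K unfolding G'_def by (auto intro: ess_bounded_indicator_scale)
  qed
  moreover have "\<exists>h\<in>lspan G'. AE x in lebesgue. x \<in> \<Union>(insert K T) \<longrightarrow> f x = h x"
    if f: "f \<in> piecewise (insert K T) P" for f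
  proof -
    have "f \<in> piecewise T P" using f by (simp add: piecewise_def)
    then obtain h where h: "h \<in> lspan G" "AE x in lebesgue. x \<in> \<Union>T \<longrightarrow> f x = h x" using G(3) by blast
    obtain p where p: "p \<in> P" "ae_eq K f p" using f by (auto simp: piecewise_def)
    have pK: "AE x in lebesgue. x \<in> K \<longrightarrow> f x = p x"
      using p(2) K(1) by (simp add: ae_eq_def AE_restrict_space_iff)
    have scaled: "(\<lambda>x. indicator L x *\<^sub>R q x) \<in> lspan G'"
      if q: "q \<in> lspan F" and F: "(\<lambda>g x. indicator L x *\<^sub>R g x) ` F \<subseteq> G'"
      for q F and L :: "(real^3) set"
    proof (rule lspan_mono[OF _ F])
      have "linear ((*\<^sub>R) (indicator L x) :: 'a \<Rightarrow> 'a)" for x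
        by (rule linearI) (simp_all add: scaleR_add_right)
      from lspan_image[OF q, of "\<lambda>x. (*\<^sub>R) (indicator L x)", OF this]
      show "(\<lambda>x. indicator L x *\<^sub>R q x) \<in> lspan ((\<lambda>g x. indicator L x *\<^sub>R g x) ` F)" .
    qed
    have 1: "(\<lambda>x. indicator K x *\<^sub>R p x) \<in> lspan G'"
      using p(1) H(3) by (intro scaled[of p H]) (auto simp: G'_def)
    have 2: "(\<lambda>x. indicator (- K) x *\<^sub>R h x) \<in> lspan G'"
      by (intro scaled[OF h(1)]) (simp add: G'_def)
    have "AE x in lebesgue. x \<in> \<Union>(insert K T) \<longrightarrow>
        f x = indicator K x *\<^sub>R p x + indicator (- K) x *\<^sub>R h x"
      using pK h(2) by eventually_elim (auto simp: indicator_def)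
    then show ?thesis by (rule bexI[OF _ lspan_add[OF 1 2]])
  qed
  ultimately show ?case by (intro exI[of _ G'] conjI ballI)
qed

lemma piecewise_finite_dim:
  fixes P :: "(real^3 \<Rightarrow> 'a::euclidean_space) set"
  assumes T: "simplicial_mesh \<Omega> T" and P: "finitely_generated P" and X: "X \<subseteq> piecewise T P" "X \<subseteq> L2 \<Omega>"
  shows "ae_finite_dim \<Omega> X" and "X \<subseteq> ess_bounded \<Omega>"
proof -
  have T': "finite T" "\<Omega> \<subseteq> \<Union>T" "\<And>K. K \<in> T \<Longrightarrow> K \<in> sets lebesgue"
  proof -
    show "finite T" using T by (simp add: simplicial_mesh_def triangulation_def)
    show "\<Omega> \<subseteq> \<Union>T" using T closure_subset by (auto simp: simplicial_mesh_def)
    fix K assume "K \<in> T"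
    then have "3 simplex K" using T by (simp add: simplicial_mesh_def)
    then have "compact K" by (rule compact_simplex)
    then show "K \<in> sets lebesgue" by (rule fmeasurableD[OF lmeasurable_compact])
  qed
  have "\<exists>G. finite G \<and> G \<subseteq> ess_bounded \<Omega> \<and>
      (\<forall>f\<in>piecewise T P. \<exists>h\<in>lspan G. AE x in lebesgue. x \<in> \<Union>T \<longrightarrow> f x = h x)"
    by (rule piecewise_generators[OF T'(1) _ P]) (rule T'(3))
  then obtain G where gen: "finite G \<and> G \<subseteq> ess_bounded \<Omega> \<and>
      (\<forall>f\<in>piecewise T P. \<exists>h\<in>lspan G. AE x in lebesgue. x \<in> \<Union>T \<longrightarrow> f x = h x)"
    by (rule exE)
  note G = gen[THEN conjunct1] gen[THEN conjunct2, THEN conjunct1] gen[THEN conjunct2, THEN conjunct2]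
  have ex: "\<exists>h\<in>lspan G. ae_eq \<Omega> f h" if f: "f \<in> X" for f
  proof -
    obtain h where h: "h \<in> lspan G" "AE x in lebesgue. x \<in> \<Union>T \<longrightarrow> f x = h x"
      using bspec[OF G(3) subsetD[OF X(1) f]] by (rule bexE)
    have "AE x in lebesgue. x \<in> \<Omega> \<longrightarrow> f x = h x"
      using h(2) by (rule eventually_mono) (use T'(2) in blast)
    then show ?thesis
      using h(1) domain_sets by (auto simp: ae_eq_def AE_restrict_space_iff)
  qed
  then show "ae_finite_dim \<Omega> X"
    using G(1,2) ess_bounded_imp_L2 unfolding ae_finite_dim_def by (intro exI[of _ G]) auto
  show "X \<subseteq> ess_bounded \<Omega>"
  proof
    fix f assume f: "f \<in> X"
    then obtain h where h: "h \<in> lspan G" "ae_eq \<Omega> f h" using ex by blast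
    have "(\<lambda>x. 0) \<in> ess_bounded \<Omega>" by (auto simp: ess_bounded_def)
    then have "linear_space (ess_bounded \<Omega> :: (real^3 \<Rightarrow> 'a) set)"
      unfolding linear_space_def by blast
    from lspan_subset[OF this G(2)] h(1) have "h \<in> ess_bounded \<Omega>" by blast
    then obtain M where "AE x in lebesgue_on \<Omega>. norm (h x) \<le> M" by (rule ess_boundedE)
    with h(2) have "AE x in lebesgue_on \<Omega>. norm (f x) \<le> M"
      unfolding ae_eq_def by eventually_elim simp
    then show "f \<in> ess_bounded \<Omega>"
      using f X(2) L2_measurable by (auto simp: ess_bounded_def)
  qed
qed

lemma H0_curl_L2: "H0_curl \<Omega> \<subseteq> L2 \<Omega>"
  by (auto simp: H0_curl_def)

lemma H0_div_L2: "H0_div \<Omega> \<subseteq> L2 \<Omega>"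
  by (auto simp: H0_div_def)

lemma standard_de_rham_spaces:
  assumes "standard_de_rham \<Omega> G N D W" and T: "simplicial_mesh \<Omega> T"
  shows "linear_space (N T)" "N T \<subseteq> H0_curl \<Omega>" "ae_finite_dim \<Omega> (N T)" "N T \<subseteq> ess_bounded \<Omega>"
    and "linear_space (D T)" "D T \<subseteq> H0_div \<Omega>" "ae_finite_dim \<Omega> (D T)" "D T \<subseteq> ess_bounded \<Omega>"
    and "linear_space (W T)" "W T \<subseteq> L2_mean_zero \<Omega>" "ae_finite_dim \<Omega> (W T)" "W T \<subseteq> ess_bounded \<Omega>"
proof -
  obtain PN PD k where N: "N T = H0_curl \<Omega> \<inter> piecewise T PN" "linear_space PN" "finitely_generated PN"
    and D: "D T = H0_div \<Omega> \<inter> piecewise T PD" "linear_space PD" "finitely_generated PD"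
    and W: "W T = L2_mean_zero \<Omega> \<inter> piecewise T (poly_deg k)"
    using assms(1)
  proof cases
    case (1 k)
    then show ?thesis
      by (intro that[of "nedelec1_shape k" "raviart_thomas_shape k" "k - 1"])
         (simp_all add: Nedelec1_def RT_def DG_def linear_space_nedelec1_shape finitely_generated_nedelec1_shape
           linear_space_raviart_thomas_shape finitely_generated_raviart_thomas_shape)
  next
    case (2 k)
    then show ?thesis
      by (intro that[of "poly_deg_vec k" "raviart_thomas_shape k" "k - 1"])
         (simp_all add: Nedelec2_def RT_def DG_def linear_space_poly_deg_vec finitely_generated_poly_deg_vec
           linear_space_raviart_thomas_shape finitely_generated_raviart_thomas_shape)
  next
    case (3 k)
    then show ?thesis
      by (intro that[of "nedelec1_shape (k + 1)" "poly_deg_vec k" "k - 1"])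
         (simp_all add: Nedelec1_def BDM_def DG_def linear_space_nedelec1_shape finitely_generated_nedelec1_shape
           linear_space_poly_deg_vec finitely_generated_poly_deg_vec)
  next
    case (4 k)
    then show ?thesis
      by (intro that[of "poly_deg_vec (k + 1)" "poly_deg_vec k" "k - 1"])
         (simp_all add: Nedelec2_def BDM_def DG_def linear_space_poly_deg_vec finitely_generated_poly_deg_vec)
  qed
  show "linear_space (N T)" "linear_space (D T)" "linear_space (W T)"
    unfolding N(1) D(1) W
    by (intro linear_space_Int linear_space_H0_curl linear_space_H0_div linear_space_piecewise N D
        linear_space_poly_deg linear_space_L2_mean_zero domain_lmeasurable)+
  show NT: "N T \<subseteq> H0_curl \<Omega>" and DT: "D T \<subseteq> H0_div \<Omega>" and WT: "W T \<subseteq> L2_mean_zero \<Omega>"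
    unfolding N(1) D(1) W by auto
  have NP: "N T \<subseteq> piecewise T PN" and DP: "D T \<subseteq> piecewise T PD" and WP: "W T \<subseteq> piecewise T (poly_deg k)"
    unfolding N(1) D(1) W by auto
  have WL: "W T \<subseteq> L2 \<Omega>" using WT by (auto simp: L2_mean_zero_def)
  show "ae_finite_dim \<Omega> (N T)" "N T \<subseteq> ess_bounded \<Omega>"
    by (rule piecewise_finite_dim[OF T N(3) NP subset_trans[OF NT H0_curl_L2]])+
  show "ae_finite_dim \<Omega> (D T)" "D T \<subseteq> ess_bounded \<Omega>"
    by (rule piecewise_finite_dim[OF T D(3) DP subset_trans[OF DT H0_div_L2]])+
  show "ae_finite_dim \<Omega> (W T)" "W T \<subseteq> ess_bounded \<Omega>"
    by (rule piecewise_finite_dim[OF T finitely_generated_poly_deg WP WL])+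
qed

end

section \<open>The discrete problem and its energy identity\<close>

lemma norm_cross3_le: "norm (cross3 x y) \<le> norm x * norm y"
proof (rule power2_le_imp_le)
  show "(norm (cross3 x y))\<^sup>2 \<le> (norm x * norm y)\<^sup>2"
    unfolding norm_cross_dot[symmetric] by simp
qed simp

lemma bounded_bilinear_cross3: "bounded_bilinear cross3"
  by (rule bounded_bilinear.intro)
     (auto simp: cross_add_left cross_add_right cross_mult_left cross_mult_right
       intro!: exI[of _ 1] norm_cross3_le)

lemma norm_matrix_vector_le: "norm ((A :: real^'n^'m) *v x) \<le> norm A * norm x"
proof (rule power2_le_imp_le)
  have "(norm (A *v x))\<^sup>2 = (\<Sum>i\<in>UNIV. (A $ i \<bullet> x)\<^sup>2)"
    unfolding power2_norm_eq_inner[of "A *v x"] inner_vec_def[of "A *v x"]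
    by (simp add: matrix_vector_mul_component power2_eq_square)
  also have "\<dots> \<le> (\<Sum>i\<in>UNIV. (norm (A $ i) * norm x)\<^sup>2)"
    by (intro sum_mono abs_le_square_iff[THEN iffD1]) (simp add: Cauchy_Schwarz_ineq2)
  also have "\<dots> = (norm A * norm x)\<^sup>2"
    by (simp add: power_mult_distrib sum_distrib_right[symmetric] power2_norm_eq_inner inner_vec_def[of A])
  finally show "(norm (A *v x))\<^sup>2 \<le> (norm A * norm x)\<^sup>2" .
qed simp

lemma bounded_bilinear_matrix_vector: "bounded_bilinear (\<lambda>(A :: real^'n^'m) x. A *v x)"
  by (rule bounded_bilinear.intro)
     (auto simp: matrix_vector_mult_add_rdistrib matrix_vector_right_distrib scaleR_matrix_vector_assoc[symmetric]
       matrix_vector_mult_scaleR intro!: exI[of _ 1] norm_matrix_vector_le)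

text \<open>The properties of the finite element spaces on one mesh from which well-posedness follows. Inf-sup stability
  enters as the absence of nonzero pressures that are orthogonal to all divergences.\<close>

locale mhd_spaces = bounded_open +
  fixes R\<^sub>e R\<^sub>m S :: real and V N D :: "vector_field set" and Q W :: "scalar_field set"
  assumes Re_pos: "0 < R\<^sub>e" and Rm_pos: "0 < R\<^sub>m" and S_pos: "0 < S"
    and V: "linear_space V" "V \<subseteq> H01_vec \<Omega>" "ae_finite_dim \<Omega> V" "V \<subseteq> ess_bounded \<Omega>"
    and N: "linear_space N" "N \<subseteq> H0_curl \<Omega>" "ae_finite_dim \<Omega> N" "N \<subseteq> ess_bounded \<Omega>"
    and D: "linear_space D" "D \<subseteq> H0_div \<Omega>" "ae_finite_dim \<Omega> D" "D \<subseteq> ess_bounded \<Omega>"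
    and Q: "linear_space Q" "Q \<subseteq> L2 \<Omega>" "ae_finite_dim \<Omega> Q"
    and W: "linear_space W" "W \<subseteq> L2 \<Omega>"
    and curl_in_D: "\<And>E. E \<in> N \<Longrightarrow> weak_curl \<Omega> E \<in> D"
    and div_in_W: "\<And>B. B \<in> D \<Longrightarrow> weak_div \<Omega> B \<in> W"
    and div_curl: "\<And>E. E \<in> N \<Longrightarrow> ae_eq \<Omega> (weak_div \<Omega> (weak_curl \<Omega> E)) (\<lambda>x. 0)"
    and exact_D: "\<And>B. \<lbrakk>B \<in> D; ae_eq \<Omega> (weak_div \<Omega> B) (\<lambda>x. 0)\<rbrakk> \<Longrightarrow> \<exists>E\<in>N. ae_eq \<Omega> B (weak_curl \<Omega> E)"
    and div_onto: "\<And>s. s \<in> W \<Longrightarrow> \<exists>B\<in>D. ae_eq \<Omega> s (weak_div \<Omega> B)"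
    and inf_sup: "\<And>q. \<lbrakk>q \<in> Q; \<And>v. v \<in> V \<Longrightarrow> l2_inner \<Omega> (weak_div \<Omega> v) q = 0\<rbrakk> \<Longrightarrow> ae_eq \<Omega> q (\<lambda>x. 0)"
begin

abbreviation ip where "ip \<equiv> l2_inner \<Omega>"
abbreviation nrm where "nrm \<equiv> l2_norm \<Omega>"
abbreviation jac where "jac \<equiv> weak_jacobian \<Omega>"

definition \<alpha> :: real where "\<alpha> = S / R\<^sub>m"

lemma \<alpha>_pos: "0 < \<alpha>"
  using S_pos Rm_pos by (simp add: \<alpha>_def)

definition D\<^sub>0 :: "vector_field set" where
  "D\<^sub>0 = {B \<in> D. ae_eq \<Omega> (weak_div \<Omega> B) (\<lambda>x. 0)}"

definition current :: "vector_field \<Rightarrow> vector_field \<Rightarrow> vector_field \<Rightarrow> vector_field" where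
  "current E u B = (\<lambda>x. E x + cross3 (u x) (B x))"

lemma V_L2: "v \<in> V \<Longrightarrow> v \<in> L2 \<Omega>" and N_L2: "E \<in> N \<Longrightarrow> E \<in> L2 \<Omega>"
  and D_L2: "B \<in> D \<Longrightarrow> B \<in> L2 \<Omega>" and Q_L2: "q \<in> Q \<Longrightarrow> q \<in> L2 \<Omega>" and W_L2: "s \<in> W \<Longrightarrow> s \<in> L2 \<Omega>"
  using V(2) N(2) D(2) Q(2) W(2) H01_vec_L2 H0_curl_L2 H0_div_L2 by blast+

lemma V_bounded: "v \<in> V \<Longrightarrow> v \<in> ess_bounded \<Omega>" and N_bounded: "E \<in> N \<Longrightarrow> E \<in> ess_bounded \<Omega>"
  and D_bounded: "B \<in> D \<Longrightarrow> B \<in> ess_bounded \<Omega>"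
  using V(4) N(4) D(4) by blast+

lemma jac_L2: "v \<in> V \<Longrightarrow> jac v \<in> L2 \<Omega>"
  using V(2) weak_jacobian_L2 by blast

lemma jac_linear: "ae_linear \<Omega> V jac"
  by (rule ae_linear_subset[OF ae_linear_weak_jacobian V(2)])

lemma curl_linear: "ae_linear \<Omega> N (weak_curl \<Omega>)"
  by (rule ae_linear_subset[OF ae_linear_weak_curl]) (use N(2) in \<open>auto simp: H0_curl_def\<close>)

lemma div_linear_D: "ae_linear \<Omega> D (weak_div \<Omega>)"
  by (rule ae_linear_subset[OF ae_linear_weak_div]) (use D(2) in \<open>auto simp: H0_div_def\<close>)

lemma V_has_weak_div: "v \<in> V \<Longrightarrow> \<exists>d. has_weak_div \<Omega> v d"
  using V(2) H01_vec_has_weak_div by blast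

lemma div_linear_V: "ae_linear \<Omega> V (weak_div \<Omega>)"
  by (rule ae_linear_subset[OF ae_linear_weak_div]) (auto intro: V_L2 V_has_weak_div)

lemma div_L2: "v \<in> V \<Longrightarrow> weak_div \<Omega> v \<in> L2 \<Omega>"
  using has_weak_div_weak_div[OF V_has_weak_div] by (simp add: has_weak_div_def)

lemma curl_L2': "E \<in> N \<Longrightarrow> weak_curl \<Omega> E \<in> L2 \<Omega>"
  by (intro D_L2 curl_in_D)

lemma curl_in_D\<^sub>0: "E \<in> N \<Longrightarrow> weak_curl \<Omega> E \<in> D\<^sub>0"
  using curl_in_D div_curl by (simp add: D\<^sub>0_def)

lemma cross_bounded: "\<lbrakk>f \<in> ess_bounded \<Omega>; g \<in> ess_bounded \<Omega>\<rbrakk> \<Longrightarrow> (\<lambda>x. cross3 (f x) (g x)) \<in> ess_bounded \<Omega>"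
  by (rule ess_bounded_bilinear[OF bounded_bilinear_cross3])

lemma current_bounded: "\<lbrakk>E \<in> N; u \<in> V; B \<in> D\<rbrakk> \<Longrightarrow> current E u B \<in> ess_bounded \<Omega>"
  unfolding current_def by (intro ess_bounded_add cross_bounded N_bounded V_bounded D_bounded)

lemma current_L2: "\<lbrakk>E \<in> N; u \<in> V; B \<in> D\<rbrakk> \<Longrightarrow> current E u B \<in> L2 \<Omega>"
  by (intro ess_bounded_imp_L2 current_bounded)

lemma convection_L2: "\<lbrakk>u \<in> V; w \<in> V\<rbrakk> \<Longrightarrow> (\<lambda>x. jac u x *v w x) \<in> L2 \<Omega>"
  by (rule L2_bilinear_bounded[OF bounded_bilinear_matrix_vector jac_L2 V_bounded])

lemma linear_space_ae_kernel:
  assumes X: "linear_space X" and T: "ae_linear \<Omega> X T"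
  shows "linear_space {u \<in> X. ae_eq \<Omega> (T u) (\<lambda>x. 0)}"
proof (rule linear_spaceI)
  show "(\<lambda>x. 0) \<in> {u \<in> X. ae_eq \<Omega> (T u) (\<lambda>x. 0)}"
    using ae_linear_zero[OF X T] linear_space_zero[OF X] by simp
  fix u v c assume uv: "u \<in> {u \<in> X. ae_eq \<Omega> (T u) (\<lambda>x. 0)}" "v \<in> {u \<in> X. ae_eq \<Omega> (T u) (\<lambda>x. 0)}"
  then have m: "(\<lambda>x. u x + c *\<^sub>R v x) \<in> X"
    by (intro linear_space_add[OF X] linear_space_scale[OF X]) auto
  have "ae_eq \<Omega> (T (\<lambda>x. u x + c *\<^sub>R v x)) (\<lambda>x. T u x + c *\<^sub>R T v x)"
    using uv by (intro ae_linearD[OF T _ _ m]) auto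
  also have "ae_eq \<Omega> \<dots> (\<lambda>x. 0 + c *\<^sub>R 0)"
    using uv by (intro ae_eq_add ae_eq_scale) auto
  finally show "(\<lambda>x. u x + c *\<^sub>R v x) \<in> {u \<in> X. ae_eq \<Omega> (T u) (\<lambda>x. 0)}" using m by simp
qed

lemma D\<^sub>0_linear: "linear_space D\<^sub>0"
  unfolding D\<^sub>0_def by (rule linear_space_ae_kernel[OF D(1) div_linear_D])

lemma D\<^sub>0_subset: "D\<^sub>0 \<subseteq> D"
  by (auto simp: D\<^sub>0_def)

text \<open>Finite dimension bounds the essential supremum by the \<open>L\<^sup>2\<close> norm, and the Poincare inequality
  bounds the latter by the gradient.\<close>

lemma velocity_bounds:
  obtains P K where "0 \<le> P" "0 \<le> K" "\<And>u. u \<in> V \<Longrightarrow> nrm u \<le> P * nrm (jac u)"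
    "\<And>u. u \<in> V \<Longrightarrow> AE x in lebesgue_on \<Omega>. norm (u x) \<le> K * nrm (jac u)"
proof -
  obtain P where P: "0 \<le> P" "\<And>u. u \<in> V \<Longrightarrow> nrm u \<le> P * nrm (jac u)"
    using Poincare_H01_vec V(2) by blast
  have VL: "V \<subseteq> L2 \<Omega>" using V_L2 by blast
  obtain n e where "orthonormal_basis \<Omega> V n e"
    using ae_finite_dim_orthonormal_basis[OF V(3,1) VL] .
  from finite_dim_sup_bound[OF this VL V(4)] obtain K where
    K: "0 \<le> K" "\<And>u. u \<in> V \<Longrightarrow> AE x in lebesgue_on \<Omega>. norm (u x) \<le> K * nrm u" by blast
  have "AE x in lebesgue_on \<Omega>. norm (u x) \<le> (K * P) * nrm (jac u)" if u: "u \<in> V" for u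
    using K(2)[OF u]
  proof (rule eventually_mono)
    fix x assume "norm (u x) \<le> K * nrm u"
    also have "\<dots> \<le> K * (P * nrm (jac u))" using P(2)[OF u] K(1) by (rule mult_left_mono)
    finally show "norm (u x) \<le> (K * P) * nrm (jac u)" by (simp add: mult.assoc)
  qed
  with P K(1) show ?thesis by (intro that[of P "K * P"]) auto
qed

text \<open>A bounded linear right inverse of the curl on the divergence-free fields, a discrete Poincare inequality:
  preimages are chosen for the elements of an orthonormal basis and extended linearly.\<close>

lemma curl_lift:
  obtains A C where "0 \<le> C" "\<And>B. B \<in> D\<^sub>0 \<Longrightarrow> A B \<in> N" "\<And>B. B \<in> D\<^sub>0 \<Longrightarrow> ae_eq \<Omega> (weak_curl \<Omega> (A B)) B"
    "\<And>B. B \<in> D\<^sub>0 \<Longrightarrow> nrm (A B) \<le> C * nrm B" "ae_linear \<Omega> D\<^sub>0 A"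
proof -
  have DL: "D\<^sub>0 \<subseteq> L2 \<Omega>" using D\<^sub>0_subset D_L2 by blast
  obtain n d where nd: "orthonormal_basis \<Omega> D\<^sub>0 n d"
    using ae_finite_dim_orthonormal_basis[OF ae_finite_dim_subset[OF D(3) D\<^sub>0_subset] D\<^sub>0_linear DL] .
  then have d: "\<And>i. i < n \<Longrightarrow> d i \<in> D\<^sub>0" and on: "orthonormal \<Omega> n d"
    by (auto simp: orthonormal_basis_def)
  have dL: "d i \<in> L2 \<Omega>" if "i < n" for i using d[OF that] DL by blast
  have "\<forall>i. \<exists>E. i < n \<longrightarrow> E \<in> N \<and> ae_eq \<Omega> (d i) (weak_curl \<Omega> E)"
    using exact_D d unfolding D\<^sub>0_def by blast
  then obtain F where F: "\<And>i. i < n \<Longrightarrow> F i \<in> N" "\<And>i. i < n \<Longrightarrow> ae_eq \<Omega> (d i) (weak_curl \<Omega> (F i))"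
    by metis
  define A where "A B = (\<lambda>x. \<Sum>i<n. ip B (d i) *\<^sub>R F i x)" for B
  show ?thesis
  proof (rule that)
    show "0 \<le> (\<Sum>i<n. nrm (F i))" by (intro sum_nonneg) simp
    fix B assume B: "B \<in> D\<^sub>0"
    show "A B \<in> N" unfolding A_def using F(1) by (intro linear_space_lincomb[OF N(1)]) auto
    have "ae_eq \<Omega> (weak_curl \<Omega> (A B)) (\<lambda>x. \<Sum>i<n. ip B (d i) *\<^sub>R weak_curl \<Omega> (F i) x)"
      unfolding A_def using F(1) by (intro ae_linear_lincomb[OF N(1) curl_linear]) auto
    also have "ae_eq \<Omega> \<dots> (\<lambda>x. \<Sum>i<n. ip B (d i) *\<^sub>R d i x)"
      using F(2) by (intro ae_eq_sum ae_eq_scale) (auto intro: ae_eq_sym)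
    also have "ae_eq \<Omega> \<dots> B"
      by (rule ae_eq_sym) (use nd B in \<open>simp add: orthonormal_basis_def\<close>)
    finally show "ae_eq \<Omega> (weak_curl \<Omega> (A B)) B" .
    have "nrm (A B) \<le> (\<Sum>i<n. nrm (\<lambda>x. ip B (d i) *\<^sub>R F i x))"
      unfolding A_def using F(1) N_L2 by (intro l2_norm_sum L2_scale) auto
    also have "\<dots> \<le> (\<Sum>i<n. nrm (F i) * nrm B)"
    proof (rule sum_mono)
      fix i assume "i \<in> {..<n}"
      then have "\<bar>ip B (d i)\<bar> \<le> nrm B" using B DL dL by (intro orthonormal_coefficient_le[OF on]) auto
      then show "nrm (\<lambda>x. ip B (d i) *\<^sub>R F i x) \<le> nrm (F i) * nrm B"
        by (simp add: l2_norm_scale mult.commute[of "nrm (F i)" "nrm B"] mult_right_mono)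
    qed
    finally show "nrm (A B) \<le> (\<Sum>i<n. nrm (F i)) * nrm B" by (simp add: sum_distrib_right)
  next
    show "ae_linear \<Omega> D\<^sub>0 A"
      unfolding ae_linear_def
    proof (intro ballI allI impI)
      fix u v w c assume *: "u \<in> D\<^sub>0" "v \<in> D\<^sub>0" "w \<in> D\<^sub>0" "ae_eq \<Omega> w (\<lambda>x. u x + c *\<^sub>R v x)"
      have "ip w (d i) = ip u (d i) + c * ip v (d i)" if "i < n" for i
        using * DL dL[OF that] by (intro l2_inner_ae_lincomb) auto
      then have "A w = (\<lambda>x. A u x + c *\<^sub>R A v x)"
        by (simp add: A_def scaleR_add_left sum.distrib scaleR_sum_right)
      then show "ae_eq \<Omega> (A w) (\<lambda>x. A u x + c *\<^sub>R A v x)" by simp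
    qed
  qed
qed

lemma trilinear_form_left:
  assumes "u \<in> V" "v \<in> V" shows "ae_linear_form \<Omega> V (\<lambda>w. trilinear \<Omega> w u v)"
proof -
  have l: "ae_linear_form \<Omega> V (\<lambda>w. ip (\<lambda>x. jac u x *v w x) v)" if "u \<in> V" "v \<in> V" for u v
    by (rule ae_linear_form_compose[OF ae_linear_form_l2_inner_left
          ae_linear_bilinear_right[OF bounded_bilinear_matrix_vector ae_linear_ident]])
       (use that V_L2 convection_L2 in auto)
  show ?thesis
    unfolding trilinear_def by (intro ae_linear_form_mult ae_linear_form_minus l assms)
qed

lemma convection_form_middle:
  assumes "w \<in> V" "v \<in> V" shows "ae_linear_form \<Omega> V (\<lambda>u. ip (\<lambda>x. jac u x *v w x) v)"
  by (rule ae_linear_form_compose[OF ae_linear_form_l2_inner_left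
        ae_linear_bilinear_left[OF bounded_bilinear_matrix_vector jac_linear]])
     (use assms V_L2 convection_L2 in auto)

lemma convection_form_right:
  assumes "w \<in> V" "u \<in> V" shows "ae_linear_form \<Omega> V (\<lambda>v. ip (\<lambda>x. jac u x *v w x) v)"
  by (rule ae_linear_form_subset[OF ae_linear_form_l2_inner_right]) (use assms V_L2 convection_L2 in auto)

lemma trilinear_form_middle:
  assumes "w \<in> V" "v \<in> V" shows "ae_linear_form \<Omega> V (\<lambda>u. trilinear \<Omega> w u v)"
  unfolding trilinear_def
  by (intro ae_linear_form_mult ae_linear_form_minus convection_form_middle convection_form_right assms)

lemma trilinear_form_right:
  assumes "w \<in> V" "u \<in> V" shows "ae_linear_form \<Omega> V (\<lambda>v. trilinear \<Omega> w u v)"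
  unfolding trilinear_def
  by (intro ae_linear_form_mult ae_linear_form_minus convection_form_middle convection_form_right assms)

lemma trilinear_self [simp]: "trilinear \<Omega> w v v = 0"
  by (simp add: trilinear_def)

lemma bilinear_norm_le:
  fixes h :: "'a::euclidean_space \<Rightarrow> 'b::euclidean_space \<Rightarrow> 'c::euclidean_space"
  assumes h: "bounded_bilinear h" "\<And>a b. norm (h a b) \<le> norm a * norm b"
    and f: "f \<in> L2 \<Omega>" and g: "g \<in> borel_measurable (lebesgue_on \<Omega>)"
    and M: "0 \<le> M" "AE x in lebesgue_on \<Omega>. norm (g x) \<le> M"
  shows "nrm (\<lambda>x. h (f x) (g x)) \<le> M * nrm f"
proof (rule l2_norm_mono[OF bounded_bilinear_measurable[OF h(1) L2_measurable[OF f] g] f M(1)])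
  show "AE x in lebesgue_on \<Omega>. norm (h (f x) (g x)) \<le> M * norm (f x)"
    using M(2)
  proof (rule eventually_mono)
    fix x assume "norm (g x) \<le> M"
    then have "norm (f x) * norm (g x) \<le> norm (f x) * M" by (rule mult_left_mono) simp
    then show "norm (h (f x) (g x)) \<le> M * norm (f x)" using h(2)[of "f x" "g x"] by (simp add: mult.commute)
  qed
qed

lemma cross_norm_le:
  assumes f: "f \<in> L2 \<Omega>" and g: "g \<in> borel_measurable (lebesgue_on \<Omega>)"
    and M: "0 \<le> M" "AE x in lebesgue_on \<Omega>. norm (g x) \<le> M"
  shows "nrm (\<lambda>x. cross3 (g x) (f x)) \<le> M * nrm f"
  by (rule bilinear_norm_le[OF bounded_bilinear.flip[OF bounded_bilinear_cross3] _ f g M])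
     (metis norm_cross3_le mult.commute)

lemma lorentz_swap:
  "ip (\<lambda>x. cross3 (j x) (B x)) v = - ip j (\<lambda>x. cross3 (v x) (B x))"
proof -
  have "cross3 (j x) (B x) \<bullet> v x = - (j x \<bullet> cross3 (v x) (B x))" for x
    by (metis cross_skew cross_triple inner_commute inner_minus_right)
  then show ?thesis by (simp add: l2_inner_def)
qed

definition solution where
  "solution f u E B p r \<longleftrightarrow> mhd_solution \<Omega> R\<^sub>e R\<^sub>m S V N D Q W f u E B p r"

text \<open>The Lorentz force term is moved to the test function, where it pairs \<open>j\<close> with \<open>v \<times>
  B\<close>. In this form the cancellation against \<open>u \<times> B\<close> in Ohm's law is visible.\<close>

lemma solution_iff:
  "solution f u E B p r \<longleftrightarrow>
     u \<in> V \<and> E \<in> N \<and> B \<in> D \<and> p \<in> Q \<and> r \<in> W \<and>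
     (\<forall>v\<in>V. trilinear \<Omega> u u v + 1 / R\<^sub>e * ip (jac u) (jac v)
        + S * ip (current E u B) (\<lambda>x. cross3 (v x) (B x)) - ip p (weak_div \<Omega> v) = f v) \<and>
     (\<forall>F\<in>N. S * ip (current E u B) F = \<alpha> * ip B (weak_curl \<Omega> F)) \<and>
     (\<forall>C\<in>D. \<alpha> * ip (weak_curl \<Omega> E) C + ip r (weak_div \<Omega> C) = 0) \<and>
     (\<forall>q\<in>Q. ip (weak_div \<Omega> u) q = 0) \<and>
     (\<forall>s\<in>W. ip (weak_div \<Omega> B) s = 0)"
  unfolding solution_def mhd_solution_def Let_def current_def[symmetric] \<alpha>_def[symmetric] lorentz_swap
  by simp

lemma ae_zero_inner:
  "\<lbrakk>ae_eq \<Omega> f (\<lambda>x. 0); f \<in> L2 \<Omega>; g \<in> L2 \<Omega>\<rbrakk> \<Longrightarrow> ip f g = 0"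
  using l2_inner_cong[of f \<Omega> "\<lambda>x. 0" g g] by simp

lemma inner_self_zero: "\<lbrakk>f \<in> L2 \<Omega>; ip f f = 0\<rbrakk> \<Longrightarrow> ae_eq \<Omega> f (\<lambda>x. 0)"
  using l2_norm_eq_0_iff[of f \<Omega>] l2_norm_square[of \<Omega> f] by simp

text \<open>The test function \<open>C = \<nabla> \<times> E\<close> is divergence-free, which eliminates the multiplier.\<close>

lemma solution_curl_zero:
  assumes sol: "solution f u E B p r" shows "ae_eq \<Omega> (weak_curl \<Omega> E) (\<lambda>x. 0)"
proof -
  have E: "E \<in> N" and r: "r \<in> W"
    and eq: "\<alpha> * ip (weak_curl \<Omega> E) (weak_curl \<Omega> E) + ip r (weak_div \<Omega> (weak_curl \<Omega> E)) = 0"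
    using sol curl_in_D by (auto simp: solution_iff)
  have "ip (weak_div \<Omega> (weak_curl \<Omega> E)) r = 0"
    by (rule ae_zero_inner[OF div_curl[OF E] W_L2[OF div_in_W[OF curl_in_D[OF E]]] W_L2[OF r]])
  then have "ip (weak_curl \<Omega> E) (weak_curl \<Omega> E) = 0"
    using eq \<alpha>_pos by (simp add: l2_inner_commute[of \<Omega> r])
  then show ?thesis by (rule inner_self_zero[OF curl_L2'[OF E]])
qed

text \<open>The divergence maps onto the space of \<open>r\<close>, and the curl of \<open>E\<close> vanishes.\<close>

lemma solution_multiplier_zero:
  assumes sol: "solution f u E B p r" shows "ae_eq \<Omega> r (\<lambda>x. 0)"
proof -
  have E: "E \<in> N" and r: "r \<in> W"
    and eq: "\<And>C. C \<in> D \<Longrightarrow> \<alpha> * ip (weak_curl \<Omega> E) C + ip r (weak_div \<Omega> C) = 0"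
    using sol by (auto simp: solution_iff)
  obtain C where C: "C \<in> D" "ae_eq \<Omega> r (weak_div \<Omega> C)" using div_onto[OF r] by blast
  have "ip (weak_curl \<Omega> E) C = 0"
    by (rule ae_zero_inner[OF solution_curl_zero[OF sol] curl_L2'[OF E] D_L2[OF C(1)]])
  then have "ip r (weak_div \<Omega> C) = 0" using eq[OF C(1)] by simp
  moreover have "ip r r = ip r (weak_div \<Omega> C)"
    using W_L2[OF r] W_L2[OF div_in_W[OF C(1)]] C(2) by (intro l2_inner_cong) auto
  ultimately show ?thesis by (intro inner_self_zero W_L2[OF r]) simp
qed

lemma solution_div_zero:
  assumes sol: "solution f u E B p r" shows "B \<in> D\<^sub>0"
proof -
  have B: "B \<in> D" "ip (weak_div \<Omega> B) (weak_div \<Omega> B) = 0"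
    using sol div_in_W by (auto simp: solution_iff)
  then show ?thesis
    using inner_self_zero[OF W_L2[OF div_in_W[OF B(1)]]] by (simp add: D\<^sub>0_def)
qed

text \<open>Tested with \<open>u\<close>, the Lorentz term is \<open>S (j, u \<times> B)\<close>; tested with
  \<open>E\<close>, Ohm's law gives \<open>S (j, E) = 0\<close>. Their sum is \<open>S
  \<parallel>j\<parallel>\<^sup>2\<close>.\<close>

lemma solution_energy:
  assumes sol: "solution f u E B p r"
  shows "1 / R\<^sub>e * (nrm (jac u))\<^sup>2 + S * (nrm (current E u B))\<^sup>2 = f u"
proof -
  let ?j = "current E u B"
  have m: "u \<in> V" "E \<in> N" "B \<in> D" "p \<in> Q"
    and eq1: "trilinear \<Omega> u u u + 1 / R\<^sub>e * ip (jac u) (jac u)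
        + S * ip ?j (\<lambda>x. cross3 (u x) (B x)) - ip p (weak_div \<Omega> u) = f u"
    and eq2: "S * ip ?j E = \<alpha> * ip B (weak_curl \<Omega> E)"
    and eq4: "ip (weak_div \<Omega> u) p = 0"
    using sol by (auto simp: solution_iff)
  have "ip (weak_curl \<Omega> E) B = 0"
    by (rule ae_zero_inner[OF solution_curl_zero[OF sol] curl_L2'[OF m(2)] D_L2[OF m(3)]])
  then have 2: "S * ip ?j E = 0" using eq2 by (simp add: l2_inner_commute[of \<Omega> B])
  have "ip ?j ?j = ip ?j E + ip ?j (\<lambda>x. cross3 (u x) (B x))"
    using current_L2[OF m(2,1,3)] N_L2[OF m(2)]
      ess_bounded_imp_L2[OF cross_bounded[OF V_bounded[OF m(1)] D_bounded[OF m(3)]]]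
    by (subst (2) current_def) (rule l2_inner_add_right)
  then show ?thesis
    using eq1 2 eq4 by (simp add: l2_norm_square l2_inner_commute[of \<Omega> p] algebra_simps)
qed

text \<open>Test with \<open>F = A B\<close>, whose curl is \<open>B\<close>. The bound is needed for solutions and for
  differences of solutions, hence the general \<open>j\<close>.\<close>

lemma magnetic_bound:
  assumes C: "0 \<le> C" and A: "\<And>B. B \<in> D\<^sub>0 \<Longrightarrow> A B \<in> N" "\<And>B. B \<in> D\<^sub>0 \<Longrightarrow> ae_eq \<Omega> (weak_curl \<Omega> (A B)) B"
      "\<And>B. B \<in> D\<^sub>0 \<Longrightarrow> nrm (A B) \<le> C * nrm B"
    and B: "B \<in> D\<^sub>0" and j: "j \<in> L2 \<Omega>" and eq: "\<And>F. F \<in> N \<Longrightarrow> S * ip j F = \<alpha> * ip B (weak_curl \<Omega> F)"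
  shows "nrm B \<le> R\<^sub>m * C * nrm j"
proof -
  have BL: "B \<in> L2 \<Omega>" using B D\<^sub>0_subset D_L2 by blast
  have "\<alpha> * (nrm B)\<^sup>2 = \<alpha> * ip B (weak_curl \<Omega> (A B))"
    using l2_inner_cong[OF BL BL BL curl_L2'[OF A(1)[OF B]] ae_eq_refl ae_eq_sym[OF A(2)[OF B]]]
    by (simp add: l2_norm_square)
  also have "\<dots> = S * ip j (A B)" using eq[OF A(1)[OF B]] by simp
  also have "\<dots> \<le> S * (nrm j * (C * nrm B))"
  proof -
    have "ip j (A B) \<le> nrm j * nrm (A B)"
      using l2_Cauchy_Schwarz[OF j N_L2[OF A(1)[OF B]]] by linarith
    also have "\<dots> \<le> nrm j * (C * nrm B)" using A(3)[OF B] by (rule mult_left_mono) simp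
    finally show ?thesis using S_pos by (simp add: mult_left_mono)
  qed
  finally have "S * (nrm B * nrm B) \<le> S * ((R\<^sub>m * C * nrm j) * nrm B)"
    using Rm_pos by (simp add: \<alpha>_def power2_eq_square field_simps)
  then have "nrm B * nrm B \<le> (R\<^sub>m * C * nrm j) * nrm B" using S_pos by simp
  then show ?thesis
    using Rm_pos C by (cases "nrm B = 0") (simp_all add: mult_le_cancel_right order_less_le)
qed

end

section \<open>Uniqueness for small data\<close>

context mhd_spaces
begin

lemma trilinear_bound:
  assumes w: "w \<in> V" and u: "u \<in> V" and v: "v \<in> V"
    and M: "0 \<le> M" "AE x in lebesgue_on \<Omega>. norm (w x) \<le> M"
  shows "\<bar>trilinear \<Omega> w u v\<bar> \<le> M * (nrm (jac u) * nrm v + nrm (jac v) * nrm u) / 2"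
proof -
  have half: "\<bar>ip (\<lambda>x. jac a x *v w x) b\<bar> \<le> M * (nrm (jac a) * nrm b)" if a: "a \<in> V" and b: "b \<in> V" for a b
  proof -
    have "\<bar>ip (\<lambda>x. jac a x *v w x) b\<bar> \<le> nrm (\<lambda>x. jac a x *v w x) * nrm b"
      by (rule l2_Cauchy_Schwarz[OF convection_L2[OF a w] V_L2[OF b]])
    also have "\<dots> \<le> (M * nrm (jac a)) * nrm b"
      by (intro mult_right_mono l2_norm_nonneg
          bilinear_norm_le[OF bounded_bilinear_matrix_vector norm_matrix_vector_le jac_L2[OF a] L2_measurable[OF V_L2[OF w]] M])
    finally show ?thesis by (simp add: mult.assoc)
  qed
  show ?thesis
    using half[OF u v] half[OF v u] unfolding trilinear_def by (simp add: distrib_left abs_le_iff)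
qed

lemma energy_bounds:
  assumes sol: "solution f u E B p r" and f: "f u \<le> \<epsilon> * nrm (jac u)" and \<epsilon>: "0 \<le> \<epsilon>"
  shows "nrm (jac u) \<le> R\<^sub>e * \<epsilon>" and "nrm (current E u B) \<le> sqrt (R\<^sub>e / S) * \<epsilon>"
proof -
  let ?a = "nrm (jac u)" and ?y = "nrm (current E u B)"
  have en: "1 / R\<^sub>e * ?a\<^sup>2 + S * ?y\<^sup>2 \<le> \<epsilon> * ?a"
    using solution_energy[OF sol] f by simp
  moreover have "0 \<le> S * ?y\<^sup>2" using S_pos by simp
  ultimately have "1 / R\<^sub>e * ?a\<^sup>2 \<le> \<epsilon> * ?a" by linarith
  then have "?a * ?a \<le> (R\<^sub>e * \<epsilon>) * ?a"
    using Re_pos by (simp add: field_simps power2_eq_square)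
  then show a: "?a \<le> R\<^sub>e * \<epsilon>"
    using Re_pos \<epsilon> by (cases "?a = 0") (simp_all add: mult_le_cancel_right order_less_le)
  have "0 \<le> 1 / R\<^sub>e * ?a\<^sup>2" using Re_pos by simp
  then have "S * ?y\<^sup>2 \<le> \<epsilon> * (R\<^sub>e * \<epsilon>)"
    using en mult_left_mono[OF a \<epsilon>] by linarith
  then have "?y\<^sup>2 \<le> (sqrt (R\<^sub>e / S) * \<epsilon>)\<^sup>2"
    using S_pos Re_pos by (simp add: power_mult_distrib field_simps power2_eq_square)
  then show "?y \<le> sqrt (R\<^sub>e / S) * \<epsilon>"
    by (rule power2_le_imp_le) (use Re_pos S_pos \<epsilon> in simp)
qed

lemma current_diff:
  "current E u B x - current E' u' B' x
    = E x - E' x + cross3 (u x - u' x) (B x) + cross3 (u' x) (B x - B' x)"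
  by (simp add: current_def cross3_simps left_diff_distrib)

text \<open>Skew-symmetry reduces the convection terms to \<open>L(\<delta>u; u, \<delta>u)\<close>. Since \<open>\<delta>j
  = \<delta>E + \<delta>u \<times> B + u' \<times> \<delta>B\<close> and \<open>(\<delta>j, \<delta>E) =
  0\<close>, the term \<open>(\<delta>j, \<delta>u \<times> B)\<close> from the Lorentz force supplies
  \<open>\<parallel>\<delta>j\<parallel>\<^sup>2\<close> up to \<open>(\<delta>j, u' \<times> \<delta>B)\<close>.\<close>

lemma solutions_difference_identity:
  assumes sol: "solution f u E B p r" and sol': "solution f u' E' B' p' r'"
  defines "du \<equiv> \<lambda>x. u x - u' x" and "dB \<equiv> \<lambda>x. B x - B' x"
    and "dj \<equiv> \<lambda>x. current E u B x - current E' u' B' x"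
  shows "1 / R\<^sub>e * (nrm (jac du))\<^sup>2 + S * (nrm dj)\<^sup>2
    = - trilinear \<Omega> du u du + S * ip dj (\<lambda>x. cross3 (u' x) (dB x))
      - S * ip (current E' u' B') (\<lambda>x. cross3 (du x) (dB x))"
proof -
  let ?j = "current E u B" and ?j' = "current E' u' B'"
  define dE where "dE = (\<lambda>x. E x - E' x)"
  have m: "u \<in> V" "E \<in> N" "B \<in> D" "p \<in> Q" "u' \<in> V" "E' \<in> N" "B' \<in> D" "p' \<in> Q"
    using sol sol' by (auto simp: solution_iff)
  have duV: "du \<in> V" unfolding du_def by (rule linear_space_diff[OF V(1) m(1,5)])
  have dEN: "dE \<in> N" unfolding dE_def by (rule linear_space_diff[OF N(1) m(2,6)])
  have dBD: "dB \<in> D" unfolding dB_def by (rule linear_space_diff[OF D(1) m(3,7)])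
  have jL: "?j \<in> L2 \<Omega>" "?j' \<in> L2 \<Omega>" using m by (auto intro: current_L2)
  have djL: "dj \<in> L2 \<Omega>" unfolding dj_def by (rule L2_diff[OF jL])
  have cL: "(\<lambda>x. cross3 (w x) (C x)) \<in> L2 \<Omega>" if "w \<in> V" "C \<in> D" for w C
    using that by (intro ess_bounded_imp_L2 cross_bounded V_bounded D_bounded)
  have eq1: "trilinear \<Omega> u u du + 1 / R\<^sub>e * ip (jac u) (jac du) + S * ip ?j (\<lambda>x. cross3 (du x) (B x)) - ip p (weak_div \<Omega> du) = f du"
    and eq1': "trilinear \<Omega> u' u' du + 1 / R\<^sub>e * ip (jac u') (jac du) + S * ip ?j' (\<lambda>x. cross3 (du x) (B' x)) - ip p' (weak_div \<Omega> du) = f du"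
    using sol sol' duV by (auto simp: solution_iff)
  have divdu: "ip q (weak_div \<Omega> du) = 0" if q: "q \<in> Q" for q
  proof -
    have "ae_linear_form \<Omega> V (\<lambda>v. ip q (weak_div \<Omega> v))"
      by (rule ae_linear_form_compose[OF ae_linear_form_l2_inner_right[OF Q_L2[OF q]] div_linear_V div_L2])
    then have "ip q (weak_div \<Omega> du) = ip q (weak_div \<Omega> u) - ip q (weak_div \<Omega> u')"
      unfolding du_def by (rule ae_linear_form_diff[OF V(1) _ m(1,5)])
    moreover have "ip (weak_div \<Omega> u) q = 0" "ip (weak_div \<Omega> u') q = 0"
      using sol sol' q by (auto simp: solution_iff)
    ultimately show ?thesis by (simp add: l2_inner_commute[of \<Omega> q])
  qed
  have tri: "trilinear \<Omega> u u du - trilinear \<Omega> u' u' du = trilinear \<Omega> du u du"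
  proof -
    have "trilinear \<Omega> du u du = trilinear \<Omega> u u du - trilinear \<Omega> u' u du"
      unfolding du_def[of] by (rule ae_linear_form_diff[OF V(1) trilinear_form_left m(1,5)]) (use m duV in \<open>simp_all add: du_def\<close>)
    moreover have "trilinear \<Omega> u' du du = trilinear \<Omega> u' u du - trilinear \<Omega> u' u' du"
      unfolding du_def[of] by (rule ae_linear_form_diff[OF V(1) trilinear_form_middle m(1,5)]) (use m duV in \<open>simp_all add: du_def\<close>)
    ultimately show ?thesis by simp
  qed
  have jacd: "ip (jac u) (jac du) - ip (jac u') (jac du) = (nrm (jac du))\<^sup>2"
  proof -
    have "(nrm (jac du))\<^sup>2 = ip (\<lambda>x. jac u x - jac u' x) (jac du)"
      unfolding l2_norm_square
      by (rule l2_inner_cong)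
         (use m duV ae_linear_diff[OF V(1) jac_linear m(1,5)] in \<open>auto intro: jac_L2 L2_diff simp: du_def\<close>)
    then show ?thesis using m duV by (simp add: l2_inner_diff_left jac_L2)
  qed
  have lor: "ip ?j (\<lambda>x. cross3 (du x) (B x)) - ip ?j' (\<lambda>x. cross3 (du x) (B' x))
      = ip dj (\<lambda>x. cross3 (du x) (B x)) + ip ?j' (\<lambda>x. cross3 (du x) (dB x))"
  proof -
    have "ip dj (\<lambda>x. cross3 (du x) (B x)) = ip ?j (\<lambda>x. cross3 (du x) (B x)) - ip ?j' (\<lambda>x. cross3 (du x) (B x))"
      unfolding dj_def by (rule l2_inner_diff_left[OF jL cL[OF duV m(3)]])
    moreover have "ip ?j' (\<lambda>x. cross3 (du x) (dB x)) = ip ?j' (\<lambda>x. cross3 (du x) (B x)) - ip ?j' (\<lambda>x. cross3 (du x) (B' x))"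
      unfolding dB_def Cross3.right_diff_distrib by (rule l2_inner_diff_right[OF cL[OF duV m(3)] cL[OF duV m(7)] jL(2)])
    ultimately show ?thesis by simp
  qed
  have ohm: "S * ip dj dE = 0"
  proof -
    have "S * ip ?j dE = \<alpha> * ip B (weak_curl \<Omega> dE)" "S * ip ?j' dE = \<alpha> * ip B' (weak_curl \<Omega> dE)"
      using sol sol' dEN by (auto simp: solution_iff)
    moreover have "ae_eq \<Omega> (weak_curl \<Omega> dE) (\<lambda>x. 0)"
    proof -
      have "ae_eq \<Omega> (weak_curl \<Omega> dE) (\<lambda>x. weak_curl \<Omega> E x - weak_curl \<Omega> E' x)"
        unfolding dE_def by (rule ae_linear_diff[OF N(1) curl_linear m(2,6)])
      also have "ae_eq \<Omega> \<dots> (\<lambda>x. 0 - 0)"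
        by (rule ae_eq_comp2[OF solution_curl_zero[OF sol] solution_curl_zero[OF sol']])
      finally show ?thesis by simp
    qed
    then have "ip (weak_curl \<Omega> dE) B = 0" "ip (weak_curl \<Omega> dE) B' = 0"
      using m dEN by (auto intro: ae_zero_inner curl_L2' D_L2)
    ultimately have "S * ip ?j dE = 0" "S * ip ?j' dE = 0"
      by (simp_all add: l2_inner_commute[of \<Omega> _ "weak_curl \<Omega> dE"])
    then have "S * ip ?j dE - S * ip ?j' dE = 0" by linarith
    then show ?thesis
      unfolding dj_def l2_inner_diff_left[OF jL N_L2[OF dEN]] right_diff_distrib .
  qed
  have jj: "(nrm dj)\<^sup>2 = ip dj dE + ip dj (\<lambda>x. cross3 (du x) (B x)) + ip dj (\<lambda>x. cross3 (u' x) (dB x))"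
  proof -
    have "dj = (\<lambda>x. dE x + cross3 (du x) (B x) + cross3 (u' x) (dB x))"
      by (simp add: dj_def current_diff dE_def du_def dB_def)
    then have "ip dj dj = ip dj (\<lambda>x. dE x + cross3 (du x) (B x) + cross3 (u' x) (dB x))" by simp
    then show ?thesis
      by (simp add: l2_norm_square l2_inner_add_right[OF L2_add[OF N_L2[OF dEN] cL[OF duV m(3)]] cL[OF m(5) dBD] djL]
          l2_inner_add_right[OF N_L2[OF dEN] cL[OF duV m(3)] djL])
  qed
  have "1 / R\<^sub>e * (nrm (jac du))\<^sup>2 + S * ip dj (\<lambda>x. cross3 (du x) (B x))
      = - trilinear \<Omega> du u du - S * ip ?j' (\<lambda>x. cross3 (du x) (dB x))"
    using eq1 eq1' divdu[OF m(4)] divdu[OF m(8)] unfolding tri[symmetric] jacd[symmetric]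
    using arg_cong[OF lor, of "\<lambda>z. S * z"] by (simp add: algebra_simps)
  then show ?thesis
    using ohm unfolding jj by (simp add: algebra_simps)
qed

text \<open>By the energy bounds and \<open>magnetic_bound\<close> every term on the right of the difference identity is at
  most a constant times \<open>\<epsilon> (\<parallel>\<nabla>\<delta>u\<parallel>\<^sup>2 +
  \<parallel>\<delta>j\<parallel>\<^sup>2)\<close>.\<close>

lemma small_data_uniqueness:
  "\<exists>\<epsilon>>0. \<forall>f u E B p r u' E' B' p' r'.
     (\<forall>v\<in>V. f v \<le> \<epsilon> * nrm (jac v)) \<longrightarrow> solution f u E B p r \<longrightarrow> solution f u' E' B' p' r' \<longrightarrow>
     ae_eq \<Omega> u u' \<and> ae_eq \<Omega> E E' \<and> ae_eq \<Omega> B B' \<and> ae_eq \<Omega> p p' \<and> ae_eq \<Omega> r r'"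
proof -
  obtain P K where PK: "0 \<le> P" "0 \<le> K" "\<And>u. u \<in> V \<Longrightarrow> nrm u \<le> P * nrm (jac u)"
    "\<And>u. u \<in> V \<Longrightarrow> AE x in lebesgue_on \<Omega>. norm (u x) \<le> K * nrm (jac u)"
    by (rule velocity_bounds) (rule that)
  obtain A C where A: "0 \<le> C" "\<And>B. B \<in> D\<^sub>0 \<Longrightarrow> A B \<in> N" "\<And>B. B \<in> D\<^sub>0 \<Longrightarrow> ae_eq \<Omega> (weak_curl \<Omega> (A B)) B"
    "\<And>B. B \<in> D\<^sub>0 \<Longrightarrow> nrm (A B) \<le> C * nrm B" "ae_linear \<Omega> D\<^sub>0 A"
    by (rule curl_lift) (rule that)
  \<comment> \<open>\<open>cB\<close> bounds \<open>\<delta>B\<close> by \<open>\<delta>j\<close>, and \<open>cj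
    \<epsilon>\<close> bounds the current of a solution; \<open>m\<close> is the coercivity constant of
    the left side of the difference identity, and \<open>M \<epsilon>\<close> bounds its right side.\<close>
  define cB where "cB = R\<^sub>m * C"
  define cj where "cj = sqrt (R\<^sub>e / S)"
  define m where "m = min (1 / R\<^sub>e) S"
  define M where "M = K * P * R\<^sub>e + S * K * R\<^sub>e * cB + S * cj * K * cB"
  define \<epsilon> where "\<epsilon> = m / (2 * (M + 1))"
  have nn: "0 \<le> cB" "0 \<le> cj" "0 < m" "0 \<le> M"
    using Rm_pos Re_pos S_pos A(1) PK(1,2) by (auto simp: cB_def cj_def m_def M_def)
  have \<epsilon>: "0 < \<epsilon>" "M * \<epsilon> < m"
  proof -
    show "0 < \<epsilon>" using nn by (simp add: \<epsilon>_def)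
    have "0 \<le> M * m" using nn by simp
    then have "M * m < m * (2 * (M + 1))" using nn(3) by (simp add: algebra_simps)
    then show "M * \<epsilon> < m" using nn by (simp add: \<epsilon>_def pos_divide_less_eq)
  qed
  show ?thesis
  proof (intro exI[of _ \<epsilon>] conjI allI impI \<epsilon>(1))
    fix f u E B p r u' E' B' p' r'
    assume f: "\<forall>v\<in>V. f v \<le> \<epsilon> * nrm (jac v)" and sol: "solution f u E B p r" and sol': "solution f u' E' B' p' r'"
    define du dB dj where "du = (\<lambda>x. u x - u' x)" and "dB = (\<lambda>x. B x - B' x)"
      and "dj = (\<lambda>x. current E u B x - current E' u' B' x)"
    let ?j = "current E u B" and ?j' = "current E' u' B'"
    have mem: "u \<in> V" "E \<in> N" "B \<in> D" "p \<in> Q" "u' \<in> V" "E' \<in> N" "B' \<in> D" "p' \<in> Q"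
      using sol sol' by (auto simp: solution_iff)
    have mr: "r \<in> W" "r' \<in> W" using sol sol' by (auto simp: solution_iff)
    have duV: "du \<in> V" unfolding du_def by (rule linear_space_diff[OF V(1) mem(1,5)])
    have dBD: "dB \<in> D\<^sub>0" unfolding dB_def
      by (rule linear_space_diff[OF D\<^sub>0_linear solution_div_zero[OF sol] solution_div_zero[OF sol']])
    then have dBL: "dB \<in> L2 \<Omega>" using D\<^sub>0_subset D_L2 by blast
    have jL: "?j \<in> L2 \<Omega>" "?j' \<in> L2 \<Omega>" using mem by (auto intro: current_L2)
    have djL: "dj \<in> L2 \<Omega>" unfolding dj_def by (rule L2_diff[OF jL])
    let ?d = "nrm (jac du)" and ?y = "nrm dj" and ?b = "nrm dB"
    have a: "nrm (jac u) \<le> R\<^sub>e * \<epsilon>" "nrm (jac u') \<le> R\<^sub>e * \<epsilon>" "nrm ?j' \<le> cj * \<epsilon>"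
      using energy_bounds[OF sol] energy_bounds[OF sol'] f mem \<epsilon>(1) by (auto simp: cj_def)
    have b: "?b \<le> cB * ?y"
      unfolding cB_def
    proof (rule magnetic_bound[OF A(1) A(2) A(3) A(4) dBD djL])
      fix F assume F: "F \<in> N"
      have "S * ip ?j F = \<alpha> * ip B (weak_curl \<Omega> F)" "S * ip ?j' F = \<alpha> * ip B' (weak_curl \<Omega> F)"
        using sol sol' F by (auto simp: solution_iff)
      then show "S * ip dj F = \<alpha> * ip dB (weak_curl \<Omega> F)"
        unfolding dj_def dB_def
        using l2_inner_diff_left[OF jL N_L2[OF F]] l2_inner_diff_left[OF D_L2[OF mem(3)] D_L2[OF mem(7)] curl_L2'[OF F]]
        by (simp add: right_diff_distrib)
    qed
    have t1: "- trilinear \<Omega> du u du \<le> (K * P * R\<^sub>e * \<epsilon>) * ?d\<^sup>2"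
    proof -
      have "\<bar>trilinear \<Omega> du u du\<bar> \<le> (K * ?d) * (nrm (jac u) * nrm du + ?d * nrm u) / 2"
        using PK(2) by (intro trilinear_bound duV mem PK(4)) auto
      also have "\<dots> \<le> (K * ?d) * (nrm (jac u) * (P * ?d) + ?d * (P * nrm (jac u))) / 2"
        using PK duV mem by (intro divide_right_mono mult_left_mono add_mono) auto
      also have "\<dots> = (K * P * ?d\<^sup>2) * nrm (jac u)"
        by (simp add: power2_eq_square algebra_simps)
      also have "\<dots> \<le> (K * P * ?d\<^sup>2) * (R\<^sub>e * \<epsilon>)"
        using PK a by (intro mult_left_mono) auto
      finally show ?thesis by (simp add: algebra_simps abs_le_iff)
    qed
    have t2: "S * ip dj (\<lambda>x. cross3 (u' x) (dB x)) \<le> (S * K * R\<^sub>e * cB * \<epsilon>) * ?y\<^sup>2"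
    proof -
      have "ip dj (\<lambda>x. cross3 (u' x) (dB x)) \<le> ?y * nrm (\<lambda>x. cross3 (u' x) (dB x))"
        using l2_Cauchy_Schwarz[OF djL ess_bounded_imp_L2[OF cross_bounded[OF V_bounded[OF mem(5)] D_bounded[of dB]]]] dBD D\<^sub>0_subset
        by fastforce
      also have "\<dots> \<le> ?y * ((K * nrm (jac u')) * ?b)"
        using PK by (intro mult_left_mono cross_norm_le[OF dBL L2_measurable[OF V_L2[OF mem(5)]] _ PK(4)[OF mem(5)]]) auto
      also have "\<dots> \<le> ?y * ((K * (R\<^sub>e * \<epsilon>)) * (cB * ?y))"
        using PK a b nn Re_pos \<epsilon> by (intro mult_left_mono mult_mono) auto
      finally have "S * ip dj (\<lambda>x. cross3 (u' x) (dB x)) \<le> S * (?y * ((K * (R\<^sub>e * \<epsilon>)) * (cB * ?y)))"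
        using S_pos by (intro mult_left_mono) auto
      then show ?thesis by (simp add: power2_eq_square mult_ac)
    qed
    have t3: "- (S * ip ?j' (\<lambda>x. cross3 (du x) (dB x))) \<le> (S * cj * K * cB * \<epsilon>) * (?d * ?y)"
    proof -
      have "- ip ?j' (\<lambda>x. cross3 (du x) (dB x)) \<le> nrm ?j' * nrm (\<lambda>x. cross3 (du x) (dB x))"
        using l2_Cauchy_Schwarz[OF jL(2) ess_bounded_imp_L2[OF cross_bounded[OF V_bounded[OF duV] D_bounded[of dB]]]] dBD D\<^sub>0_subset
        by fastforce
      also have "\<dots> \<le> nrm ?j' * ((K * ?d) * ?b)"
        using PK by (intro mult_left_mono cross_norm_le[OF dBL L2_measurable[OF V_L2[OF duV]] _ PK(4)[OF duV]]) auto
      also have "\<dots> \<le> (cj * \<epsilon>) * ((K * ?d) * (cB * ?y))"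
        using PK a b nn \<epsilon> by (intro mult_left_mono mult_mono) auto
      finally have "S * (- ip ?j' (\<lambda>x. cross3 (du x) (dB x))) \<le> S * ((cj * \<epsilon>) * ((K * ?d) * (cB * ?y)))"
        using S_pos by (intro mult_left_mono) auto
      then show ?thesis by (simp add: mult_ac)
    qed
    have dy: "?d * ?y \<le> ?d\<^sup>2 + ?y\<^sup>2"
    proof -
      have "2 * (?d * ?y) \<le> ?d\<^sup>2 + ?y\<^sup>2" using sum_squares_bound[of ?d ?y] by (simp add: mult.assoc)
      moreover have "0 \<le> ?d * ?y" by simp
      ultimately show ?thesis by linarith
    qed
    have "m * (?d\<^sup>2 + ?y\<^sup>2) \<le> 1 / R\<^sub>e * ?d\<^sup>2 + S * ?y\<^sup>2"
      unfolding distrib_left by (intro add_mono mult_right_mono) (auto simp: m_def)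
    also have "\<dots> \<le> (K * P * R\<^sub>e * \<epsilon>) * ?d\<^sup>2 + (S * K * R\<^sub>e * cB * \<epsilon>) * ?y\<^sup>2 + (S * cj * K * cB * \<epsilon>) * (?d * ?y)"
      using solutions_difference_identity[OF sol sol'] t1 t2 t3 unfolding du_def dB_def dj_def by linarith
    also have "\<dots> \<le> (K * P * R\<^sub>e * \<epsilon>) * (?d\<^sup>2 + ?y\<^sup>2) + (S * K * R\<^sub>e * cB * \<epsilon>) * (?d\<^sup>2 + ?y\<^sup>2)
        + (S * cj * K * cB * \<epsilon>) * (?d\<^sup>2 + ?y\<^sup>2)"
      using PK nn Re_pos S_pos \<epsilon> dy by (intro add_mono mult_left_mono) auto
    also have "\<dots> = (M * \<epsilon>) * (?d\<^sup>2 + ?y\<^sup>2)"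
      by (simp add: M_def algebra_simps)
    finally have "(m - M * \<epsilon>) * (?d\<^sup>2 + ?y\<^sup>2) \<le> 0" by (simp add: left_diff_distrib)
    then have "?d\<^sup>2 + ?y\<^sup>2 \<le> 0"
      using \<epsilon>(2) by (simp add: mult_le_0_iff)
    then have zero: "?d = 0" "?y = 0" by (simp_all add: sum_power2_le_zero_iff)
    have "nrm du \<le> 0" using PK(3)[OF duV] zero by simp
    then have "nrm du = 0" using l2_norm_nonneg[of \<Omega> du] by linarith
    then have u0: "ae_eq \<Omega> u u'"
      using l2_norm_eq_0_iff[OF V_L2[OF duV]] by (simp add: du_def ae_eq_diff_zero)
    have "nrm dB = 0" using b zero l2_norm_nonneg[of \<Omega> dB] by simp
    then have B0: "ae_eq \<Omega> B B'"
      using l2_norm_eq_0_iff[OF dBL] by (simp add: dB_def ae_eq_diff_zero)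
    have j0: "ae_eq \<Omega> ?j ?j'"
      using l2_norm_eq_0_iff[OF djL] zero by (simp add: dj_def ae_eq_diff_zero)
    have E0: "ae_eq \<Omega> E E'"
    proof -
      have "ae_eq \<Omega> (\<lambda>x. ?j x - cross3 (u x) (B x)) (\<lambda>x. ?j' x - cross3 (u' x) (B' x))"
        by (rule ae_eq_comp2[OF j0 ae_eq_comp2[OF u0 B0]])
      then show ?thesis by (simp add: current_def)
    qed
    have r0: "ae_eq \<Omega> r r'"
      using solution_multiplier_zero[OF sol] solution_multiplier_zero[OF sol'] ae_eq_sym ae_eq_trans by blast
    have "ip (weak_div \<Omega> v) (\<lambda>x. p x - p' x) = 0" if v: "v \<in> V" for v
    proof -
      have 1: "trilinear \<Omega> u u v = trilinear \<Omega> u' u' v"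
        using ae_linear_form_cong[OF V(1) trilinear_form_left[OF mem(1) v] mem(1,5) u0]
          ae_linear_form_cong[OF V(1) trilinear_form_middle[OF mem(5) v] mem(1,5) u0] by simp
      have 2: "ip (jac u) (jac v) = ip (jac u') (jac v)"
        using mem v by (intro l2_inner_cong ae_linear_cong[OF V(1) jac_linear] u0 jac_L2 ae_eq_refl)
      have 3: "ip ?j (\<lambda>x. cross3 (v x) (B x)) = ip ?j' (\<lambda>x. cross3 (v x) (B' x))"
        using mem v by (intro l2_inner_cong jL j0 ae_eq_comp2[OF ae_eq_refl B0] ess_bounded_imp_L2 cross_bounded V_bounded D_bounded)
      have "trilinear \<Omega> u u v + 1 / R\<^sub>e * ip (jac u) (jac v) + S * ip ?j (\<lambda>x. cross3 (v x) (B x)) - ip p (weak_div \<Omega> v) = f v"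
        "trilinear \<Omega> u' u' v + 1 / R\<^sub>e * ip (jac u') (jac v) + S * ip ?j' (\<lambda>x. cross3 (v x) (B' x)) - ip p' (weak_div \<Omega> v) = f v"
        using sol sol' v by (auto simp: solution_iff)
      then have "ip p (weak_div \<Omega> v) = ip p' (weak_div \<Omega> v)" using 1 2 3 by simp
      then show ?thesis
        by (simp add: l2_inner_diff_right[OF Q_L2[OF mem(4)] Q_L2[OF mem(8)] div_L2[OF v]] l2_inner_commute[of \<Omega> "weak_div \<Omega> v"])
    qed
    then have "ae_eq \<Omega> (\<lambda>x. p x - p' x) (\<lambda>x. 0)"
      by (intro inf_sup linear_space_diff[OF Q(1) mem(4,8)])
    then have p0: "ae_eq \<Omega> p p'" by (simp add: ae_eq_diff_zero)
    show "ae_eq \<Omega> u u'" "ae_eq \<Omega> E E'" "ae_eq \<Omega> B B'" "ae_eq \<Omega> p p'" "ae_eq \<Omega> r r'"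
      by (fact u0 E0 B0 p0 r0)+
  qed
qed

end

section \<open>Existence\<close>

lemma L2_Pair: "\<lbrakk>f \<in> L2 \<Omega>; g \<in> L2 \<Omega>\<rbrakk> \<Longrightarrow> (\<lambda>x. (f x, g x)) \<in> L2 \<Omega>"
  for f :: "real^3 \<Rightarrow> 'a::euclidean_space" and g :: "real^3 \<Rightarrow> 'b::euclidean_space"
proof -
  assume fg: "f \<in> L2 \<Omega>" "g \<in> L2 \<Omega>"
  have "bounded_linear (\<lambda>y::'a. (y, 0::'b))" "bounded_linear (\<lambda>y::'b. (0::'a, y))"
    by (intro bounded_linear_Pair bounded_linear_ident bounded_linear_zero)+
  from L2_add[OF L2_bounded_linear[OF this(1) fg(1)] L2_bounded_linear[OF this(2) fg(2)]]
  show ?thesis by simp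
qed

lemma l2_norm_Pair:
  fixes f :: "real^3 \<Rightarrow> 'a::euclidean_space" and g :: "real^3 \<Rightarrow> 'b::euclidean_space"
  assumes "f \<in> L2 \<Omega>" "g \<in> L2 \<Omega>"
  shows "(l2_norm \<Omega> (\<lambda>x. (f x, g x)))\<^sup>2 = (l2_norm \<Omega> f)\<^sup>2 + (l2_norm \<Omega> g)\<^sup>2"
  using assms unfolding l2_norm_square by (simp add: l2_inner_def L2_inner_integrable)

text \<open>The unknowns are combined into one function with values in a product, so that a single orthonormal basis serves
  the whole system.\<close>

definition pair_space :: "('a \<Rightarrow> 'b) set \<Rightarrow> ('a \<Rightarrow> 'c) set \<Rightarrow> ('a \<Rightarrow> 'b \<times> 'c) set" where
  "pair_space X Y = {w. (\<lambda>x. fst (w x)) \<in> X \<and> (\<lambda>x. snd (w x)) \<in> Y}"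

lemma pair_space_Pair [simp]: "(\<lambda>x. (f x, g x)) \<in> pair_space X Y \<longleftrightarrow> f \<in> X \<and> g \<in> Y"
  by (simp add: pair_space_def)

lemma linear_space_pair_space:
  assumes X: "linear_space X" and Y: "linear_space Y" shows "linear_space (pair_space X Y)"
proof (rule linear_spaceI)
  show "(\<lambda>x. 0) \<in> pair_space X Y"
    using linear_space_zero[OF X] linear_space_zero[OF Y] by (simp add: pair_space_def)
  fix u v c assume "u \<in> pair_space X Y" "v \<in> pair_space X Y"
  then show "(\<lambda>x. u x + c *\<^sub>R v x) \<in> pair_space X Y"
    unfolding pair_space_def
    by (simp add: linear_space_add[OF X] linear_space_scale[OF X] linear_space_add[OF Y] linear_space_scale[OF Y])
qed

lemma pair_space_L2:
  fixes X :: "(real^3 \<Rightarrow> 'a::euclidean_space) set" and Y :: "(real^3 \<Rightarrow> 'b::euclidean_space) set"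
  assumes "X \<subseteq> L2 \<Omega>" "Y \<subseteq> L2 \<Omega>" shows "pair_space X Y \<subseteq> L2 \<Omega>"
proof
  fix w assume "w \<in> pair_space X Y"
  then have "(\<lambda>x. fst (w x)) \<in> L2 \<Omega>" "(\<lambda>x. snd (w x)) \<in> L2 \<Omega>"
    using assms by (auto simp: pair_space_def)
  from L2_Pair[OF this] show "w \<in> L2 \<Omega>" by simp
qed

lemma ae_finite_dim_pair_space:
  fixes X :: "(real^3 \<Rightarrow> 'a::euclidean_space) set" and Y :: "(real^3 \<Rightarrow> 'b::euclidean_space) set"
  assumes "ae_finite_dim \<Omega> X" "ae_finite_dim \<Omega> Y" shows "ae_finite_dim \<Omega> (pair_space X Y)"
proof -
  obtain G where G: "finite G" "G \<subseteq> L2 \<Omega>" "\<And>f. f \<in> X \<Longrightarrow> \<exists>h\<in>lspan G. ae_eq \<Omega> f h"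
    using assms(1) unfolding ae_finite_dim_def by metis
  obtain H where H: "finite H" "H \<subseteq> L2 \<Omega>" "\<And>f. f \<in> Y \<Longrightarrow> \<exists>h\<in>lspan H. ae_eq \<Omega> f h"
    using assms(2) unfolding ae_finite_dim_def by metis
  define I where "I = (\<lambda>g x. (g x, 0::'b)) ` G \<union> (\<lambda>g x. (0::'a, g x)) ` H"
  have "finite I" using G H by (simp add: I_def)
  moreover have "I \<subseteq> L2 \<Omega>"
    using G(2) H(2) L2_Pair[OF _ L2_zero] L2_Pair[OF L2_zero] unfolding I_def by blast
  moreover have "\<exists>h\<in>lspan I. ae_eq \<Omega> w h" if w: "w \<in> pair_space X Y" for w
  proof -
    obtain h k where h: "h \<in> lspan G" "ae_eq \<Omega> (\<lambda>x. fst (w x)) h"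
      and k: "k \<in> lspan H" "ae_eq \<Omega> (\<lambda>x. snd (w x)) k"
      using w G(3) H(3) unfolding pair_space_def by blast
    have 1: "(\<lambda>x. (h x, 0)) \<in> lspan I"
      by (rule lspan_mono[OF lspan_image[OF h(1), of "\<lambda>x y. (y, 0)"]]) (auto simp: I_def intro: linearI)
    have 2: "(\<lambda>x. (0, k x)) \<in> lspan I"
      by (rule lspan_mono[OF lspan_image[OF k(1), of "\<lambda>x y. (0, y)"]]) (auto simp: I_def intro: linearI)
    have "ae_eq \<Omega> w (\<lambda>x. (h x, k x))"
      using ae_eq_comp2[OF h(2) k(2), of Pair] by simp
    then show ?thesis using lspan_add[OF 1 2] by (intro bexI[of _ "\<lambda>x. (h x, k x)"]) simp_all
  qed
  ultimately show ?thesis unfolding ae_finite_dim_def by blast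
qed

lemma ae_linear_bounded_linear:
  assumes h: "bounded_linear h" and T: "ae_linear \<Omega> X T" shows "ae_linear \<Omega> X (\<lambda>u x. h (T u x))"
  unfolding ae_linear_def
proof (intro ballI allI impI)
  fix u v w c assume "u \<in> X" "v \<in> X" "w \<in> X" "ae_eq \<Omega> w (\<lambda>x. u x + c *\<^sub>R v x)"
  then have "ae_eq \<Omega> (T w) (\<lambda>x. T u x + c *\<^sub>R T v x)" by (rule ae_linearD[OF T])
  from ae_eq_comp[OF this, of h]
  show "ae_eq \<Omega> (\<lambda>x. h (T w x)) (\<lambda>x. h (T u x) + c *\<^sub>R h (T v x))"
    by (simp add: linear_add[OF bounded_linear.linear[OF h]] linear_scale[OF bounded_linear.linear[OF h]])
qed

context mhd_spaces
begin

definition V\<^sub>0 :: "vector_field set" where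
  "V\<^sub>0 = {v \<in> V. \<forall>q\<in>Q. ip (weak_div \<Omega> v) q = 0}"

definition Z :: "vector_field set" where
  "Z = {E \<in> N. ae_eq \<Omega> (weak_curl \<Omega> E) (\<lambda>x. 0)}"

text \<open>The constraints that the multipliers and Faraday's law impose on a solution are built into the space.\<close>

definition trial_space :: "(real^3 \<Rightarrow> (real^3) \<times> (real^3) \<times> (real^3)) set" where
  "trial_space = pair_space V\<^sub>0 (pair_space Z D\<^sub>0)"

lemma div_form: "q \<in> Q \<Longrightarrow> ae_linear_form \<Omega> V (\<lambda>v. ip (weak_div \<Omega> v) q)"
  by (rule ae_linear_form_compose[OF ae_linear_form_l2_inner_left[OF Q_L2] div_linear_V div_L2])

lemma V\<^sub>0_linear: "linear_space V\<^sub>0"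
proof (rule linear_spaceI)
  show "(\<lambda>x. 0) \<in> V\<^sub>0"
    using linear_space_zero[OF V(1)] ae_linear_form_zero[OF V(1) div_form] by (simp add: V\<^sub>0_def)
  fix u v c assume uv: "u \<in> V\<^sub>0" "v \<in> V\<^sub>0"
  then have m: "(\<lambda>x. u x + c *\<^sub>R v x) \<in> V"
    by (intro linear_space_add[OF V(1)] linear_space_scale[OF V(1)]) (auto simp: V\<^sub>0_def)
  then show "(\<lambda>x. u x + c *\<^sub>R v x) \<in> V\<^sub>0"
    using uv ae_linear_formD[OF div_form _ _ m ae_eq_refl] by (auto simp: V\<^sub>0_def)
qed

lemma Z_linear: "linear_space Z"
  unfolding Z_def by (rule linear_space_ae_kernel[OF N(1) curl_linear])

lemma V\<^sub>0_subset: "V\<^sub>0 \<subseteq> V" and Z_subset: "Z \<subseteq> N"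
  by (auto simp: V\<^sub>0_def Z_def)

lemma trial_space_L2: "trial_space \<subseteq> L2 \<Omega>"
  unfolding trial_space_def
  by (intro pair_space_L2) (use V\<^sub>0_subset Z_subset D\<^sub>0_subset V_L2 N_L2 D_L2 in blast)+

lemma trial_space_linear: "linear_space trial_space"
  unfolding trial_space_def by (intro linear_space_pair_space V\<^sub>0_linear Z_linear D\<^sub>0_linear)

lemma trial_space_basis: obtains n e where "orthonormal_basis \<Omega> trial_space n e"
proof -
  have "ae_finite_dim \<Omega> trial_space"
    unfolding trial_space_def
    by (intro ae_finite_dim_pair_space ae_finite_dim_subset[OF V(3) V\<^sub>0_subset]
        ae_finite_dim_subset[OF N(3) Z_subset] ae_finite_dim_subset[OF D(3) D\<^sub>0_subset])
  then show ?thesis by (rule ae_finite_dim_orthonormal_basis[OF _ trial_space_linear trial_space_L2 that])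
qed

abbreviation vel :: "(real^3 \<Rightarrow> (real^3) \<times> (real^3) \<times> (real^3)) \<Rightarrow> vector_field" where "vel w \<equiv> (\<lambda>x. fst (w x))"
abbreviation elec :: "(real^3 \<Rightarrow> (real^3) \<times> (real^3) \<times> (real^3)) \<Rightarrow> vector_field" where "elec w \<equiv> (\<lambda>x. fst (snd (w x)))"
abbreviation magn :: "(real^3 \<Rightarrow> (real^3) \<times> (real^3) \<times> (real^3)) \<Rightarrow> vector_field" where "magn w \<equiv> (\<lambda>x. snd (snd (w x)))"

lemma trial_components:
  assumes "w \<in> trial_space"
  shows "vel w \<in> V\<^sub>0" "vel w \<in> V" "elec w \<in> Z" "elec w \<in> N" "magn w \<in> D\<^sub>0" "magn w \<in> D"
  using assms V\<^sub>0_subset Z_subset D\<^sub>0_subset by (auto simp: trial_space_def pair_space_def)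

lemma component_linear:
  "ae_linear \<Omega> trial_space vel" "ae_linear \<Omega> trial_space elec" "ae_linear \<Omega> trial_space magn"
  by (rule ae_linear_bounded_linear[OF _ ae_linear_ident, of "\<lambda>y. fst y"]
      ae_linear_bounded_linear[OF _ ae_linear_ident, of "\<lambda>y. fst (snd y)"]
      ae_linear_bounded_linear[OF _ ae_linear_ident, of "\<lambda>y. snd (snd y)"],
      intro bounded_linear_intros bounded_linear_fst bounded_linear_snd
        bounded_linear_compose[OF bounded_linear_fst bounded_linear_snd]
        bounded_linear_compose[OF bounded_linear_snd bounded_linear_snd])+

lemma inner_component_form:
  assumes "g \<in> L2 \<Omega>"
  shows "ae_linear_form \<Omega> trial_space (\<lambda>w. ip (elec w) g)" "ae_linear_form \<Omega> trial_space (\<lambda>w. ip (magn w) g)"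
  by (rule ae_linear_form_compose[OF ae_linear_form_l2_inner_left[OF assms]] component_linear
      N_L2 D_L2 trial_components | assumption)+

lemma cross_forms:
  assumes g: "g \<in> L2 \<Omega>" and a: "a \<in> ess_bounded \<Omega>"
  shows "ae_linear_form \<Omega> trial_space (\<lambda>w. ip (\<lambda>x. cross3 (vel w x) (a x)) g)"
    and "ae_linear_form \<Omega> trial_space (\<lambda>w. ip (\<lambda>x. cross3 (elec w x) (a x)) g)"
    and "ae_linear_form \<Omega> trial_space (\<lambda>w. ip (\<lambda>x. cross3 (a x) (magn w x)) g)"
  by (rule ae_linear_form_compose[OF ae_linear_form_l2_inner_left[OF g]]
      ae_linear_bilinear_left[OF bounded_bilinear_cross3] ae_linear_bilinear_right[OF bounded_bilinear_cross3]
      component_linear ess_bounded_imp_L2 cross_bounded a V_bounded N_bounded D_bounded trial_components | assumption)+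

lemma double_cross_form:
  assumes g: "g \<in> L2 \<Omega>" and b: "b \<in> ess_bounded \<Omega>" and a: "a \<in> ess_bounded \<Omega>"
  shows "ae_linear_form \<Omega> trial_space (\<lambda>w. ip (\<lambda>x. cross3 (cross3 (vel w x) (b x)) (a x)) g)"
    and "ae_linear_form \<Omega> trial_space (\<lambda>w. ip (\<lambda>x. cross3 (cross3 (b x) (magn w x)) (a x)) g)"
  by (rule ae_linear_form_compose[OF ae_linear_form_l2_inner_left[OF g]]
      ae_linear_bilinear_left[OF bounded_bilinear_cross3] ae_linear_bilinear_right[OF bounded_bilinear_cross3]
      component_linear ess_bounded_imp_L2 cross_bounded a b V_bounded N_bounded D_bounded trial_components | assumption)+

lemma cont_cross:
  assumes g: "g \<in> L2 \<Omega>"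
  shows "coord_continuous trial_space (\<lambda>w. ip (\<lambda>x. cross3 (vel w x) (magn w x)) g)"
    and "coord_continuous trial_space (\<lambda>w. ip (\<lambda>x. cross3 (elec w x) (magn w x)) g)"
proof -
  show "coord_continuous trial_space (\<lambda>w. ip (\<lambda>x. cross3 (vel w x) (magn w x)) g)"
  proof (rule coord_continuous_bilinear[OF trial_space_linear, where b = "\<lambda>u w. ip (\<lambda>x. cross3 (vel u x) (magn w x)) g"])
    fix w assume w: "w \<in> trial_space"
    show "ae_linear_form \<Omega> trial_space (\<lambda>u. ip (\<lambda>x. cross3 (vel u x) (magn w x)) g)"
      by (rule cross_forms(1)[OF g D_bounded[OF trial_components(6)[OF w]]])
    show "coord_continuous trial_space (\<lambda>u. ip (\<lambda>x. cross3 (vel w x) (magn u x)) g)"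
      by (rule coord_continuous_linear[OF trial_space_linear cross_forms(3)[OF g V_bounded[OF trial_components(2)[OF w]]]])
  qed
  show "coord_continuous trial_space (\<lambda>w. ip (\<lambda>x. cross3 (elec w x) (magn w x)) g)"
  proof (rule coord_continuous_bilinear[OF trial_space_linear, where b = "\<lambda>u w. ip (\<lambda>x. cross3 (elec u x) (magn w x)) g"])
    fix w assume w: "w \<in> trial_space"
    show "ae_linear_form \<Omega> trial_space (\<lambda>u. ip (\<lambda>x. cross3 (elec u x) (magn w x)) g)"
      by (rule cross_forms(2)[OF g D_bounded[OF trial_components(6)[OF w]]])
    show "coord_continuous trial_space (\<lambda>u. ip (\<lambda>x. cross3 (elec w x) (magn u x)) g)"
      by (rule coord_continuous_linear[OF trial_space_linear cross_forms(3)[OF g N_bounded[OF trial_components(4)[OF w]]]])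
  qed
qed

lemma cont_double_cross:
  assumes g: "g \<in> L2 \<Omega>"
  shows "coord_continuous trial_space (\<lambda>w. ip (\<lambda>x. cross3 (cross3 (vel w x) (magn w x)) (magn w x)) g)"
proof (rule coord_continuous_bilinear[OF trial_space_linear,
      where b = "\<lambda>u w. ip (\<lambda>x. cross3 (cross3 (vel u x) (magn w x)) (magn w x)) g"])
  fix w assume w: "w \<in> trial_space"
  note B = D_bounded[OF trial_components(6)[OF w]] and U = V_bounded[OF trial_components(2)[OF w]]
  show "ae_linear_form \<Omega> trial_space (\<lambda>u. ip (\<lambda>x. cross3 (cross3 (vel u x) (magn w x)) (magn w x)) g)"
    by (rule double_cross_form(1)[OF g B B])
  show "coord_continuous trial_space (\<lambda>u. ip (\<lambda>x. cross3 (cross3 (vel w x) (magn u x)) (magn u x)) g)"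
  proof (rule coord_continuous_bilinear[OF trial_space_linear,
        where b = "\<lambda>u z. ip (\<lambda>x. cross3 (cross3 (vel w x) (magn u x)) (magn z x)) g"])
    fix z assume z: "z \<in> trial_space"
    note B = D_bounded[OF trial_components(6)[OF z]]
    show "ae_linear_form \<Omega> trial_space (\<lambda>u. ip (\<lambda>x. cross3 (cross3 (vel w x) (magn u x)) (magn z x)) g)"
      by (rule double_cross_form(2)[OF g U B])
    show "coord_continuous trial_space (\<lambda>u. ip (\<lambda>x. cross3 (cross3 (vel w x) (magn z x)) (magn u x)) g)"
      by (rule coord_continuous_linear[OF trial_space_linear cross_forms(3)[OF g cross_bounded[OF U B]]])
  qed
qed

lemma current_inner:
  assumes w: "w \<in> trial_space" and g: "g \<in> L2 \<Omega>"
  shows "ip (current (elec w) (vel w) (magn w)) g = ip (elec w) g + ip (\<lambda>x. cross3 (vel w x) (magn w x)) g"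
  unfolding current_def
  by (intro l2_inner_add_left g N_L2 ess_bounded_imp_L2 cross_bounded V_bounded D_bounded trial_components w)

text \<open>Expanded with \<open>j = E + u \<times> B\<close>, the Lorentz term is a sum of diagonals of multilinear forms,
  to which \<open>coord_continuous_bilinear\<close> applies.\<close>

lemma lorentz_inner:
  assumes w: "w \<in> trial_space" and v: "v \<in> V"
  shows "ip (current (elec w) (vel w) (magn w)) (\<lambda>x. cross3 (v x) (magn w x))
    = - (ip (\<lambda>x. cross3 (elec w x) (magn w x)) v + ip (\<lambda>x. cross3 (cross3 (vel w x) (magn w x)) (magn w x)) v)"
proof -
  have "ip (\<lambda>x. cross3 (current (elec w) (vel w) (magn w) x) (magn w x)) v
      = ip (\<lambda>x. cross3 (elec w x) (magn w x)) v + ip (\<lambda>x. cross3 (cross3 (vel w x) (magn w x)) (magn w x)) v"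
    unfolding current_def cross_add_left
    by (intro l2_inner_add_left V_L2 v ess_bounded_imp_L2 cross_bounded V_bounded N_bounded D_bounded trial_components w)
  then show ?thesis unfolding lorentz_swap by simp
qed

lemma coord_continuous_cong:
  fixes X :: "(real^3 \<Rightarrow> 'b::euclidean_space) set"
  assumes X: "linear_space X" and \<phi>: "coord_continuous X \<phi>" and eq: "\<And>w. w \<in> X \<Longrightarrow> \<psi> w = \<phi> w"
  shows "coord_continuous X \<psi>"
  unfolding coord_continuous_def
proof (intro allI impI)
  fix n :: nat and e :: "nat \<Rightarrow> real^3 \<Rightarrow> 'b" assume e: "\<forall>i<n. e i \<in> X"
  have "\<psi> (\<lambda>x. \<Sum>i<n. c i *\<^sub>R e i x) = \<phi> (\<lambda>x. \<Sum>i<n. c i *\<^sub>R e i x)" for c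
    using e by (intro eq linear_space_lincomb[OF X]) auto
  with \<phi> e show "continuous_on UNIV (\<lambda>c. \<psi> (\<lambda>x. \<Sum>i<n. c i *\<^sub>R e i x))"
    unfolding coord_continuous_def by simp
qed

text \<open>The residual of the momentum equation without the pressure.\<close>

definition momentum :: "(vector_field \<Rightarrow> real) \<Rightarrow> vector_field \<Rightarrow> vector_field \<Rightarrow> vector_field \<Rightarrow> vector_field \<Rightarrow> real" where
  "momentum f u E B v = trilinear \<Omega> u u v + 1 / R\<^sub>e * ip (jac u) (jac v)
     + S * ip (current E u B) (\<lambda>x. cross3 (v x) (B x)) - f v"

lemma momentum_form:
  assumes f: "ae_linear_form \<Omega> V f" and u: "u \<in> V" "E \<in> N" "B \<in> D"
  shows "ae_linear_form \<Omega> V (momentum f u E B)"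
proof -
  have 1: "ae_linear_form \<Omega> V (\<lambda>v. ip (jac u) (jac v))"
    by (rule ae_linear_form_compose[OF ae_linear_form_l2_inner_right[OF jac_L2[OF u(1)]] jac_linear jac_L2])
  have 2: "ae_linear_form \<Omega> V (\<lambda>v. ip (current E u B) (\<lambda>x. cross3 (v x) (B x)))"
    by (rule ae_linear_form_compose[OF ae_linear_form_l2_inner_right[OF current_L2[OF u(2,1,3)]]
          ae_linear_bilinear_left[OF bounded_bilinear_cross3 ae_linear_ident]])
       (intro ess_bounded_imp_L2 cross_bounded V_bounded D_bounded u)
  show ?thesis
    unfolding momentum_def[abs_def]
    by (intro ae_linear_form_plus ae_linear_form_minus ae_linear_form_mult trilinear_form_right f u 1 2)
qed

lemma cont_momentum:
  assumes v: "v \<in> V"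
  shows "coord_continuous trial_space (\<lambda>w. momentum f (vel w) (elec w) (magn w) v)"
proof (rule coord_continuous_cong[OF trial_space_linear])
  have 1: "coord_continuous trial_space (\<lambda>w. trilinear \<Omega> (vel w) (vel w) v)"
  proof (rule coord_continuous_bilinear[OF trial_space_linear, where b = "\<lambda>u w. trilinear \<Omega> (vel u) (vel w) v"])
    fix w assume w: "w \<in> trial_space"
    note U = trial_components(2)
    show "ae_linear_form \<Omega> trial_space (\<lambda>u. trilinear \<Omega> (vel u) (vel w) v)"
      by (rule ae_linear_form_compose[OF trilinear_form_left[OF U[OF w] v] component_linear(1) U])
    show "coord_continuous trial_space (\<lambda>u. trilinear \<Omega> (vel w) (vel u) v)"
      by (rule coord_continuous_linear[OF trial_space_linear
            ae_linear_form_compose[OF trilinear_form_middle[OF U[OF w] v] component_linear(1) U]])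
  qed
  have 2: "coord_continuous trial_space (\<lambda>w. ip (jac (vel w)) (jac v))"
  proof (rule coord_continuous_linear[OF trial_space_linear])
    have "ae_linear_form \<Omega> V (\<lambda>u. ip (jac u) (jac v))"
      by (rule ae_linear_form_compose[OF ae_linear_form_l2_inner_left[OF jac_L2[OF v]] jac_linear jac_L2])
    then show "ae_linear_form \<Omega> trial_space (\<lambda>w. ip (jac (vel w)) (jac v))"
      by (rule ae_linear_form_compose[OF _ component_linear(1) trial_components(2)])
  qed
  show "coord_continuous trial_space (\<lambda>w. trilinear \<Omega> (vel w) (vel w) v + 1 / R\<^sub>e * ip (jac (vel w)) (jac v)
      + (- S) * (ip (\<lambda>x. cross3 (elec w x) (magn w x)) v
           + ip (\<lambda>x. cross3 (cross3 (vel w x) (magn w x)) (magn w x)) v) - f v)"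
    by (intro coord_continuous_add coord_continuous_diff coord_continuous_mult coord_continuous_const 1 2
        cont_cross(2) cont_double_cross V_L2 v)
qed (simp add: momentum_def lorentz_inner v algebra_simps)

lemma cont_current:
  assumes g: "g \<in> L2 \<Omega>"
  shows "coord_continuous trial_space (\<lambda>w. ip (current (elec w) (vel w) (magn w)) g)"
proof (rule coord_continuous_cong[OF trial_space_linear])
  show "coord_continuous trial_space (\<lambda>w. ip (elec w) g + ip (\<lambda>x. cross3 (vel w x) (magn w x)) g)"
    by (intro coord_continuous_add cont_cross(1) g coord_continuous_linear[OF trial_space_linear inner_component_form(1)])
qed (simp add: current_inner g)

text \<open>The energy identity controls \<open>\<nabla>u\<close> and \<open>j\<close> but not \<open>B\<close>. Adding
  \<open>\<kappa>\<close> times the equation for \<open>B\<close> contributes \<open>\<kappa> \<alpha>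
  \<parallel>B\<parallel>\<^sup>2\<close> and the mixed term \<open>\<kappa> S (j, A B)\<close>, which for small
  \<open>\<kappa>\<close> is absorbed by half of \<open>S \<parallel>j\<parallel>\<^sup>2\<close> and half of
  \<open>\<kappa> \<alpha> \<parallel>B\<parallel>\<^sup>2\<close>. The sum is positive as soon as one of
  \<open>\<nabla>u\<close>, \<open>j\<close>, \<open>B\<close> is large, and \<open>E = j - u \<times> B\<close>
  can be large only if one of these is.\<close>

lemma reduced_solution_exists:
  assumes f: "ae_linear_form \<Omega> V f" and M: "0 \<le> M" "\<And>v. v \<in> V \<Longrightarrow> f v \<le> M * nrm (jac v)"
    and C: "0 \<le> C" and A: "\<And>B. B \<in> D\<^sub>0 \<Longrightarrow> A B \<in> N" "\<And>B. B \<in> D\<^sub>0 \<Longrightarrow> nrm (A B) \<le> C * nrm B" "ae_linear \<Omega> D\<^sub>0 A"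
  shows "\<exists>u\<in>V\<^sub>0. \<exists>E\<in>Z. \<exists>B\<in>D\<^sub>0. (\<forall>v\<in>V\<^sub>0. momentum f u E B v = 0) \<and>
    (\<forall>F\<in>Z. ip (current E u B) F = 0) \<and> (\<forall>B'\<in>D\<^sub>0. \<alpha> * ip B B' = S * ip (current E u B) (A B'))"
proof -
  obtain P K where PK: "0 \<le> P" "0 \<le> K" "\<And>u. u \<in> V \<Longrightarrow> nrm u \<le> P * nrm (jac u)"
    "\<And>u. u \<in> V \<Longrightarrow> AE x in lebesgue_on \<Omega>. norm (u x) \<le> K * nrm (jac u)"
    by (rule velocity_bounds) (rule that)
  define \<kappa> where "\<kappa> = \<alpha> / (S * (C\<^sup>2 + 1))"
  have C1: "0 < C\<^sup>2 + 1" by (intro add_nonneg_pos) auto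
  have \<kappa>: "0 < \<kappa>" "\<kappa> * S * C\<^sup>2 \<le> \<alpha>"
  proof -
    show "0 < \<kappa>" unfolding \<kappa>_def by (intro divide_pos_pos mult_pos_pos \<alpha>_pos S_pos C1)
    have "\<kappa> * S * C\<^sup>2 = \<alpha> * (C\<^sup>2 / (C\<^sup>2 + 1))" using S_pos by (simp add: \<kappa>_def)
    also have "\<dots> \<le> \<alpha> * 1"
      using \<alpha>_pos C1 by (intro mult_left_mono) simp_all
    finally show "\<kappa> * S * C\<^sup>2 \<le> \<alpha>" by simp
  qed
  \<comment> \<open>Where the weighted energy is not positive, \<open>\<parallel>\<nabla>u\<parallel> \<le> R\<^sub>e
    M\<close>, \<open>\<parallel>j\<parallel>\<^sup>2 \<le> yy\<close> and
    \<open>\<parallel>B\<parallel>\<^sup>2 \<le> bb\<close>; the radius \<open>\<rho>\<close> exceeds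
    the norm of \<open>(u, E, B)\<close> that these bounds allow.\<close>
  define bb where "bb = 2 * R\<^sub>e * M\<^sup>2 / (\<kappa> * \<alpha>)"
  define yy where "yy = 2 * R\<^sub>e * M\<^sup>2 / S"
  define \<rho> where "\<rho> = sqrt (P\<^sup>2 * (R\<^sub>e * M)\<^sup>2 + (2 * yy + 2 * (K\<^sup>2 * (R\<^sub>e * M)\<^sup>2 * bb)) + bb + 1)"
  have nn: "0 \<le> bb" "0 \<le> yy" using Re_pos \<kappa>(1) \<alpha>_pos S_pos by (auto simp: bb_def yy_def)
  then have \<rho>: "0 < \<rho>" "\<rho>\<^sup>2 = P\<^sup>2 * (R\<^sub>e * M)\<^sup>2 + (2 * yy + 2 * (K\<^sup>2 * (R\<^sub>e * M)\<^sup>2 * bb)) + bb + 1"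
    unfolding \<rho>_def by (auto intro!: add_nonneg_pos)
  define T where "T w v = momentum f (vel w) (elec w) (magn w) (vel v)
      + S * ip (current (elec w) (vel w) (magn w)) (elec v)
      + \<kappa> * (\<alpha> * ip (magn w) (magn v) - S * ip (current (elec w) (vel w) (magn w)) (A (magn v)))" for w v
  obtain n e where ne: "orthonormal_basis \<Omega> trial_space n e" by (rule trial_space_basis)
  have curL: "current (elec w) (vel w) (magn w) \<in> L2 \<Omega>" if "w \<in> trial_space" for w
    by (intro current_L2 trial_components that)
  have "\<exists>w\<in>trial_space. \<forall>v\<in>trial_space. T w v = 0"
  proof (rule galerkin_solution[OF trial_space_linear trial_space_L2 ne \<rho>(1)])
    fix w assume w: "w \<in> trial_space"
    have 1: "ae_linear_form \<Omega> trial_space (\<lambda>v. momentum f (vel w) (elec w) (magn w) (vel v))"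
      by (rule ae_linear_form_compose[OF momentum_form[OF f trial_components(2,4,6)[OF w]] component_linear(1) trial_components(2)])
    have 2: "ae_linear_form \<Omega> trial_space (\<lambda>v. ip j (elec v))" "ae_linear_form \<Omega> trial_space (\<lambda>v. ip j (magn v))" if "j \<in> L2 \<Omega>" for j
      using inner_component_form[OF that] by (simp_all add: l2_inner_commute[of \<Omega> j])
    have "ae_linear_form \<Omega> D\<^sub>0 (\<lambda>B. ip (current (elec w) (vel w) (magn w)) (A B))"
      by (rule ae_linear_form_compose[OF ae_linear_form_l2_inner_right[OF curL[OF w]] A(3) N_L2[OF A(1)]])
    then have 3: "ae_linear_form \<Omega> trial_space (\<lambda>v. ip (current (elec w) (vel w) (magn w)) (A (magn v)))"
      by (rule ae_linear_form_compose[OF _ component_linear(3) trial_components(5)])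
    show "ae_linear_form \<Omega> trial_space (T w)"
      unfolding T_def[abs_def]
      by (intro ae_linear_form_plus ae_linear_form_minus ae_linear_form_mult 1 2 3 curL[OF w] D_L2 trial_components w)
  next
    fix v assume v: "v \<in> trial_space"
    show "coord_continuous trial_space (\<lambda>w. T w v)"
      unfolding T_def
      by (intro coord_continuous_add coord_continuous_diff coord_continuous_mult cont_momentum cont_current
          coord_continuous_linear[OF trial_space_linear inner_component_form(2)] N_L2 D_L2 A(1) trial_components v)
  next
    fix w assume w: "w \<in> trial_space" and norm_w: "nrm w = \<rho>"
    note m = trial_components[OF w]
    let ?j = "current (elec w) (vel w) (magn w)"
    let ?a = "nrm (jac (vel w))" and ?y = "nrm ?j" and ?b = "nrm (magn w)"
    have cross_L2: "(\<lambda>x. cross3 (vel w x) (magn w x)) \<in> L2 \<Omega>"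
      by (intro ess_bounded_imp_L2 cross_bounded V_bounded D_bounded m)
    have jj: "ip ?j ?j = ip ?j (elec w) + ip ?j (\<lambda>x. cross3 (vel w x) (magn w x))"
      by (subst (2) current_def) (rule l2_inner_add_right[OF N_L2[OF m(4)] cross_L2 curL[OF w]])
    have Tww: "T w w = 1 / R\<^sub>e * ?a\<^sup>2 + S * ?y\<^sup>2 - f (vel w) + \<kappa> * (\<alpha> * ?b\<^sup>2 - S * ip ?j (A (magn w)))"
      unfolding T_def momentum_def l2_norm_square jj by (simp add: algebra_simps)
    have cs: "\<kappa> * (S * ip ?j (A (magn w))) \<le> S / 2 * ?y\<^sup>2 + \<kappa> * \<alpha> / 2 * ?b\<^sup>2"
    proof -
      have "ip ?j (A (magn w)) \<le> ?y * nrm (A (magn w))"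
        using l2_Cauchy_Schwarz[OF curL[OF w] N_L2[OF A(1)[OF m(5)]]] by linarith
      also have "\<dots> \<le> ?y * (C * ?b)" using A(2)[OF m(5)] by (rule mult_left_mono) simp
      finally have "\<kappa> * (S * ip ?j (A (magn w))) \<le> \<kappa> * (S * (?y * (C * ?b)))"
        using \<kappa>(1) S_pos by (intro mult_left_mono) auto
      also have "\<dots> = S / 2 * (2 * ?y * (\<kappa> * C * ?b))" by simp
      also have "\<dots> \<le> S / 2 * (?y\<^sup>2 + (\<kappa> * C * ?b)\<^sup>2)"
        using S_pos by (intro mult_left_mono sum_squares_bound) auto
      also have "\<dots> = S / 2 * ?y\<^sup>2 + \<kappa> / 2 * (\<kappa> * S * C\<^sup>2) * ?b\<^sup>2"
        by (simp add: power2_eq_square algebra_simps)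
      also have "\<dots> \<le> S / 2 * ?y\<^sup>2 + \<kappa> / 2 * \<alpha> * ?b\<^sup>2"
        using \<kappa> by (intro add_left_mono mult_right_mono mult_left_mono) auto
      finally show ?thesis by simp
    qed
    show "0 < T w w"
    proof (rule ccontr)
      assume "\<not> 0 < T w w"
      then have le: "1 / R\<^sub>e * ?a\<^sup>2 + S / 2 * ?y\<^sup>2 + \<kappa> * \<alpha> / 2 * ?b\<^sup>2 \<le> M * ?a"
        using Tww cs M(2)[OF m(2)] by (simp add: algebra_simps)
      have pos: "0 \<le> 1 / R\<^sub>e * ?a\<^sup>2" "0 \<le> S / 2 * ?y\<^sup>2" "0 \<le> \<kappa> * \<alpha> / 2 * ?b\<^sup>2"
        using Re_pos S_pos \<kappa> \<alpha>_pos by auto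
      have "1 / R\<^sub>e * ?a\<^sup>2 \<le> M * ?a" using le pos by linarith
      then have "?a * ?a \<le> (R\<^sub>e * M) * ?a" using Re_pos by (simp add: field_simps power2_eq_square)
      then have a: "?a \<le> R\<^sub>e * M"
        using Re_pos M(1) by (cases "?a = 0") (simp_all add: mult_le_cancel_right order_less_le)
      have Ma: "M * ?a \<le> R\<^sub>e * M\<^sup>2" using mult_left_mono[OF a M(1)] by (simp add: power2_eq_square mult_ac)
      have "S / 2 * ?y\<^sup>2 \<le> R\<^sub>e * M\<^sup>2" using le pos Ma by linarith
      then have y: "?y\<^sup>2 \<le> yy" using S_pos by (simp add: yy_def field_simps)
      have "\<kappa> * \<alpha> / 2 * ?b\<^sup>2 \<le> R\<^sub>e * M\<^sup>2" using le pos Ma by linarith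
      then have b: "?b\<^sup>2 \<le> bb" using \<kappa>(1) \<alpha>_pos by (simp add: bb_def field_simps)
      have a2: "?a\<^sup>2 \<le> (R\<^sub>e * M)\<^sup>2" using a by (intro power_mono) auto
      have u: "(nrm (vel w))\<^sup>2 \<le> P\<^sup>2 * (R\<^sub>e * M)\<^sup>2"
      proof -
        have "(nrm (vel w))\<^sup>2 \<le> (P * ?a)\<^sup>2" using PK(3)[OF m(2)] by (intro power_mono) auto
        also have "\<dots> \<le> P\<^sup>2 * (R\<^sub>e * M)\<^sup>2" using a2 by (simp add: power_mult_distrib mult_left_mono)
        finally show ?thesis .
      qed
      have E: "(nrm (elec w))\<^sup>2 \<le> 2 * yy + 2 * (K\<^sup>2 * (R\<^sub>e * M)\<^sup>2 * bb)"
      proof -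
        let ?c = "nrm (\<lambda>x. cross3 (vel w x) (magn w x))"
        have "elec w = (\<lambda>x. ?j x - cross3 (vel w x) (magn w x))" by (simp add: current_def)
        then have "nrm (elec w) \<le> ?y + ?c" using l2_norm_diff_le[OF curL[OF w] cross_L2] by simp
        also have "\<dots> \<le> ?y + (K * ?a) * ?b"
          using PK(2) by (intro add_left_mono cross_norm_le[OF D_L2[OF m(6)] L2_measurable[OF V_L2[OF m(2)]] _ PK(4)[OF m(2)]]) auto
        finally have "(nrm (elec w))\<^sup>2 \<le> (?y + (K * ?a) * ?b)\<^sup>2" by (intro power_mono) auto
        also have "\<dots> \<le> 2 * ?y\<^sup>2 + 2 * ((K * ?a) * ?b)\<^sup>2"
          using sum_squares_bound[of ?y "(K * ?a) * ?b"] by (simp add: power2_sum)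
        also have "\<dots> = 2 * ?y\<^sup>2 + 2 * (K\<^sup>2 * ?a\<^sup>2 * ?b\<^sup>2)" by (simp add: power_mult_distrib)
        also have "\<dots> \<le> 2 * yy + 2 * (K\<^sup>2 * (R\<^sub>e * M)\<^sup>2 * bb)"
          using y a2 b by (intro add_mono mult_left_mono mult_mono) auto
        finally show ?thesis .
      qed
      have "(nrm w)\<^sup>2 = (nrm (vel w))\<^sup>2 + ((nrm (elec w))\<^sup>2 + ?b\<^sup>2)"
        using l2_norm_Pair[OF V_L2[OF m(2)] L2_Pair[OF N_L2[OF m(4)] D_L2[OF m(6)]]]
          l2_norm_Pair[OF N_L2[OF m(4)] D_L2[OF m(6)]] by simp
      then show False using u E b norm_w \<rho>(2) by simp
    qed
  qed
  then obtain w where w: "w \<in> trial_space" and T0: "\<And>v. v \<in> trial_space \<Longrightarrow> T w v = 0" by blast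
  note m = trial_components[OF w]
  let ?j = "current (elec w) (vel w) (magn w)"
  have z: "(\<lambda>x. 0) \<in> V\<^sub>0" "(\<lambda>x. 0) \<in> Z" "(\<lambda>x. 0) \<in> D\<^sub>0"
    using linear_space_zero[OF V\<^sub>0_linear] linear_space_zero[OF Z_linear] linear_space_zero[OF D\<^sub>0_linear] by auto
  have mom0: "momentum f (vel w) (elec w) (magn w) (\<lambda>x. 0) = 0"
    using ae_linear_form_zero[OF V(1) momentum_form[OF f m(2,4,6)] linear_space_zero[OF V(1)]] by simp
  have A0: "ip ?j (A (\<lambda>x. 0)) = 0"
    using ae_zero_inner[OF ae_linear_zero[OF D\<^sub>0_linear A(3) z(3) ae_eq_refl] N_L2[OF A(1)[OF z(3)]] curL[OF w]]
    by (simp add: l2_inner_commute[of \<Omega> ?j])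
  have split: "momentum f (vel w) (elec w) (magn w) v + S * ip ?j F
      + \<kappa> * (\<alpha> * ip (magn w) B' - S * ip ?j (A B')) = 0" if "v \<in> V\<^sub>0" "F \<in> Z" "B' \<in> D\<^sub>0" for v F B'
    using T0[of "\<lambda>x. (v x, F x, B' x)"] that by (simp add: T_def trial_space_def)
  show ?thesis
  proof (intro bexI[OF _ m(1)] bexI[OF _ m(3)] bexI[OF _ m(5)] conjI ballI)
    show "momentum f (vel w) (elec w) (magn w) v = 0" if "v \<in> V\<^sub>0" for v
      using split[OF that z(2,3)] A0 by simp
    show "ip ?j F = 0" if "F \<in> Z" for F
      using split[OF z(1) that z(3)] A0 mom0 S_pos by simp
    show "\<alpha> * ip (magn w) B' = S * ip ?j (A B')" if "B' \<in> D\<^sub>0" for B'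
      using split[OF z(1,2) that] mom0 \<kappa>(1) by simp
  qed
qed

text \<open>A test function \<open>F\<close> differs from \<open>A (\<nabla> \<times> F)\<close> by a curl-free field, so
  the two parts of the second equation that the reduced solution satisfies combine to the whole. The residual of
  the momentum equation vanishes on the discretely divergence-free velocities, hence is represented by a pressure.\<close>

lemma solution_exists:
  assumes f: "ae_linear_form \<Omega> V f" and M: "0 \<le> M" "\<And>v. v \<in> V \<Longrightarrow> f v \<le> M * nrm (jac v)"
  shows "\<exists>u E B p r. solution f u E B p r"
proof -
  obtain A C where A: "0 \<le> C" "\<And>B. B \<in> D\<^sub>0 \<Longrightarrow> A B \<in> N" "\<And>B. B \<in> D\<^sub>0 \<Longrightarrow> ae_eq \<Omega> (weak_curl \<Omega> (A B)) B"
    "\<And>B. B \<in> D\<^sub>0 \<Longrightarrow> nrm (A B) \<le> C * nrm B" "ae_linear \<Omega> D\<^sub>0 A"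
    by (rule curl_lift) (rule that)
  obtain u E B where uEB: "u \<in> V\<^sub>0" "E \<in> Z" "B \<in> D\<^sub>0" and mom: "\<forall>v\<in>V\<^sub>0. momentum f u E B v = 0"
    and ohm: "\<forall>F\<in>Z. ip (current E u B) F = 0" and mag: "\<forall>B'\<in>D\<^sub>0. \<alpha> * ip B B' = S * ip (current E u B) (A B')"
    using reduced_solution_exists[OF f M A(1,2,4,5)] by blast
  have m: "u \<in> V" "E \<in> N" "B \<in> D" using uEB V\<^sub>0_subset Z_subset D\<^sub>0_subset by auto
  have jL: "current E u B \<in> L2 \<Omega>" by (rule current_L2[OF m(2,1,3)])
  have QL: "Q \<subseteq> L2 \<Omega>" using Q_L2 by blast
  obtain n q where nq: "orthonormal_basis \<Omega> Q n q" by (rule ae_finite_dim_orthonormal_basis[OF Q(3,1) QL])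
  then have q: "\<And>k. k < n \<Longrightarrow> q k \<in> Q" by (simp add: orthonormal_basis_def)
  have "\<exists>c. \<forall>v\<in>V. momentum f u E B v = (\<Sum>k<n. c k * ip (weak_div \<Omega> v) (q k))"
  proof (rule linear_form_in_span[OF V(1) _ momentum_form[OF f m]])
    show "ae_linear_form \<Omega> V (\<lambda>v. ip (weak_div \<Omega> v) (q k))" if "k < n" for k
      by (rule div_form[OF q[OF that]])
    fix v assume v: "v \<in> V" and v0: "\<forall>k<n. ip (weak_div \<Omega> v) (q k) = 0"
    have "ip (weak_div \<Omega> v) s = 0" if s: "s \<in> Q" for s
    proof -
      have "ip s (weak_div \<Omega> v) = ip (\<lambda>x. \<Sum>k<n. ip s (q k) *\<^sub>R q k x) (weak_div \<Omega> v)"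
        using nq s q Q_L2 div_L2[OF v]
        by (intro l2_inner_cong L2_sum L2_scale) (auto simp: orthonormal_basis_def simp del: real_scaleR_def)
      also have "\<dots> = (\<Sum>k<n. ip s (q k) * ip (q k) (weak_div \<Omega> v))"
        using q Q_L2 div_L2[OF v] by (intro l2_inner_lincomb_left) auto
      also have "\<dots> = 0" using v0 by (simp add: l2_inner_commute[of \<Omega> _ "weak_div \<Omega> v"])
      finally show ?thesis by (simp add: l2_inner_commute[of \<Omega> s])
    qed
    then show "momentum f u E B v = 0" using mom v by (simp add: V\<^sub>0_def)
  qed
  then obtain c where c: "\<And>v. v \<in> V \<Longrightarrow> momentum f u E B v = (\<Sum>k<n. c k * ip (weak_div \<Omega> v) (q k))" by blast
  define p where "p = (\<lambda>x. \<Sum>k<n. c k *\<^sub>R q k x)"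
  have pQ: "p \<in> Q" unfolding p_def using q by (intro linear_space_lincomb[OF Q(1)]) auto
  have press: "momentum f u E B v = ip p (weak_div \<Omega> v)" if v: "v \<in> V" for v
    using q Q_L2 div_L2[OF v] unfolding p_def c[OF v]
    by (subst l2_inner_lincomb_left) (auto simp: l2_inner_commute[of \<Omega> "weak_div \<Omega> v"])
  have ohm_eq: "S * ip (current E u B) F = \<alpha> * ip B (weak_curl \<Omega> F)" if F: "F \<in> N" for F
  proof -
    let ?w = "weak_curl \<Omega> F"
    have w: "?w \<in> D\<^sub>0" by (rule curl_in_D\<^sub>0[OF F])
    have AN: "A ?w \<in> N" by (rule A(2)[OF w])
    have "ae_eq \<Omega> (weak_curl \<Omega> (\<lambda>x. F x - A ?w x)) (\<lambda>x. ?w x - weak_curl \<Omega> (A ?w) x)"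
      by (rule ae_linear_diff[OF N(1) curl_linear F AN])
    also have "ae_eq \<Omega> \<dots> (\<lambda>x. ?w x - ?w x)"
      by (rule ae_eq_comp2[OF ae_eq_refl A(3)[OF w]])
    finally have "(\<lambda>x. F x - A ?w x) \<in> Z"
      using linear_space_diff[OF N(1) F AN] by (simp add: Z_def)
    then have "ip (current E u B) F = ip (current E u B) (A ?w)"
      using ohm l2_inner_diff_right[OF N_L2[OF F] N_L2[OF AN] jL] by simp
    then show ?thesis using mag w by simp
  qed
  have "solution f u E B p (\<lambda>x. 0)"
    unfolding solution_iff
  proof (intro conjI ballI m pQ)
    show "(\<lambda>x. 0) \<in> W" by (rule linear_space_zero[OF W(1)])
    show "trilinear \<Omega> u u v + 1 / R\<^sub>e * ip (jac u) (jac v)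
        + S * ip (current E u B) (\<lambda>x. cross3 (v x) (B x)) - ip p (weak_div \<Omega> v) = f v" if "v \<in> V" for v
      using press[OF that] by (simp add: momentum_def)
    show "S * ip (current E u B) F = \<alpha> * ip B (weak_curl \<Omega> F)" if "F \<in> N" for F by (rule ohm_eq[OF that])
    show "\<alpha> * ip (weak_curl \<Omega> E) C' + ip (\<lambda>x. 0) (weak_div \<Omega> C') = 0" if "C' \<in> D" for C'
      using ae_zero_inner[OF _ curl_L2'[OF m(2)] D_L2[OF that]] uEB(2) by (simp add: Z_def)
    show "ip (weak_div \<Omega> u) q = 0" if "q \<in> Q" for q using uEB(1) that by (simp add: V\<^sub>0_def)
    show "ip (weak_div \<Omega> B) s = 0" if "s \<in> W" for s
      using ae_zero_inner[OF _ W_L2[OF div_in_W[OF m(3)]] W_L2[OF that]] uEB(3) by (simp add: D\<^sub>0_def)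
  qed
  then show ?thesis by blast
qed

end

section \<open>Functionals on \<open>H\<^sub>0\<^sup>1\<close> and inf-sup stability\<close>

context bounded_open
begin

lemma Hminus1D:
  assumes "f \<in> Hminus1 \<Omega>"
  shows "\<lbrakk>u \<in> H01_vec \<Omega>; v \<in> H01_vec \<Omega>\<rbrakk> \<Longrightarrow> f (\<lambda>x. u x + v x) = f u + f v"
    and "v \<in> H01_vec \<Omega> \<Longrightarrow> f (\<lambda>x. c *\<^sub>R v x) = c * f v"
    and "\<exists>M. \<forall>v\<in>H01_vec \<Omega>. \<bar>f v\<bar> \<le> M * l2_norm \<Omega> (weak_jacobian \<Omega> v)"
  using assms unfolding Hminus1_def mem_Collect_eq by blast+

text \<open>Boundedness by \<open>\<parallel>\<nabla>v\<parallel>\<close> makes the functional blind to null sets, since the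
  gradient of a function that vanishes almost everywhere vanishes almost everywhere.\<close>

lemma Hminus1_form:
  assumes f: "f \<in> Hminus1 \<Omega>" and X: "linear_space X" "X \<subseteq> H01_vec \<Omega>"
  shows "ae_linear_form \<Omega> X f"
  unfolding ae_linear_form_def
proof (intro ballI allI impI)
  fix u v w c assume uvw: "u \<in> X" "v \<in> X" "w \<in> X" and eq: "ae_eq \<Omega> w (\<lambda>x. u x + c *\<^sub>R v x)"
  have add: "f (\<lambda>x. a x + b x) = f a + f b" if "a \<in> X" "b \<in> X" for a b
    using that X(2) by (intro Hminus1D(1)[OF f]) auto
  have scale: "f (\<lambda>x. k *\<^sub>R a x) = k * f a" if "a \<in> X" for a k
    using that X(2) by (intro Hminus1D(2)[OF f]) auto
  obtain M where M: "\<And>v. v \<in> H01_vec \<Omega> \<Longrightarrow> \<bar>f v\<bar> \<le> M * l2_norm \<Omega> (weak_jacobian \<Omega> v)"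
    using Hminus1D(3)[OF f] by blast
  define z where "z = (\<lambda>x. u x + c *\<^sub>R v x)"
  define d where "d = (\<lambda>x. w x + (-1) *\<^sub>R z x)"
  have zX: "z \<in> X" unfolding z_def using uvw by (intro linear_space_add[OF X(1)] linear_space_scale[OF X(1)])
  have dX: "d \<in> X" unfolding d_def using uvw zX by (intro linear_space_add[OF X(1)] linear_space_scale[OF X(1)])
  have "ae_eq \<Omega> (\<lambda>x. w x - z x) (\<lambda>x. 0)"
    using eq unfolding ae_eq_diff_zero z_def .
  then have "ae_eq \<Omega> d (\<lambda>x. 0)" by (simp add: d_def)
  then have "ae_eq \<Omega> (weak_jacobian \<Omega> d) (\<lambda>x. 0)"
    by (rule ae_linear_zero[OF X(1) ae_linear_subset[OF ae_linear_weak_jacobian X(2)] dX])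
  then have "l2_norm \<Omega> (weak_jacobian \<Omega> d) = 0"
    using dX X(2) weak_jacobian_L2 by (subst l2_norm_eq_0_iff) auto
  then have "f d = 0" using M[of d] dX X(2) by auto
  moreover have "f d = f w - f z"
    using add[OF uvw(3) linear_space_scale[OF X(1) zX, of "-1"]] scale[OF zX, of "-1"] by (simp add: d_def)
  moreover have "f z = f u + c * f v"
    using add[OF uvw(1) linear_space_scale[OF X(1) uvw(2), of c]] scale[OF uvw(2), of c] by (simp add: z_def)
  ultimately show "f w = f u + c * f v" by simp
qed

lemma Hminus1_bound:
  assumes f: "f \<in> Hminus1 \<Omega>"
  shows "\<exists>M\<ge>0. \<forall>v\<in>H01_vec \<Omega>. f v \<le> M * l2_norm \<Omega> (weak_jacobian \<Omega> v)"
proof -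
  obtain M where M: "\<And>v. v \<in> H01_vec \<Omega> \<Longrightarrow> \<bar>f v\<bar> \<le> M * l2_norm \<Omega> (weak_jacobian \<Omega> v)"
    using Hminus1D(3)[OF f] by blast
  have "f v \<le> max M 0 * l2_norm \<Omega> (weak_jacobian \<Omega> v)" if "v \<in> H01_vec \<Omega>" for v
    using M[OF that] mult_right_mono[of M "max M 0" "l2_norm \<Omega> (weak_jacobian \<Omega> v)"] by simp
  then show ?thesis by (intro exI[of _ "max M 0"]) auto
qed

text \<open>The supremum is over quotients bounded by the continuity constant of \<open>f\<close>; for \<open>v = 0\<close>
  almost everywhere, which it excludes, both sides are zero.\<close>

lemma norm_Hminus1_bound:
  assumes f: "f \<in> Hminus1 \<Omega>" and v: "v \<in> H01_vec \<Omega>"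
  shows "f v \<le> norm_Hminus1 \<Omega> f * l2_norm \<Omega> (weak_jacobian \<Omega> v)"
proof -
  obtain M where M: "\<And>v. v \<in> H01_vec \<Omega> \<Longrightarrow> \<bar>f v\<bar> \<le> M * l2_norm \<Omega> (weak_jacobian \<Omega> v)"
    using Hminus1D(3)[OF f] by blast
  obtain C where C: "0 \<le> C" "\<And>v. v \<in> H01_vec \<Omega> \<Longrightarrow> l2_norm \<Omega> v \<le> C * l2_norm \<Omega> (weak_jacobian \<Omega> v)"
    using Poincare_H01_vec by blast
  have pos: "0 < l2_norm \<Omega> (weak_jacobian \<Omega> v)" if "v \<in> H01_vec \<Omega>" "\<not> ae_eq \<Omega> v (\<lambda>x. 0)" for v
  proof (rule ccontr)
    assume "\<not> 0 < l2_norm \<Omega> (weak_jacobian \<Omega> v)"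
    then have "l2_norm \<Omega> (weak_jacobian \<Omega> v) = 0"
      using l2_norm_nonneg[of \<Omega> "weak_jacobian \<Omega> v"] by linarith
    then have "l2_norm \<Omega> v = 0" using C(2)[OF that(1)] l2_norm_nonneg[of \<Omega> v] by simp
    then show False using that l2_norm_eq_0_iff[OF H01_vec_L2[OF that(1)]] by simp
  qed
  show ?thesis
  proof (cases "l2_norm \<Omega> (weak_jacobian \<Omega> v) = 0")
    case True
    then show ?thesis using M[OF v] by simp
  next
    case False
    then have p: "0 < l2_norm \<Omega> (weak_jacobian \<Omega> v)"
      using l2_norm_nonneg[of \<Omega> "weak_jacobian \<Omega> v"] by linarith
    have nz: "\<not> ae_eq \<Omega> v (\<lambda>x. 0)"
    proof
      assume "ae_eq \<Omega> v (\<lambda>x. 0)"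
      moreover have "ae_eq \<Omega> v (\<lambda>x. v x + 1 *\<^sub>R v x)"
        using \<open>ae_eq \<Omega> v (\<lambda>x. 0)\<close> by (auto simp: ae_eq_def elim: eventually_mono)
      then have "ae_eq \<Omega> (weak_jacobian \<Omega> v) (\<lambda>x. weak_jacobian \<Omega> v x + 1 *\<^sub>R weak_jacobian \<Omega> v x)"
        by (rule ae_linearD[OF ae_linear_weak_jacobian v v v])
      then have "ae_eq \<Omega> (weak_jacobian \<Omega> v) (\<lambda>x. 0)"
        by (auto simp: ae_eq_def elim: eventually_mono)
      then show False using False l2_norm_eq_0_iff[OF weak_jacobian_L2[OF v]] by simp
    qed
    have "f v / l2_norm \<Omega> (weak_jacobian \<Omega> v) \<le> norm_Hminus1 \<Omega> f"
      unfolding norm_Hminus1_def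
    proof (rule cSup_upper)
      show "f v / l2_norm \<Omega> (weak_jacobian \<Omega> v)
          \<in> {f v / l2_norm \<Omega> (weak_jacobian \<Omega> v) |v. v \<in> H01_vec \<Omega> \<and> \<not> ae_eq \<Omega> v (\<lambda>x. 0)}"
        using v nz by blast
      show "bdd_above {f v / l2_norm \<Omega> (weak_jacobian \<Omega> v) |v. v \<in> H01_vec \<Omega> \<and> \<not> ae_eq \<Omega> v (\<lambda>x. 0)}"
      proof (rule bdd_aboveI[of _ M])
        fix y assume "y \<in> {f v / l2_norm \<Omega> (weak_jacobian \<Omega> v) |v. v \<in> H01_vec \<Omega> \<and> \<not> ae_eq \<Omega> v (\<lambda>x. 0)}"
        then obtain w where w: "y = f w / l2_norm \<Omega> (weak_jacobian \<Omega> w)" "w \<in> H01_vec \<Omega>" "\<not> ae_eq \<Omega> w (\<lambda>x. 0)"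
          by blast
        then show "y \<le> M" using M[OF w(2)] pos[OF w(2,3)] by (simp add: pos_divide_le_eq)
      qed
    qed
    then show ?thesis using p by (simp add: pos_divide_le_eq)
  qed
qed

end

text \<open>All quotients in the supremum are zero.\<close>

lemma inf_sup_stable_injective:
  assumes stable: "inf_sup_stable \<Omega> \<T> V Q" and T: "T \<in> \<T>" and V: "V T \<noteq> {}" and q: "q \<in> Q T" "q \<in> L2 \<Omega>"
    and orth: "\<And>v. v \<in> V T \<Longrightarrow> l2_inner \<Omega> (weak_div \<Omega> v) q = 0"
  shows "ae_eq \<Omega> q (\<lambda>x. 0)"
proof -
  obtain \<beta> where \<beta>: "\<beta> > 0" "\<beta> * l2_norm \<Omega> q \<le>
      (SUP v\<in>V T. l2_inner \<Omega> (weak_div \<Omega> v) q / l2_norm \<Omega> (weak_jacobian \<Omega> v))"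
    using stable T q(1) unfolding inf_sup_stable_def by blast
  have "(\<lambda>v. l2_inner \<Omega> (weak_div \<Omega> v) q / l2_norm \<Omega> (weak_jacobian \<Omega> v)) ` V T = {0}"
    using V orth by force
  then have "\<beta> * l2_norm \<Omega> q \<le> 0" using \<beta>(2) by simp
  then have "l2_norm \<Omega> q = 0" using \<beta>(1) l2_norm_nonneg[of \<Omega> q] by (simp add: mult_le_0_iff)
  then show ?thesis using l2_norm_eq_0_iff[OF q(2)] by simp
qed

section \<open>Well-posedness\<close>

theorem theorem4:
  fixes \<Omega> :: "(real^3) set"
    and R\<^sub>e R\<^sub>m S :: real
    and \<T> :: "mesh set" and T\<^sub>h :: mesh
    and G W Q :: "mesh \<Rightarrow> scalar_field set"
    and N D V :: "mesh \<Rightarrow> vector_field set"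
  assumes "bounded \<Omega>" and "contractible \<Omega>" and "lipschitz_polyhedron \<Omega>"
    and "R\<^sub>e > 0" and "R\<^sub>m > 0" and "S > 0"
    and "\<forall>T\<in>\<T>. simplicial_mesh \<Omega> T" and "shape_regular \<T>" and "quasi_uniform \<T>"
    and "standard_de_rham \<Omega> G N D W"
    and "\<forall>T\<in>\<T>. exact_complex \<Omega> (G T) (N T) (D T) (W T)"
    and "\<forall>T\<in>\<T>. stokes_fe_pair \<Omega> T (V T) (Q T)" and "inf_sup_stable \<Omega> \<T> V Q"
    and "T\<^sub>h \<in> \<T>"
  defines "solution \<equiv> mhd_solution \<Omega> R\<^sub>e R\<^sub>m S (V T\<^sub>h) (N T\<^sub>h) (D T\<^sub>h) (Q T\<^sub>h) (W T\<^sub>h)"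
  shows "(\<forall>f\<in>Hminus1 \<Omega>. \<exists>u E B p r. solution f u E B p r) \<and>
         (\<exists>\<epsilon>>0. \<forall>f\<in>Hminus1 \<Omega>. norm_Hminus1 \<Omega> f \<le> \<epsilon> \<longrightarrow>
            (\<forall>u E B p r u' E' B' p' r'.
               solution f u E B p r \<longrightarrow> solution f u' E' B' p' r' \<longrightarrow>
               ae_eq \<Omega> u u' \<and> ae_eq \<Omega> E E' \<and> ae_eq \<Omega> B B' \<and> ae_eq \<Omega> p p' \<and> ae_eq \<Omega> r r'))"
proof -
  interpret bounded_open \<Omega>
    using assms(1,3) by unfold_locales (simp_all add: lipschitz_polyhedron_def)
  have mesh: "simplicial_mesh \<Omega> T\<^sub>h" and exact: "exact_complex \<Omega> (G T\<^sub>h) (N T\<^sub>h) (D T\<^sub>h) (W T\<^sub>h)"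
    and stokes: "stokes_fe_pair \<Omega> T\<^sub>h (V T\<^sub>h) (Q T\<^sub>h)"
    using assms(7,11,12,14) by auto
  note spaces = standard_de_rham_spaces[OF assms(10) mesh]
  have Vlin: "linear_space (V T\<^sub>h)" "V T\<^sub>h \<subseteq> H01_vec \<Omega>" and Qlin: "linear_space (Q T\<^sub>h)" "Q T\<^sub>h \<subseteq> L2 \<Omega>"
    using stokes by (auto simp: stokes_fe_pair_def L2_mean_zero_def)
  obtain T' m where T': "simplicial_mesh \<Omega> T'" "V T\<^sub>h \<subseteq> piecewise T' (poly_deg_vec m)" "Q T\<^sub>h \<subseteq> piecewise T' (poly_deg m)"
    using stokes by (auto simp: stokes_fe_pair_def)
  have VL: "V T\<^sub>h \<subseteq> L2 \<Omega>" using Vlin(2) H01_vec_L2 by blast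
  note Vfin = piecewise_finite_dim[OF T'(1) finitely_generated_poly_deg_vec T'(2) VL]
  note Qfin = piecewise_finite_dim[OF T'(1) finitely_generated_poly_deg T'(3) Qlin(2)]
  interpret mhd_spaces \<Omega> R\<^sub>e R\<^sub>m S "V T\<^sub>h" "N T\<^sub>h" "D T\<^sub>h" "Q T\<^sub>h" "W T\<^sub>h"
  proof unfold_locales
    show "W T\<^sub>h \<subseteq> L2 \<Omega>" using spaces(10) by (auto simp: L2_mean_zero_def)
    show "weak_curl \<Omega> E \<in> D T\<^sub>h" "ae_eq \<Omega> (weak_div \<Omega> (weak_curl \<Omega> E)) (\<lambda>x. 0)" if "E \<in> N T\<^sub>h" for E
      using exact that ae_eq_refl unfolding exact_complex_def by blast+
    show "weak_div \<Omega> B \<in> W T\<^sub>h" if "B \<in> D T\<^sub>h" for B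
      using exact that unfolding exact_complex_def by blast
    show "\<exists>E\<in>N T\<^sub>h. ae_eq \<Omega> B (weak_curl \<Omega> E)" if "B \<in> D T\<^sub>h" "ae_eq \<Omega> (weak_div \<Omega> B) (\<lambda>x. 0)" for B
      using exact that unfolding exact_complex_def by blast
    show "\<exists>B\<in>D T\<^sub>h. ae_eq \<Omega> s (weak_div \<Omega> B)" if "s \<in> W T\<^sub>h" for s
      using exact that unfolding exact_complex_def by blast
    show "ae_eq \<Omega> q (\<lambda>x. 0)" if "q \<in> Q T\<^sub>h" "\<And>v. v \<in> V T\<^sub>h \<Longrightarrow> l2_inner \<Omega> (weak_div \<Omega> v) q = 0" for q
      using linear_space_zero[OF Vlin(1)] Qlin(2) that
      by (intro inf_sup_stable_injective[OF assms(13,14)]) auto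
  qed (fact assms Vlin Qlin spaces Vfin Qfin)+
  have sol: "solution = mhd_spaces.solution \<Omega> R\<^sub>e R\<^sub>m S (V T\<^sub>h) (N T\<^sub>h) (D T\<^sub>h) (Q T\<^sub>h) (W T\<^sub>h)"
    unfolding assms(15) by (intro ext) (simp add: solution_def)
  show ?thesis
  proof (intro conjI ballI)
    fix f assume f: "f \<in> Hminus1 \<Omega>"
    obtain M where "0 \<le> M" "\<And>v. v \<in> V T\<^sub>h \<Longrightarrow> f v \<le> M * nrm (jac v)"
      using Hminus1_bound[OF f] Vlin(2) by blast
    from solution_exists[OF Hminus1_form[OF f Vlin] this]
    show "\<exists>u E B p r. solution f u E B p r" unfolding sol .
  next
    obtain \<epsilon> where \<epsilon>: "\<epsilon> > 0" and uniq: "\<And>f u E B p r u' E' B' p' r'. \<lbrakk>\<forall>v\<in>V T\<^sub>h. f v \<le> \<epsilon> * nrm (jac v);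
        mhd_spaces.solution \<Omega> R\<^sub>e R\<^sub>m S (V T\<^sub>h) (N T\<^sub>h) (D T\<^sub>h) (Q T\<^sub>h) (W T\<^sub>h) f u E B p r;
        mhd_spaces.solution \<Omega> R\<^sub>e R\<^sub>m S (V T\<^sub>h) (N T\<^sub>h) (D T\<^sub>h) (Q T\<^sub>h) (W T\<^sub>h) f u' E' B' p' r'\<rbrakk> \<Longrightarrow>
        ae_eq \<Omega> u u' \<and> ae_eq \<Omega> E E' \<and> ae_eq \<Omega> B B' \<and> ae_eq \<Omega> p p' \<and> ae_eq \<Omega> r r'"
      using small_data_uniqueness by metis
    have small: "\<forall>v\<in>V T\<^sub>h. f v \<le> \<epsilon> * nrm (jac v)" if f: "f \<in> Hminus1 \<Omega>" "norm_Hminus1 \<Omega> f \<le> \<epsilon>" for f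
    proof
      fix v assume "v \<in> V T\<^sub>h"
      then have "f v \<le> norm_Hminus1 \<Omega> f * nrm (jac v)" using norm_Hminus1_bound[OF f(1)] Vlin(2) by blast
      also have "\<dots> \<le> \<epsilon> * nrm (jac v)" using f(2) by (rule mult_right_mono) simp
      finally show "f v \<le> \<epsilon> * nrm (jac v)" .
    qed
    show "\<exists>\<epsilon>>0. \<forall>f\<in>Hminus1 \<Omega>. norm_Hminus1 \<Omega> f \<le> \<epsilon> \<longrightarrow>
        (\<forall>u E B p r u' E' B' p' r'. solution f u E B p r \<longrightarrow> solution f u' E' B' p' r' \<longrightarrow>
           ae_eq \<Omega> u u' \<and> ae_eq \<Omega> E E' \<and> ae_eq \<Omega> B B' \<and> ae_eq \<Omega> p p' \<and> ae_eq \<Omega> r r')"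
      unfolding sol by (intro exI[of _ \<epsilon>] conjI[OF \<epsilon>] ballI impI allI) (rule uniq[OF small])
  qed
qed

end
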